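(* Let $\pi:(M,\phi,\xi,\eta,g_M)\to(N,g_N)$ be a conformal anti-invariant $\xi^\perp$-submersion with dilation $\lambda$ from a Sasakian manifold $(M,\phi,\xi,\eta,g_M)$ onto a Riemannian manifold $(N,g_N)$. Then the following assertions are equivalent: (a) the distribution $(\ker\pi_* )^\perp$ is integrable; (b) for all $X,Y\in\Gamma((\ker\pi_* )^\perp)$ and $V\in\Gamma(\ker\pi_* )$, $$\frac{1}{\lambda^{2}}g_N\big(\nabla^{\pi}_{Y}\pi_*\mathcal{C}X-\nabla^{\pi}_{X}\pi_*\mathcal{C}Y,\pi_*\phi V\big)=g_M\big(A_X\mathcal{B}Y-A_Y\mathcal{B}X-(\mathcal{C}Y)(\ln\lambda)X+(\mathcal{C}X)(\ln\lambda)Y-2g_M(\mathcal{C}X,Y)\,\mathrm{grad}\ln\lambda-\eta(Y)X+\eta(X)Y,\ \phi V\big).$$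
   Context: Everything is smooth. An almost contact metric manifold $(M,\phi,\xi,\eta,g_M)$ is a Riemannian manifold with a $(1,1)$-tensor field $\phi$, a vector field $\xi$ and a 1-form $\eta$ with $\phi\xi=0$, $\eta\circ\phi=0$, $\eta(\xi)=1$, $\phi^2=-I+\eta\otimes\xi$, $g_M(\phi X,\phi Y)=g_M(X,Y)-\eta(X)\eta(Y)$. It is Sasakian (in the sign convention used here) if $(\nabla_X\phi)Y=-g_M(X,Y)\xi+\eta(Y)X$ and $\nabla_X\xi=\phi X$, with $\nabla$ the Levi-Civita connection of $g_M$. A horizontally conformal submersion $\pi:(M,g_M)\to(N,g_N)$ with dilation $\lambda$ ($\lambda$ a positive function on $M$) is a submersion with $\lambda^2g_M(X,Y)=g_N(\pi_*X,\pi_*Y)$ for all $X,Y\in\Gamma((\ker\pi_* )^\perp)$. A conformal anti-invariant $\xi^\perp$-submersion is a horizontally conformal submersion from an almost contact metric manifold to a Riemannian manifold such that $\xi$ is normal to $\ker\pi_*$ and $\phi(\ker\pi_* )\subset(\ker\pi_* )^\perp$. Let $\mu$ be the orthogonal complement of $\phi(\ker\pi_* )$ in $(\ker\pi_* )^\perp$ (it is $\phi$-invariant and contains $\xi$). For $X\in\Gamma((\ker\pi_* )^\perp)$ write $\phi X=\mathcal{B}X+\mathcal{C}X$ with $\mathcal{B}X\in\Gamma(\ker\pi_* )$, $\mathcal{C}X\in\Gamma(\mu)$. $\mathcal{V},\mathcal{H}$ are the projections onto $\ker\pi_*$ and $(\ker\pi_* )^\perp$; O'Neill's tensor $A$ is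 $A_EF=\mathcal{V}\nabla_{\mathcal{H}E}\mathcal{H}F+\mathcal{H}\nabla_{\mathcal{H}E}\mathcal{V}F$. $\nabla^\pi$ is the pullback to $\pi^{-1}TN$ of the Levi-Civita connection of $N$. $Z(\ln\lambda)$ denotes the derivative of $\ln\lambda$ along $Z$. *)

theory Defs
  imports "HOL-Analysis.Analysis" "HOL-Library.Function_Algebras"
begin

section \<open>Smooth manifolds, functions and maps\<close>

primrec Ck_on :: "nat \<Rightarrow> 'v::real_normed_vector set \<Rightarrow> ('v \<Rightarrow> 'w::real_normed_vector) \<Rightarrow> bool" where
  "Ck_on 0 S f \<longleftrightarrow> continuous_on S f"
| "Ck_on (Suc k) S f \<longleftrightarrow> (\<forall>x\<in>S. f differentiable (at x)) \<and>
     (\<forall>v. Ck_on k S (\<lambda>x. frechet_derivative f (at x) v))"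

text \<open>The set \<open>S\<close> is meant to be open.\<close>

definition smooth_on :: "'v::real_normed_vector set \<Rightarrow> ('v \<Rightarrow> 'w::real_normed_vector) \<Rightarrow> bool" where
  "smooth_on S f \<longleftrightarrow> (\<forall>k. Ck_on k S f)"

text \<open>The points of a manifold are the points of \<open>mtop\<close>, which need not exhaust the type \<open>'a\<close>. A
  chart is a pair of a domain \<open>U\<close> and a map \<open>\<kappa>\<close> whose values outside \<open>U\<close> are irrelevant. The atlas
  need not be maximal. As \<open>'e\<close> is a Euclidean space, the dimension \<open>DIM('e)\<close> is positive.\<close>

record ('a, 'e) mfd =
  mtop :: "'a topology"
  atlas :: "('a set \<times> ('a \<Rightarrow> 'e)) set"

abbreviation points :: "('a, 'e) mfd \<Rightarrow> 'a set" where
  "points M \<equiv> topspace (mtop M)"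

definition smooth_manifold :: "('a, 'e::euclidean_space) mfd \<Rightarrow> bool" where
  "smooth_manifold M \<longleftrightarrow>
     Hausdorff_space (mtop M) \<and> second_countable (mtop M) \<and>
     \<Union> (fst ` atlas M) = points M \<and>
     (\<forall>(U, \<kappa>) \<in> atlas M. openin (mtop M) U \<and> open (\<kappa> ` U) \<and>
        homeomorphic_map (subtopology (mtop M) U) (top_of_set (\<kappa> ` U)) \<kappa>) \<and>
     (\<forall>(U, \<kappa>) \<in> atlas M. \<forall>(U', \<kappa>') \<in> atlas M.
        smooth_on (\<kappa> ` (U \<inter> U')) (\<kappa>' \<circ> inv_into U \<kappa>))"

definition Cinf :: "('a, 'e::euclidean_space) mfd \<Rightarrow> ('a \<Rightarrow> real) set" where
  "Cinf M = {f. \<forall>(U, \<kappa>) \<in> atlas M. smooth_on (\<kappa> ` U) (f \<circ> inv_into U \<kappa>)}"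

definition smooth_map ::
  "('a, 'e::euclidean_space) mfd \<Rightarrow> ('b, 'f::euclidean_space) mfd \<Rightarrow> ('a \<Rightarrow> 'b) \<Rightarrow> bool" where
  "smooth_map M N F \<longleftrightarrow> continuous_map (mtop M) (mtop N) F \<and>
     (\<forall>(U, \<kappa>) \<in> atlas M. \<forall>(V, \<psi>) \<in> atlas N.
        smooth_on (\<kappa> ` (U \<inter> F -` V)) (\<psi> \<circ> F \<circ> inv_into U \<kappa>))"

section \<open>Tangent vectors and vector fields\<close>

text \<open>A tangent vector at \<open>p\<close> is a derivation at \<open>p\<close> of the algebra of smooth functions. It is
  required to vanish on functions that are not smooth, so that derivations that agree on smooth
  functions are equal. Sums and differences of tangent vectors and of vector fields are those of
  \<^theory>\<open>HOL-Library.Function_Algebras\<close>.\<close>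

type_synonym 'a tvec = "('a \<Rightarrow> real) \<Rightarrow> real"

definition tscale :: "real \<Rightarrow> 'a tvec \<Rightarrow> 'a tvec" (infixr "\<cdot>" 75) where
  "c \<cdot> v = (\<lambda>f. c * v f)"

definition tangent_space :: "('a, 'e::euclidean_space) mfd \<Rightarrow> 'a \<Rightarrow> 'a tvec set" where
  "tangent_space M p = {v.
     (\<forall>f\<in>Cinf M. \<forall>h\<in>Cinf M. \<forall>a b. v (\<lambda>x. a * f x + b * h x) = a * v f + b * v h) \<and>
     (\<forall>f\<in>Cinf M. \<forall>h\<in>Cinf M. v (\<lambda>x. f x * h x) = f p * v h + h p * v f) \<and>
     (\<forall>f. f \<notin> Cinf M \<longrightarrow> v f = 0)}"

text \<open>The differential of a map into \<open>N\<close>. The base point is implicit in the derivation.\<close>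

definition pushfwd :: "('b, 'f::euclidean_space) mfd \<Rightarrow> ('a \<Rightarrow> 'b) \<Rightarrow> 'a tvec \<Rightarrow> 'b tvec" where
  "pushfwd N F v = (\<lambda>h. if h \<in> Cinf N then v (h \<circ> F) else 0)"

text \<open>Smooth vector fields along \<open>F\<close>, that is, smooth sections of the pullback of the tangent bundle
  of \<open>N\<close> by \<open>F\<close>. Fields are set to \<open>0\<close> outside the manifold, so that equality of fields is equality
  of functions.\<close>

definition fields_along ::
  "('a, 'e::euclidean_space) mfd \<Rightarrow> ('b, 'f::euclidean_space) mfd \<Rightarrow> ('a \<Rightarrow> 'b) \<Rightarrow>
   ('a \<Rightarrow> 'b tvec) set" where
  "fields_along M N F = {W.
     (\<forall>p\<in>points M. W p \<in> tangent_space N (F p)) \<and>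
     (\<forall>p. p \<notin> points M \<longrightarrow> W p = 0) \<and>
     (\<forall>h\<in>Cinf N. (\<lambda>p. W p h) \<in> Cinf M)}"

definition vector_fields :: "('a, 'e::euclidean_space) mfd \<Rightarrow> ('a \<Rightarrow> 'a tvec) set" where
  "vector_fields M = fields_along M M id"

definition fscale :: "('a \<Rightarrow> real) \<Rightarrow> ('a \<Rightarrow> 'b tvec) \<Rightarrow> 'a \<Rightarrow> 'b tvec" where
  "fscale f W = (\<lambda>p. f p \<cdot> W p)"

definition lie_bracket :: "('a \<Rightarrow> 'a tvec) \<Rightarrow> ('a \<Rightarrow> 'a tvec) \<Rightarrow> 'a \<Rightarrow> 'a tvec" where
  "lie_bracket X Y = (\<lambda>p f. X p (\<lambda>q. Y q f) - Y p (\<lambda>q. X q f))"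

text \<open>The field obtained by applying fibrewise maps \<open>L p\<close> to a field \<open>X\<close>.\<close>

definition along ::
  "('a, 'e) mfd \<Rightarrow> ('a \<Rightarrow> 'b tvec \<Rightarrow> 'c tvec) \<Rightarrow> ('a \<Rightarrow> 'b tvec) \<Rightarrow> 'a \<Rightarrow> 'c tvec" where
  "along M L X = (\<lambda>p. if p \<in> points M then L p (X p) else 0)"

section \<open>Distributions and integrability\<close>

text \<open>A distribution is given by its fibres. Its sections are smooth.\<close>

definition sections :: "('a, 'e::euclidean_space) mfd \<Rightarrow> ('a \<Rightarrow> 'a tvec set) \<Rightarrow> ('a \<Rightarrow> 'a tvec) set" where
  "sections M D = {X \<in> vector_fields M. \<forall>p\<in>points M. X p \<in> D p}"

definition immersion ::
  "('a, 'e::euclidean_space) mfd \<Rightarrow> ('b, 'f::euclidean_space) mfd \<Rightarrow> ('a \<Rightarrow> 'b) \<Rightarrow> bool" where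
  "immersion M N F \<longleftrightarrow> smooth_map M N F \<and>
     (\<forall>p\<in>points M. inj_on (pushfwd N F) (tangent_space M p))"

text \<open>An integral manifold of \<open>D\<close> is an immersed submanifold \<open>S\<close>, a subset of the points of \<open>M\<close> with
  its own topology and atlas such that the inclusion is an immersion, whose tangent spaces are the
  fibres of \<open>D\<close>.\<close>

definition integral_manifold ::
  "('a, 'e::euclidean_space) mfd \<Rightarrow> ('a \<Rightarrow> 'a tvec set) \<Rightarrow> ('a, 'r::euclidean_space) mfd \<Rightarrow> bool" where
  "integral_manifold M D S \<longleftrightarrow> smooth_manifold S \<and> immersion S M id \<and>
     (\<forall>q\<in>points S. pushfwd M id ` tangent_space S q = D q)"

text \<open>The type \<open>'r\<close> fixes the dimension of the integral manifolds, that is, the rank of \<open>D\<close>.\<close>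

definition integrable_distribution ::
  "'r::euclidean_space itself \<Rightarrow> ('a, 'e::euclidean_space) mfd \<Rightarrow> ('a \<Rightarrow> 'a tvec set) \<Rightarrow> bool" where
  "integrable_distribution _ M D \<longleftrightarrow>
     (\<forall>p\<in>points M. \<exists>S :: ('a, 'r) mfd. integral_manifold M D S \<and> p \<in> points S)"

section \<open>Riemannian metrics and connections\<close>

type_synonym 'a metric_tensor = "'a \<Rightarrow> 'a tvec \<Rightarrow> 'a tvec \<Rightarrow> real"

definition riemannian_metric :: "('a, 'e::euclidean_space) mfd \<Rightarrow> 'a metric_tensor \<Rightarrow> bool" where
  "riemannian_metric M g \<longleftrightarrow>
     (\<forall>p\<in>points M. \<forall>u\<in>tangent_space M p. \<forall>v\<in>tangent_space M p.
        g p u v = g p v u \<and> (u \<noteq> 0 \<longrightarrow> g p u u > 0) \<and>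
        (\<forall>w\<in>tangent_space M p. \<forall>a b. g p (a \<cdot> u + b \<cdot> v) w = a * g p u w + b * g p v w)) \<and>
     (\<forall>X\<in>vector_fields M. \<forall>Y\<in>vector_fields M. (\<lambda>p. g p (X p) (Y p)) \<in> Cinf M)"

definition grad :: "('a, 'e::euclidean_space) mfd \<Rightarrow> 'a metric_tensor \<Rightarrow> ('a \<Rightarrow> real) \<Rightarrow> 'a \<Rightarrow> 'a tvec" where
  "grad M g f p = (THE v. v \<in> tangent_space M p \<and> (\<forall>w\<in>tangent_space M p. g p v w = w f))"

text \<open>A connection on a vector bundle over \<open>M\<close> with \<open>E\<close> as its module of smooth sections.\<close>

definition connection ::
  "('a, 'e::euclidean_space) mfd \<Rightarrow> ('a \<Rightarrow> 'b tvec) set \<Rightarrow>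
   (('a \<Rightarrow> 'a tvec) \<Rightarrow> ('a \<Rightarrow> 'b tvec) \<Rightarrow> ('a \<Rightarrow> 'b tvec)) \<Rightarrow> bool" where
  "connection M E nab \<longleftrightarrow>
     (\<forall>X\<in>vector_fields M. \<forall>W\<in>E. nab X W \<in> E) \<and>
     (\<forall>X\<in>vector_fields M. \<forall>Y\<in>vector_fields M. \<forall>W\<in>E. nab (X + Y) W = nab X W + nab Y W) \<and>
     (\<forall>f\<in>Cinf M. \<forall>X\<in>vector_fields M. \<forall>W\<in>E. nab (fscale f X) W = fscale f (nab X W)) \<and>
     (\<forall>X\<in>vector_fields M. \<forall>W\<in>E. \<forall>Z\<in>E. nab X (W + Z) = nab X W + nab X Z) \<and>
     (\<forall>f\<in>Cinf M. \<forall>X\<in>vector_fields M. \<forall>W\<in>E.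
        nab X (fscale f W) = fscale (\<lambda>p. X p f) W + fscale f (nab X W))"

definition levi_civita ::
  "('a, 'e::euclidean_space) mfd \<Rightarrow> 'a metric_tensor \<Rightarrow>
   (('a \<Rightarrow> 'a tvec) \<Rightarrow> ('a \<Rightarrow> 'a tvec) \<Rightarrow> ('a \<Rightarrow> 'a tvec)) \<Rightarrow> bool" where
  "levi_civita M g nab \<longleftrightarrow> connection M (vector_fields M) nab \<and>
     (\<forall>X\<in>vector_fields M. \<forall>Y\<in>vector_fields M. nab X Y - nab Y X = lie_bracket X Y) \<and>
     (\<forall>X\<in>vector_fields M. \<forall>Y\<in>vector_fields M. \<forall>Z\<in>vector_fields M. \<forall>p\<in>points M.
        X p (\<lambda>q. g q (Y q) (Z q)) = g p (nab X Y p) (Z p) + g p (Y p) (nab X Z p))"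

text \<open>The pullback by \<open>F\<close> of a connection \<open>nabN\<close> on the tangent bundle of \<open>N\<close> is the connection on
  fields along \<open>F\<close> whose value on \<open>Z \<circ> F\<close> in the direction \<open>v\<close> is the covariant derivative of \<open>Z\<close> in
  the direction of the image of \<open>v\<close>. The latter is computed with an arbitrary extension \<open>V\<close> of this
  image to a vector field on \<open>N\<close>.\<close>

definition pullback_connection ::
  "('a, 'e::euclidean_space) mfd \<Rightarrow> ('b, 'f::euclidean_space) mfd \<Rightarrow> ('a \<Rightarrow> 'b) \<Rightarrow>
   (('b \<Rightarrow> 'b tvec) \<Rightarrow> ('b \<Rightarrow> 'b tvec) \<Rightarrow> ('b \<Rightarrow> 'b tvec)) \<Rightarrow>
   (('a \<Rightarrow> 'a tvec) \<Rightarrow> ('a \<Rightarrow> 'b tvec) \<Rightarrow> ('a \<Rightarrow> 'b tvec)) \<Rightarrow> bool" where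
  "pullback_connection M N F nabN nab \<longleftrightarrow> connection M (fields_along M N F) nab \<and>
     (\<forall>X\<in>vector_fields M. \<forall>Z\<in>vector_fields N. \<forall>p\<in>points M. \<forall>V\<in>vector_fields N.
        V (F p) = pushfwd N F (X p) \<longrightarrow>
        nab X (\<lambda>q. if q \<in> points M then Z (F q) else 0) p = nabN V Z (F p))"

section \<open>Almost contact metric and Sasakian manifolds\<close>

definition tensor11 :: "('a, 'e::euclidean_space) mfd \<Rightarrow> ('a \<Rightarrow> 'a tvec \<Rightarrow> 'a tvec) \<Rightarrow> bool" where
  "tensor11 M L \<longleftrightarrow>
     (\<forall>p\<in>points M. \<forall>u\<in>tangent_space M p. \<forall>v\<in>tangent_space M p.
        L p u \<in> tangent_space M p \<and> (\<forall>a b. L p (a \<cdot> u + b \<cdot> v) = a \<cdot> L p u + b \<cdot> L p v)) \<and>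
     (\<forall>X\<in>vector_fields M. along M L X \<in> vector_fields M)"

definition one_form :: "('a, 'e::euclidean_space) mfd \<Rightarrow> ('a \<Rightarrow> 'a tvec \<Rightarrow> real) \<Rightarrow> bool" where
  "one_form M \<omega> \<longleftrightarrow>
     (\<forall>p\<in>points M. \<forall>u\<in>tangent_space M p. \<forall>v\<in>tangent_space M p. \<forall>a b.
        \<omega> p (a \<cdot> u + b \<cdot> v) = a * \<omega> p u + b * \<omega> p v) \<and>
     (\<forall>X\<in>vector_fields M. (\<lambda>p. \<omega> p (X p)) \<in> Cinf M)"

definition almost_contact_metric ::
  "('a, 'e::euclidean_space) mfd \<Rightarrow> ('a \<Rightarrow> 'a tvec \<Rightarrow> 'a tvec) \<Rightarrow> ('a \<Rightarrow> 'a tvec) \<Rightarrow>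
   ('a \<Rightarrow> 'a tvec \<Rightarrow> real) \<Rightarrow> 'a metric_tensor \<Rightarrow> bool" where
  "almost_contact_metric M \<phi> \<xi> \<eta> g \<longleftrightarrow>
     smooth_manifold M \<and> riemannian_metric M g \<and>
     tensor11 M \<phi> \<and> \<xi> \<in> vector_fields M \<and> one_form M \<eta> \<and>
     (\<forall>p\<in>points M. \<phi> p (\<xi> p) = 0 \<and> \<eta> p (\<xi> p) = 1 \<and>
        (\<forall>u\<in>tangent_space M p. \<eta> p (\<phi> p u) = 0 \<and> \<phi> p (\<phi> p u) = - u + \<eta> p u \<cdot> \<xi> p \<and>
           (\<forall>v\<in>tangent_space M p. g p (\<phi> p u) (\<phi> p v) = g p u v - \<eta> p u * \<eta> p v)))"

text \<open>The sign convention is the one in which the covariant derivative of \<open>\<xi>\<close> is \<open>\<phi>\<close>.\<close>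

definition sasakian ::
  "('a, 'e::euclidean_space) mfd \<Rightarrow> ('a \<Rightarrow> 'a tvec \<Rightarrow> 'a tvec) \<Rightarrow> ('a \<Rightarrow> 'a tvec) \<Rightarrow>
   ('a \<Rightarrow> 'a tvec \<Rightarrow> real) \<Rightarrow> 'a metric_tensor \<Rightarrow>
   (('a \<Rightarrow> 'a tvec) \<Rightarrow> ('a \<Rightarrow> 'a tvec) \<Rightarrow> ('a \<Rightarrow> 'a tvec)) \<Rightarrow> bool" where
  "sasakian M \<phi> \<xi> \<eta> g nab \<longleftrightarrow>
     almost_contact_metric M \<phi> \<xi> \<eta> g \<and> levi_civita M g nab \<and>
     (\<forall>X\<in>vector_fields M. \<forall>Y\<in>vector_fields M. \<forall>p\<in>points M.
        nab X (along M \<phi> Y) p - \<phi> p (nab X Y p) = - (g p (X p) (Y p) \<cdot> \<xi> p) + \<eta> p (Y p) \<cdot> X p) \<and>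
     (\<forall>X\<in>vector_fields M. nab X \<xi> = along M \<phi> X)"

section \<open>Conformal anti-invariant submersions\<close>

text \<open>The kernel of the differential of \<open>F\<close> and its orthogonal complement.\<close>

definition ver ::
  "('a, 'e::euclidean_space) mfd \<Rightarrow> ('b, 'f::euclidean_space) mfd \<Rightarrow> ('a \<Rightarrow> 'b) \<Rightarrow> 'a \<Rightarrow> 'a tvec set" where
  "ver M N F p = {v \<in> tangent_space M p. pushfwd N F v = 0}"

definition hor ::
  "('a, 'e::euclidean_space) mfd \<Rightarrow> 'a metric_tensor \<Rightarrow> ('b, 'f::euclidean_space) mfd \<Rightarrow> ('a \<Rightarrow> 'b) \<Rightarrow>
   'a \<Rightarrow> 'a tvec set" where
  "hor M g N F p = {v \<in> tangent_space M p. \<forall>w\<in>ver M N F p. g p v w = 0}"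

definition submersion ::
  "('a, 'e::euclidean_space) mfd \<Rightarrow> ('b, 'f::euclidean_space) mfd \<Rightarrow> ('a \<Rightarrow> 'b) \<Rightarrow> bool" where
  "submersion M N F \<longleftrightarrow> smooth_map M N F \<and>
     (\<forall>p\<in>points M. pushfwd N F ` tangent_space M p = tangent_space N (F p))"

definition horizontally_conformal_submersion ::
  "('a, 'e::euclidean_space) mfd \<Rightarrow> 'a metric_tensor \<Rightarrow> ('b, 'f::euclidean_space) mfd \<Rightarrow>
   'b metric_tensor \<Rightarrow> ('a \<Rightarrow> 'b) \<Rightarrow> ('a \<Rightarrow> real) \<Rightarrow> bool" where
  "horizontally_conformal_submersion M gM N gN F dil \<longleftrightarrow>
     submersion M N F \<and> dil \<in> Cinf M \<and>
     (\<forall>p\<in>points M. dil p > 0 \<and>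
        (\<forall>u\<in>hor M gM N F p. \<forall>v\<in>hor M gM N F p.
           (dil p)\<^sup>2 * gM p u v = gN (F p) (pushfwd N F u) (pushfwd N F v)))"

definition conformal_anti_invariant_xi_perp_submersion ::
  "('a, 'e::euclidean_space) mfd \<Rightarrow> ('a \<Rightarrow> 'a tvec \<Rightarrow> 'a tvec) \<Rightarrow> ('a \<Rightarrow> 'a tvec) \<Rightarrow>
   ('a \<Rightarrow> 'a tvec \<Rightarrow> real) \<Rightarrow> 'a metric_tensor \<Rightarrow>
   ('b, 'f::euclidean_space) mfd \<Rightarrow> 'b metric_tensor \<Rightarrow> ('a \<Rightarrow> 'b) \<Rightarrow> ('a \<Rightarrow> real) \<Rightarrow> bool" where
  "conformal_anti_invariant_xi_perp_submersion M \<phi> \<xi> \<eta> gM N gN F dil \<longleftrightarrow>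
     almost_contact_metric M \<phi> \<xi> \<eta> gM \<and> smooth_manifold N \<and> riemannian_metric N gN \<and>
     horizontally_conformal_submersion M gM N gN F dil \<and>
     (\<forall>p\<in>points M. \<xi> p \<in> hor M gM N F p \<and> \<phi> p ` ver M N F p \<subseteq> hor M gM N F p)"

text \<open>The orthogonal complement of the image of the vertical space under \<open>\<phi>\<close> in the horizontal space.\<close>

definition mu ::
  "('a, 'e::euclidean_space) mfd \<Rightarrow> ('a \<Rightarrow> 'a tvec \<Rightarrow> 'a tvec) \<Rightarrow> 'a metric_tensor \<Rightarrow>
   ('b, 'f::euclidean_space) mfd \<Rightarrow> ('a \<Rightarrow> 'b) \<Rightarrow> 'a \<Rightarrow> 'a tvec set" where
  "mu M \<phi> g N F p = {v \<in> hor M g N F p. \<forall>w\<in>ver M N F p. g p v (\<phi> p w) = 0}"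

text \<open>For horizontal \<open>v\<close>, the components of \<open>\<phi> v\<close> in the vertical space and in \<^const>\<open>mu\<close>.\<close>

definition Bpart ::
  "('a, 'e::euclidean_space) mfd \<Rightarrow> ('a \<Rightarrow> 'a tvec \<Rightarrow> 'a tvec) \<Rightarrow> 'a metric_tensor \<Rightarrow>
   ('b, 'f::euclidean_space) mfd \<Rightarrow> ('a \<Rightarrow> 'b) \<Rightarrow> 'a \<Rightarrow> 'a tvec \<Rightarrow> 'a tvec" where
  "Bpart M \<phi> g N F p v = (THE w. w \<in> ver M N F p \<and> \<phi> p v - w \<in> mu M \<phi> g N F p)"

definition Cpart ::
  "('a, 'e::euclidean_space) mfd \<Rightarrow> ('a \<Rightarrow> 'a tvec \<Rightarrow> 'a tvec) \<Rightarrow> 'a metric_tensor \<Rightarrow>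
   ('b, 'f::euclidean_space) mfd \<Rightarrow> ('a \<Rightarrow> 'b) \<Rightarrow> 'a \<Rightarrow> 'a tvec \<Rightarrow> 'a tvec" where
  "Cpart M \<phi> g N F p v = \<phi> p v - Bpart M \<phi> g N F p v"

definition vproj ::
  "('a, 'e::euclidean_space) mfd \<Rightarrow> 'a metric_tensor \<Rightarrow> ('b, 'f::euclidean_space) mfd \<Rightarrow> ('a \<Rightarrow> 'b) \<Rightarrow>
   'a \<Rightarrow> 'a tvec \<Rightarrow> 'a tvec" where
  "vproj M g N F p v = (THE w. w \<in> ver M N F p \<and> v - w \<in> hor M g N F p)"

definition hproj ::
  "('a, 'e::euclidean_space) mfd \<Rightarrow> 'a metric_tensor \<Rightarrow> ('b, 'f::euclidean_space) mfd \<Rightarrow> ('a \<Rightarrow> 'b) \<Rightarrow>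
   'a \<Rightarrow> 'a tvec \<Rightarrow> 'a tvec" where
  "hproj M g N F p v = v - vproj M g N F p v"

definition oneill_A ::
  "('a, 'e::euclidean_space) mfd \<Rightarrow> 'a metric_tensor \<Rightarrow> ('b, 'f::euclidean_space) mfd \<Rightarrow> ('a \<Rightarrow> 'b) \<Rightarrow>
   (('a \<Rightarrow> 'a tvec) \<Rightarrow> ('a \<Rightarrow> 'a tvec) \<Rightarrow> ('a \<Rightarrow> 'a tvec)) \<Rightarrow>
   ('a \<Rightarrow> 'a tvec) \<Rightarrow> ('a \<Rightarrow> 'a tvec) \<Rightarrow> 'a \<Rightarrow> 'a tvec" where
  "oneill_A M g N F nab E G =
     (let V = vproj M g N F; H = hproj M g N F
      in along M V (nab (along M H E) (along M H G)) + along M H (nab (along M H E) (along M V G)))"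

end

theory Submission
  imports Defs
begin

text \<open>Both assertions hold exactly when \<open>ker \<pi>\<^sub>* = 0\<close> at every point, and this is how their equivalence
  is proved.

  The reason is the contact structure. Let \<open>V\<close> be a vertical field. The fields \<open>\<xi>\<close> and \<open>\<phi> V\<close> are
  horizontal and orthogonal. Conformality makes the Lie derivative of the metric along \<open>V\<close>
  proportional to the metric on horizontal fields, hence
  \<open>g([V, \<xi>], \<phi> V) + g(\<xi>, [V, \<phi> V]) = 0\<close> (\<open>conformal_lie_bracket\<close>). Since \<open>\<nabla>\<^sub>X \<xi> = \<phi> X\<close>, this determines
  \<open>g(\<nabla>\<^sub>\<xi> V, \<phi> V) = - g(V, V)\<close> (\<open>nabla_xi_V\<close>), and then \<open>g([\<phi> V, \<xi>], V) = - 2 g(V, V)\<close>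
  (\<open>lie_bracket_phi_V_xi\<close>). So the bracket of the horizontal fields \<open>\<phi> V\<close> and \<open>\<xi>\<close> has a vertical part
  wherever \<open>V\<close> does not vanish. An integral manifold would force this bracket to be horizontal
  (\<open>integral_manifold_bracket\<close>). Likewise the two sides of the identity in the second assertion differ
  by \<open>2 g(V, V)\<close> for \<open>X = \<phi> V\<close> and \<open>Y = \<xi>\<close> (\<open>vertical_zero_if_identity\<close>). As every vertical vector
  extends to a vertical field (\<open>vertical_field_exists\<close>), each assertion implies \<open>ker \<pi>\<^sub>* = 0\<close>.

  Conversely let \<open>ker \<pi>\<^sub>* = 0\<close>. In the identity \<open>V = 0\<close>, and both sides vanish
  (\<open>identity_if_vertical_trivial\<close>). The horizontal distribution is the whole tangent bundle, and \<open>M\<close>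
  itself is an integral manifold once its charts are composed with a linear isomorphism between the
  model spaces, which have the same dimension because \<open>\<pi>\<^sub>*\<close> is bijective on tangent spaces
  (\<open>integrable_if_vertical_trivial\<close>).

  Tangent vectors are derivations of the algebra of global smooth functions. To compute with them one
  needs cut-off functions (\<open>bump_function\<close>, \<open>cutoff\<close>) and the Hadamard lemma (\<open>hadamard\<close>), which
  together show that coordinate fields span the tangent spaces (\<open>local_frame_exists\<close>).\<close>

section \<open>Calculus of smooth functions on Euclidean space\<close>

lemma Ck_on_cong:
  assumes "open S" "\<And>x. x \<in> S \<Longrightarrow> f x = g x" "Ck_on k S f"
  shows "Ck_on k S g"
  using assms(2,3)
proof (induction k arbitrary: f g)
  case 0
  then show ?case by (simp cong: continuous_on_cong)
next
  case (Suc k)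
  have d: "g differentiable (at x)" if x: "x \<in> S" for x
  proof -
    have "(f has_derivative frechet_derivative f (at x)) (at x)"
      using Suc.prems x by (simp flip: frechet_derivative_works)
    from has_derivative_transform_within_open[OF this assms(1) x] Suc.prems
    show ?thesis by (auto simp: differentiable_def)
  qed
  have e: "frechet_derivative f (at x) = frechet_derivative g (at x)" if "x \<in> S" for x
    using Suc.prems that frechet_derivative_transform_within_open[OF _ assms(1) that, of f g] by auto
  have "Ck_on k S (\<lambda>x. frechet_derivative g (at x) v)" for v
    by (rule Suc.IH[of "\<lambda>x. frechet_derivative f (at x) v"]) (use Suc.prems e in \<open>simp_all only: Ck_on.simps\<close>)
  with d show ?case by simp
qed

lemma Ck_on_subset: "Ck_on k S f \<Longrightarrow> T \<subseteq> S \<Longrightarrow> Ck_on k T f"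
  by (induction k arbitrary: f) (auto intro: continuous_on_subset)

lemma Ck_on_local:
  assumes "\<And>x. x \<in> S \<Longrightarrow> \<exists>T. open T \<and> x \<in> T \<and> Ck_on k T f"
  shows "Ck_on k S f"
  using assms
proof (induction k arbitrary: f)
  case 0
  show ?case
    unfolding Ck_on.simps
  proof (intro continuous_at_imp_continuous_on ballI)
    fix x assume "x \<in> S"
    with 0 obtain T where "open T" "x \<in> T" "continuous_on T f" by auto
    then show "isCont f x" by (simp add: continuous_on_eq_continuous_at)
  qed
next
  case (Suc k)
  have "Ck_on k S (\<lambda>x. frechet_derivative f (at x) v)" for v
    using Suc.prems by (intro Suc.IH) fastforce
  then show ?case using Suc.prems by fastforce
qed

lemma Ck_on_SucD: "Ck_on (Suc k) S f \<Longrightarrow> Ck_on k S f"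
  by (induction k arbitrary: f)
    (auto intro!: continuous_at_imp_continuous_on differentiable_imp_continuous_within)

lemma Ck_on_SucI:
  assumes "open S" "\<And>x. x \<in> S \<Longrightarrow> (f has_derivative f' x) (at x)" "\<And>v. Ck_on k S (\<lambda>x. f' x v)"
  shows "Ck_on (Suc k) S f"
proof -
  have "Ck_on k S (\<lambda>x. frechet_derivative f (at x) v)" for v
  proof (rule Ck_on_cong[OF assms(1) _ assms(3)])
    show "f' x v = frechet_derivative f (at x) v" if "x \<in> S" for x
      by (simp only: frechet_derivative_at[OF assms(2)[OF that]])
  qed
  moreover have "f differentiable (at x)" if "x \<in> S" for x
    using assms(2)[OF that] unfolding differentiable_def by blast
  ultimately show ?thesis by simp
qed

lemma Ck_on_const: "Ck_on k S (\<lambda>x. c)"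
  by (induction k arbitrary: c) auto

lemma Ck_on_bounded_linear:
  assumes "bounded_linear f"
  shows "Ck_on k S f"
proof (cases k)
  case 0
  then show ?thesis by (simp add: assms linear_continuous_on)
next
  case (Suc j)
  have d: "(f has_derivative f) (at x)" for x
    by (rule bounded_linear_imp_has_derivative[OF assms])
  show ?thesis
    unfolding Suc Ck_on.simps frechet_derivative_at[OF d, symmetric]
    using d by (auto simp: differentiable_def intro!: Ck_on_const)
qed

lemma Ck_on_add:
  assumes "open S"
  shows "Ck_on k S f \<Longrightarrow> Ck_on k S g \<Longrightarrow> Ck_on k S (\<lambda>x. f x + g x)"
proof (induction k arbitrary: f g)
  case 0
  then show ?case by (simp add: continuous_on_add)
next
  case (Suc k)
  then show ?case
    by (intro Ck_on_SucI[OF assms, where f' = "\<lambda>x v. frechet_derivative f (at x) v + frechet_derivative g (at x) v"])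
      (auto intro!: has_derivative_add simp flip: frechet_derivative_works)
qed

lemma Ck_on_mult:
  fixes f g :: "'v::real_normed_vector \<Rightarrow> real"
  assumes "open S"
  shows "Ck_on k S f \<Longrightarrow> Ck_on k S g \<Longrightarrow> Ck_on k S (\<lambda>x. f x * g x)"
proof (induction k arbitrary: f g)
  case 0
  then show ?case by (simp add: continuous_on_mult)
next
  case (Suc k)
  have *: "Ck_on k S f" "Ck_on k S g" using Suc.prems by (blast dest: Ck_on_SucD)+
  have d: "((\<lambda>x. f x * g x) has_derivative
      (\<lambda>v. f x * frechet_derivative g (at x) v + frechet_derivative f (at x) v * g x)) (at x)"
    if "x \<in> S" for x
    using Suc.prems that by (intro has_derivative_mult) (auto simp flip: frechet_derivative_works)
  show ?case
  proof (rule Ck_on_SucI[OF assms d])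
    fix v
    have "Ck_on k S (\<lambda>x. frechet_derivative f (at x) v)" "Ck_on k S (\<lambda>x. frechet_derivative g (at x) v)"
      using Suc.prems by auto
    then show "Ck_on k S (\<lambda>x. f x * frechet_derivative g (at x) v + frechet_derivative f (at x) v * g x)"
      using * by (intro Ck_on_add[OF assms] Suc.IH)
  qed
qed

lemma Ck_on_sum:
  assumes "open S" "\<And>i. i \<in> I \<Longrightarrow> Ck_on k S (f i)"
  shows "Ck_on k S (\<lambda>x. \<Sum>i\<in>I. f i x)"
proof (cases "finite I")
  case True
  then show ?thesis using assms(2)
  proof (induction I)
    case (insert i I)
    then show ?case using Ck_on_add[OF assms(1), of k "f i" "\<lambda>x. \<Sum>i\<in>I. f i x"] by simp
  qed (simp add: Ck_on_const)
qed (simp add: Ck_on_const)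

lemma Ck_on_linear_compose:
  assumes "bounded_linear L" "open S"
  shows "Ck_on k S f \<Longrightarrow> Ck_on k S (\<lambda>x. L (f x))"
proof (induction k arbitrary: f)
  case 0
  then show ?case by (simp add: bounded_linear.continuous_on[OF assms(1)])
next
  case (Suc k)
  then show ?case
    by (intro Ck_on_SucI[OF assms(2), where f' = "\<lambda>x v. L (frechet_derivative f (at x) v)"])
      (auto intro!: bounded_linear.has_derivative[OF assms(1)] simp flip: frechet_derivative_works)
qed

text \<open>By the chain rule a directional derivative of a composite is a sum, over a basis of the
  intermediate space, of products of functions of the class \<open>C\<^sup>k\<close>; the intermediate space therefore
  has to be finite-dimensional.\<close>

lemma Ck_on_compose:
  fixes f :: "'v::real_normed_vector \<Rightarrow> 'w::euclidean_space" and g :: "'w \<Rightarrow> real"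
  assumes "open S" "f ` S \<subseteq> T"
  shows "Ck_on k S f \<Longrightarrow> Ck_on k T g \<Longrightarrow> Ck_on k S (\<lambda>x. g (f x))"
proof (induction k arbitrary: g)
  case 0
  then show ?case using assms by (auto intro: continuous_on_compose2)
next
  case (Suc k)
  let ?f' = "\<lambda>x. frechet_derivative f (at x)" and ?g' = "\<lambda>y. frechet_derivative g (at y)"
  have k: "Ck_on k S f" using Suc.prems by (blast dest: Ck_on_SucD)
  have d: "((\<lambda>x. g (f x)) has_derivative (\<lambda>v. \<Sum>b\<in>Basis. (?f' x v \<bullet> b) * ?g' (f x) b)) (at x)"
    if "x \<in> S" for x
  proof -
    have fx: "(f has_derivative ?f' x) (at x)" and gx: "(g has_derivative ?g' (f x)) (at (f x))"
      using Suc.prems that assms by (auto simp flip: frechet_derivative_works)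
    have *: "?g' (f x) w = (\<Sum>b\<in>Basis. (w \<bullet> b) * ?g' (f x) b)" for w
    proof -
      interpret linear "?g' (f x)" using gx by (rule has_derivative_linear)
      have "?g' (f x) w = ?g' (f x) (\<Sum>b\<in>Basis. (w \<bullet> b) *\<^sub>R b)" by (simp add: euclidean_representation)
      also have "\<dots> = (\<Sum>b\<in>Basis. (w \<bullet> b) * ?g' (f x) b)" by (simp add: sum scale)
      finally show ?thesis .
    qed
    show ?thesis
      by (rule has_derivative_eq_rhs[OF has_derivative_compose[OF fx gx]]) (rule ext, rule *)
  qed
  show ?case
  proof (rule Ck_on_SucI[OF assms(1) d])
    fix v
    have "Ck_on k S (\<lambda>x. ?f' x v \<bullet> b)" for b
      using Suc.prems by (intro Ck_on_linear_compose[OF bounded_linear_inner_left assms(1)]) auto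
    moreover have "Ck_on k S (\<lambda>x. ?g' (f x) b)" for b
      using Suc.prems k by (intro Suc.IH) auto
    ultimately show "Ck_on k S (\<lambda>x. \<Sum>b\<in>Basis. (?f' x v \<bullet> b) * ?g' (f x) b)"
      by (intro Ck_on_sum Ck_on_mult assms)
  qed
qed

lemma smooth_on_cong: "open S \<Longrightarrow> (\<And>x. x \<in> S \<Longrightarrow> f x = g x) \<Longrightarrow> smooth_on S f \<Longrightarrow> smooth_on S g"
  unfolding smooth_on_def using Ck_on_cong by blast

lemma smooth_on_subset: "smooth_on S f \<Longrightarrow> T \<subseteq> S \<Longrightarrow> smooth_on T f"
  unfolding smooth_on_def using Ck_on_subset by blast

lemma smooth_on_local:
  assumes "\<And>x. x \<in> S \<Longrightarrow> \<exists>T. open T \<and> x \<in> T \<and> smooth_on T f"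
  shows "smooth_on S f"
  using assms Ck_on_local[of S _ f] unfolding smooth_on_def by meson

lemma smooth_on_const: "smooth_on S (\<lambda>x. c)"
  by (simp add: smooth_on_def Ck_on_const)

lemma smooth_on_bounded_linear: "bounded_linear f \<Longrightarrow> smooth_on S f"
  by (simp add: smooth_on_def Ck_on_bounded_linear)

lemma smooth_on_add: "open S \<Longrightarrow> smooth_on S f \<Longrightarrow> smooth_on S g \<Longrightarrow> smooth_on S (\<lambda>x. f x + g x)"
  by (simp add: smooth_on_def Ck_on_add)

lemma smooth_on_mult:
  fixes f g :: "'v::real_normed_vector \<Rightarrow> real"
  shows "open S \<Longrightarrow> smooth_on S f \<Longrightarrow> smooth_on S g \<Longrightarrow> smooth_on S (\<lambda>x. f x * g x)"
  by (simp add: smooth_on_def Ck_on_mult)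

lemma smooth_on_linear_compose:
  "bounded_linear L \<Longrightarrow> open S \<Longrightarrow> smooth_on S f \<Longrightarrow> smooth_on S (\<lambda>x. L (f x))"
  by (simp add: smooth_on_def Ck_on_linear_compose)

lemma smooth_on_compose:
  fixes f :: "'v::real_normed_vector \<Rightarrow> 'w::euclidean_space" and g :: "'w \<Rightarrow> real"
  shows "open S \<Longrightarrow> f ` S \<subseteq> T \<Longrightarrow> smooth_on S f \<Longrightarrow> smooth_on T g \<Longrightarrow> smooth_on S (\<lambda>x. g (f x))"
  by (simp add: smooth_on_def Ck_on_compose)

lemma smooth_on_deriv: "smooth_on S f \<Longrightarrow> smooth_on S (\<lambda>x. frechet_derivative f (at x) v)"
  unfolding smooth_on_def by (metis Ck_on.simps(2))

lemma smooth_on_has_derivative: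
  assumes "smooth_on S f" "x \<in> S"
  shows "(f has_derivative frechet_derivative f (at x)) (at x)"
proof -
  have "Ck_on (Suc 0) S f" using assms(1) unfolding smooth_on_def by blast
  then show ?thesis using assms(2) by (auto simp flip: frechet_derivative_works)
qed

lemma smooth_on_imp_continuous_on: "smooth_on S f \<Longrightarrow> continuous_on S f"
  unfolding smooth_on_def by (metis Ck_on.simps(1))

lemma smooth_on_inverse: "smooth_on {0<..} (inverse :: real \<Rightarrow> real)"
proof -
  \<comment> \<open>The derivative of \<open>x\<^sup>-\<^sup>1\<close> is \<open>- x\<^sup>-\<^sup>1 x\<^sup>-\<^sup>1\<close>, so that smoothness propagates through products.\<close>
  have "Ck_on k {0<..} (inverse :: real \<Rightarrow> real)" for k
  proof (induction k)
    case 0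
    then show ?case by (auto intro!: continuous_intros)
  next
    case (Suc k)
    have "(inverse has_derivative (\<lambda>v. (- v) * (inverse x * inverse x))) (at x)" if "x \<in> {0<..}" for x :: real
      using that by (auto intro!: derivative_eq_intros)
    then show ?case
      by (rule Ck_on_SucI[OF open_greaterThan]) (assumption, intro Ck_on_mult open_greaterThan Suc Ck_on_const)
  qed
  then show ?thesis by (simp add: smooth_on_def)
qed

section \<open>Bump functions\<close>

text \<open>The derivative of a member of this family is a combination of two others, and it is this closure
  of the whole family that makes the member \<open>k = 0\<close> smooth.\<close>

definition flat_exp :: "nat \<Rightarrow> real \<Rightarrow> real" where
  "flat_exp k x = (if x > 0 then inverse x ^ k * exp (- inverse x) else 0)"

lemma flat_exp_tendsto: "((\<lambda>x. inverse x ^ k * exp (- inverse x)) \<longlongrightarrow> (0::real)) (at_right 0)"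
proof -
  have "((\<lambda>y::real. y ^ k / exp y) \<longlongrightarrow> 0) at_top" by (rule tendsto_power_div_exp_0)
  then have "((\<lambda>x::real. inverse x ^ k / exp (inverse x)) \<longlongrightarrow> 0) (at_right 0)"
    by (rule filterlim_compose[OF _ filterlim_inverse_at_top_right])
  then show ?thesis by (simp add: exp_minus field_simps)
qed

lemma flat_exp_deriv:
  "(flat_exp k has_real_derivative (flat_exp (k + 2) x - real k * flat_exp (k + 1) x)) (at x)"
proof -
  consider "x > 0" | "x < 0" | "x = 0" by linarith
  then show ?thesis
  proof cases
    case 1
    have "((\<lambda>x. inverse x ^ k * exp (- inverse x)) has_real_derivative
        (flat_exp (k + 2) x - real k * flat_exp (k + 1) x)) (at x)"
    proof (cases k)
      case (Suc j)
      then show ?thesis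
        using 1 by (auto intro!: derivative_eq_intros simp: flat_exp_def algebra_simps) (cases j; simp)
    qed (use 1 in \<open>auto intro!: derivative_eq_intros simp: flat_exp_def algebra_simps\<close>)
    then show ?thesis
      by (rule has_field_derivative_transform_within_open[where S = "{0<..}"]) (use 1 in \<open>auto simp: flat_exp_def\<close>)
  next
    case 2
    have "((\<lambda>x. 0) has_real_derivative (flat_exp (k + 2) x - real k * flat_exp (k + 1) x)) (at x)"
      using 2 by (auto simp: flat_exp_def)
    then show ?thesis
      by (rule has_field_derivative_transform_within_open[where S = "{..<0}"]) (use 2 in \<open>auto simp: flat_exp_def\<close>)
  next
    case 3
    have "((\<lambda>h. flat_exp k h / h) \<longlongrightarrow> 0) (at_right 0)"
      by (rule Lim_transform_eventually[OF flat_exp_tendsto[of "k + 1"]])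
        (auto simp: flat_exp_def eventually_at_right_less field_simps intro!: eventually_at_rightI[of 0 1])
    moreover have "((\<lambda>h. flat_exp k h / h) \<longlongrightarrow> 0) (at_left 0)"
      by (rule Lim_transform_eventually[OF tendsto_const])
        (auto simp: flat_exp_def intro!: eventually_at_leftI[of "-1"])
    ultimately show ?thesis
      using 3 by (simp add: DERIV_def flat_exp_def filterlim_split_at_real)
  qed
qed

lemma smooth_on_flat_exp: "open S \<Longrightarrow> smooth_on S (flat_exp 0)"
proof -
  assume S: "open S"
  have "Ck_on n S (flat_exp k)" for n k
  proof (induction n arbitrary: k)
    case 0
    show ?case using flat_exp_deriv[THEN DERIV_isCont] by (simp add: continuous_at_imp_continuous_on)
  next
    case (Suc n)
    have *: "(flat_exp k has_derivative
        (\<lambda>v. flat_exp (k + 2) x * v + (- real k) * (flat_exp (k + 1) x * v))) (at x)" for x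
      using flat_exp_deriv[of k x] unfolding has_field_derivative_def
      by (rule has_derivative_eq_rhs) (simp add: fun_eq_iff algebra_simps)
    show ?case
      by (rule Ck_on_SucI[OF S *]) (intro Ck_on_add Ck_on_mult Ck_on_const Suc S)
  qed
  then show ?thesis by (simp add: smooth_on_def)
qed

text \<open>The plateau comes from \<open>e t / (e t + e (1 - t))\<close> with \<open>e = flat_exp 0\<close>, which is \<open>0\<close> for
  \<open>t \<le> 0\<close> and \<open>1\<close> for \<open>t \<ge> 1\<close>; the denominator never vanishes.\<close>

lemma bump_function:
  fixes a :: "'v::euclidean_space"
  assumes "r > 0"
  obtains \<beta> :: "'v \<Rightarrow> real" and s where "smooth_on UNIV \<beta>" "0 < s" "s < r"
    "\<And>x. x \<in> ball a s \<Longrightarrow> \<beta> x = 1" "\<And>x. dist a x \<ge> r \<Longrightarrow> \<beta> x = 0"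
proof -
  define s where "s = r / 2"
  define t where "t = (\<lambda>x. (r\<^sup>2 - (x - a) \<bullet> (x - a)) * (1 / (r\<^sup>2 - s\<^sup>2)))"
  define \<beta> where "\<beta> = (\<lambda>x. flat_exp 0 (t x) * inverse (flat_exp 0 (t x) + flat_exp 0 (1 - t x)))"
  have s: "0 < s" "s < r" using assms by (auto simp: s_def)
  then have rs: "r\<^sup>2 - s\<^sup>2 > 0" by (simp add: power2_eq_square mult_strict_mono)
  have sm: "smooth_on UNIV (\<lambda>x. (x - a) \<bullet> b)" for b
  proof -
    have "smooth_on UNIV (\<lambda>x. x \<bullet> b + (- (a \<bullet> b)))"
      by (intro smooth_on_add smooth_on_const smooth_on_bounded_linear bounded_linear_inner_left) simp
    then show ?thesis by (simp add: inner_diff_left)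
  qed
  have "smooth_on UNIV (\<lambda>x. (r\<^sup>2 + (- 1) * (\<Sum>b\<in>Basis. ((x - a) \<bullet> b) * ((x - a) \<bullet> b))) * (1 / (r\<^sup>2 - s\<^sup>2)))"
  proof -
    have "smooth_on UNIV (\<lambda>x. \<Sum>b\<in>Basis. ((x - a) \<bullet> b) * ((x - a) \<bullet> b))"
      unfolding smooth_on_def using smooth_on_mult[OF open_UNIV sm sm]
      by (auto intro!: Ck_on_sum simp: smooth_on_def)
    then show ?thesis by (intro smooth_on_mult smooth_on_add smooth_on_const) auto
  qed
  then have t: "smooth_on UNIV t"
    by (simp add: t_def euclidean_inner[of "x - a" "x - a" for x])
  have u: "smooth_on UNIV (\<lambda>x. 1 - t x)"
    using smooth_on_add[OF _ smooth_on_const[of _ 1] smooth_on_mult[OF _ smooth_on_const[of _ "-1"] t]] by simp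
  have e: "smooth_on UNIV (\<lambda>x. flat_exp 0 (t x))" "smooth_on UNIV (\<lambda>x. flat_exp 0 (1 - t x))"
    by (rule smooth_on_compose[OF _ _ _ smooth_on_flat_exp[OF open_UNIV]]; use t u in simp)+
  have pos: "flat_exp 0 y + flat_exp 0 (1 - y) > 0" for y
    by (auto simp: flat_exp_def add_pos_nonneg add_nonneg_pos)
  have "smooth_on UNIV \<beta>"
    unfolding \<beta>_def
  proof (rule smooth_on_mult[OF _ e(1)])
    show "smooth_on UNIV (\<lambda>x. inverse (flat_exp 0 (t x) + flat_exp 0 (1 - t x)))"
      by (rule smooth_on_compose[OF _ _ smooth_on_add[OF _ e] smooth_on_inverse]) (use pos in auto)
  qed simp
  moreover have "\<beta> x = 1" if "x \<in> ball a s" for x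
  proof -
    have "(x - a) \<bullet> (x - a) \<le> s\<^sup>2"
      using that by (simp add: dist_norm norm_minus_commute power2_norm_eq_inner[symmetric] power_mono)
    then have "t x \<ge> 1" using rs by (simp add: t_def field_simps)
    then show ?thesis using pos[of "t x"] by (simp add: \<beta>_def flat_exp_def)
  qed
  moreover have "\<beta> x = 0" if "dist a x \<ge> r" for x
  proof -
    have "r\<^sup>2 \<le> (x - a) \<bullet> (x - a)"
      using that assms by (simp add: dist_norm norm_minus_commute power2_norm_eq_inner[symmetric] power_mono)
    then have "t x \<le> 0" using rs by (simp add: t_def mult_nonpos_nonneg field_simps)
    then show ?thesis by (simp add: \<beta>_def flat_exp_def)
  qed
  ultimately show ?thesis using that s by blast
qed

section \<open>The Hadamard lemma\<close>

text \<open>Differentiating under the integral sign turns the moment \<open>j\<close> of \<open>F\<close> along rays into the moment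
  \<open>j + 1\<close> of a derivative of \<open>F\<close>. Admitting all \<open>j\<close> is what lets smoothness be proved by induction.\<close>

definition ray_moment :: "'v::euclidean_space \<Rightarrow> nat \<Rightarrow> ('v \<Rightarrow> real) \<Rightarrow> 'v \<Rightarrow> real" where
  "ray_moment a j F x = integral (cbox 0 1) (\<lambda>t. t ^ j * F (a + t *\<^sub>R (x - a)))"

lemma ray_in_ball:
  fixes x a :: "'v::real_normed_vector"
  shows "x \<in> ball a r \<Longrightarrow> t \<in> cbox 0 (1::real) \<Longrightarrow> a + t *\<^sub>R (x - a) \<in> ball a r"
  by (auto simp: dist_norm norm_minus_commute[of x] intro: le_less_trans[OF mult_left_le_one_le])

lemma ray_moment_has_derivative:
  assumes F: "smooth_on (ball a r) F" and x: "x \<in> ball a r"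
  shows "(ray_moment a j F has_derivative
    (\<lambda>v. ray_moment a (Suc j) (\<lambda>y. frechet_derivative F (at y) v) x)) (at x)"
proof -
  let ?D = "\<lambda>y v. frechet_derivative F (at y) v" and ?p = "\<lambda>x t. a + t *\<^sub>R (x - a)"
  define fx where "fx = (\<lambda>x t. \<Sum>b\<in>Basis. (t ^ Suc j * ?D (?p x t) b) *\<^sub>R blinfun_inner_left b)"
  have lin: "?D (?p x t) v = (\<Sum>b\<in>Basis. (v \<bullet> b) * ?D (?p x t) b)"
    if "x \<in> ball a r" "t \<in> cbox 0 1" for x t v
  proof -
    interpret linear "?D (?p x t)"
      using smooth_on_has_derivative[OF F ray_in_ball[OF that]] by (rule has_derivative_linear)
    have "?D (?p x t) v = ?D (?p x t) (\<Sum>b\<in>Basis. (v \<bullet> b) *\<^sub>R b)" by (simp add: euclidean_representation)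
    also have "\<dots> = (\<Sum>b\<in>Basis. (v \<bullet> b) * ?D (?p x t) b)" by (simp add: sum scale)
    finally show ?thesis .
  qed
  have fx: "blinfun_apply (fx x t) v = t ^ Suc j * ?D (?p x t) v"
    if "x \<in> ball a r" "t \<in> cbox 0 1" for x t v
    by (subst lin[OF that]) (simp add: fx_def blinfun.sum_left blinfun.scaleR_left sum_distrib_left algebra_simps)
  have cont_p: "continuous_on T (\<lambda>z. G (?p (fst z) (snd z)))"
    if "continuous_on (ball a r) G" "T \<subseteq> ball a r \<times> cbox 0 1" for G :: "_ \<Rightarrow> real" and T
    by (rule continuous_on_compose2[OF that(1)])
      (use that(2) in \<open>auto intro!: continuous_intros ray_in_ball simp del: mem_ball\<close>)
  have cF: "continuous_on (ball a r) F" and cD: "continuous_on (ball a r) (\<lambda>y. ?D y b)" for b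
    using smooth_on_imp_continuous_on F smooth_on_deriv by blast+
  have int: "(\<lambda>t. t ^ i * G (?p x t)) integrable_on cbox 0 1"
    if "continuous_on (ball a r) G" "x \<in> ball a r" for G and x i
    by (rule integrable_continuous, intro continuous_intros continuous_on_compose2[OF that(1)])
      (use that(2) in \<open>auto intro!: continuous_intros ray_in_ball simp del: mem_ball\<close>)
  have cfx: "continuous_on (ball a r \<times> cbox 0 1) (\<lambda>(x, t). fx x t)"
    unfolding fx_def split_beta by (intro continuous_intros cont_p cD) auto
  have "((\<lambda>x. integral (cbox 0 1) (\<lambda>t. t ^ j * F (?p x t))) has_derivative
      blinfun_apply (integral (cbox 0 1) (fx x))) (at x within ball a r)"
  proof (rule leibniz_rule[OF _ _ cfx x convex_ball])
    fix x t assume xt: "x \<in> ball a r" "t \<in> cbox 0 (1::real)"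
    interpret linear "?D (?p x t)"
      using smooth_on_has_derivative[OF F ray_in_ball[OF xt]] by (rule has_derivative_linear)
    have "((\<lambda>x. ?p x t) has_derivative (\<lambda>v. t *\<^sub>R v)) (at x within ball a r)"
      by (auto intro!: derivative_eq_intros)
    from has_derivative_mult_right[OF has_derivative_compose[OF this smooth_on_has_derivative[OF F ray_in_ball[OF xt]]]]
    show "((\<lambda>x. t ^ j * F (?p x t)) has_derivative blinfun_apply (fx x t)) (at x within ball a r)"
      by (rule has_derivative_eq_rhs) (auto simp: fx[OF xt] scale)
  qed (rule int[OF cF])
  moreover have "blinfun_apply (integral (cbox 0 1) (fx x)) v = ray_moment a (Suc j) (\<lambda>y. ?D y v) x" for v
  proof -
    have "fx x integrable_on cbox 0 1"
    proof (rule integrable_continuous)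
      have "continuous_on (cbox 0 1) (\<lambda>t. case (x, t) of (x, t) \<Rightarrow> fx x t)"
        by (rule continuous_on_compose2[OF cfx continuous_on_Pair[OF continuous_on_const continuous_on_id]])
          (use x in auto)
      then show "continuous_on (cbox 0 1) (fx x)" by simp
    qed
    then have "blinfun_apply (integral (cbox 0 1) (fx x)) v = integral (cbox 0 1) (\<lambda>t. blinfun_apply (fx x t) v)"
      by (rule blinfun_apply_integral) 
    also have "\<dots> = ray_moment a (Suc j) (\<lambda>y. ?D y v) x"
      unfolding ray_moment_def by (rule integral_cong) (simp add: fx[OF x])
    finally show ?thesis .
  qed
  ultimately show ?thesis
    unfolding ray_moment_def[of a j, abs_def] at_within_open[OF x open_ball]
    by (auto intro: has_derivative_eq_rhs)
qed

lemma smooth_on_ray_moment: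
  assumes "smooth_on (ball a r) F"
  shows "smooth_on (ball a r) (ray_moment a j F)"
proof -
  have "Ck_on k (ball a r) (ray_moment a j F)" for k
    using assms
  proof (induction k arbitrary: F j)
    case 0
    then show ?case
      using has_derivative_continuous[OF ray_moment_has_derivative[OF 0]]
      unfolding Ck_on.simps by (intro continuous_at_imp_continuous_on ballI)
  next
    case (Suc k)
    show ?case
      by (rule Ck_on_SucI[OF open_ball ray_moment_has_derivative[OF Suc.prems]])
        (auto intro!: Suc.IH smooth_on_deriv Suc.prems)
  qed
  then show ?thesis by (simp add: smooth_on_def)
qed

text \<open>Integrate the derivative of \<open>F\<close> along the segment from \<open>a\<close> to \<open>x\<close>.\<close>

lemma hadamard:
  fixes F :: "'v::euclidean_space \<Rightarrow> real"
  assumes F: "smooth_on (ball a r) F" and x: "x \<in> ball a r"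
  shows "F x = F a + (\<Sum>b\<in>Basis. ((x - a) \<bullet> b) * ray_moment a 0 (\<lambda>y. frechet_derivative F (at y) b) x)"
proof -
  let ?D = "\<lambda>y v. frechet_derivative F (at y) v" and ?p = "\<lambda>t. a + t *\<^sub>R (x - a)"
  have lin: "?D (?p t) (x - a) = (\<Sum>b\<in>Basis. ((x - a) \<bullet> b) * ?D (?p t) b)" if "t \<in> cbox 0 1" for t
  proof -
    interpret linear "?D (?p t)"
      using smooth_on_has_derivative[OF F ray_in_ball[OF x that]] by (rule has_derivative_linear)
    have "?D (?p t) (x - a) = ?D (?p t) (\<Sum>b\<in>Basis. ((x - a) \<bullet> b) *\<^sub>R b)"
      by (simp only: euclidean_representation)
    also have "\<dots> = (\<Sum>b\<in>Basis. ((x - a) \<bullet> b) * ?D (?p t) b)" by (simp add: sum scale)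
    finally show ?thesis .
  qed
  have "((\<lambda>t. ?D (?p t) (x - a)) has_integral (F (?p 1) - F (?p 0))) {0..1}"
  proof (rule fundamental_theorem_of_calculus)
    fix t :: real assume t: "t \<in> {0..1}"
    then have t': "t \<in> cbox 0 1" by simp
    interpret linear "?D (?p t)"
      using smooth_on_has_derivative[OF F ray_in_ball[OF x t']] by (rule has_derivative_linear)
    have "(?p has_derivative (\<lambda>h. h *\<^sub>R (x - a))) (at t within {0..1})"
      by (auto intro!: derivative_eq_intros)
    from has_derivative_compose[OF this smooth_on_has_derivative[OF F ray_in_ball[OF x t']]]
    show "((\<lambda>t. F (?p t)) has_vector_derivative ?D (?p t) (x - a)) (at t within {0..1})"
      by (simp add: has_vector_derivative_def scale)
  qed simp
  then have "F x - F a = integral (cbox 0 1) (\<lambda>t. ?D (?p t) (x - a))"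
    by (simp add: integral_unique)
  also have "\<dots> = integral (cbox 0 1) (\<lambda>t. \<Sum>b\<in>Basis. ((x - a) \<bullet> b) * ?D (?p t) b)"
    by (rule integral_cong) (rule lin)
  also have "\<dots> = (\<Sum>b\<in>Basis. ((x - a) \<bullet> b) * ray_moment a 0 (\<lambda>y. ?D y b) x)"
  proof (subst integral_sum)
    fix b :: 'v
    have "continuous_on (ball a r) (\<lambda>y. ?D y b)"
      using smooth_on_imp_continuous_on F smooth_on_deriv by blast
    then have "continuous_on (cbox 0 1) (\<lambda>t. ?D (?p t) b)"
      by (rule continuous_on_compose2)
        (use x in \<open>auto intro!: continuous_intros ray_in_ball simp del: mem_ball\<close>)
    then show "(\<lambda>t. ((x - a) \<bullet> b) * ?D (?p t) b) integrable_on cbox 0 1"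
      by (intro integrable_continuous continuous_intros)
  qed (auto simp: ray_moment_def)
  finally show ?thesis by simp
qed

lemma ray_moment_center: "ray_moment a 0 F a = F a"
  by (simp add: ray_moment_def)

section \<open>Smooth functions on a manifold\<close>

locale manifold =
  fixes M :: "('a, 'e::euclidean_space) mfd"
  assumes manifold: "smooth_manifold M"

text \<open>Functions that are only locally of interest, such as coordinates and quotients, are smooth on an
  open set \<open>W\<close> before they are cut off.\<close>

definition Cinf_on :: "('a, 'e::euclidean_space) mfd \<Rightarrow> 'a set \<Rightarrow> ('a \<Rightarrow> real) set" where
  "Cinf_on M W = {f. \<forall>(U, \<kappa>) \<in> atlas M. smooth_on (\<kappa> ` (U \<inter> W)) (f \<circ> inv_into U \<kappa>)}"

context manifold
begin

lemma chart_openin: "(U, \<kappa>) \<in> atlas M \<Longrightarrow> openin (mtop M) U"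
  using manifold unfolding smooth_manifold_def by blast

lemma chart_subset: "(U, \<kappa>) \<in> atlas M \<Longrightarrow> U \<subseteq> points M"
  by (simp add: chart_openin openin_subset)

lemma chart_homeo:
  "(U, \<kappa>) \<in> atlas M \<Longrightarrow> homeomorphic_map (subtopology (mtop M) U) (top_of_set (\<kappa> ` U)) \<kappa>"
  using manifold unfolding smooth_manifold_def by blast

lemma chart_transition:
  "(U, \<kappa>) \<in> atlas M \<Longrightarrow> (U', \<kappa>') \<in> atlas M \<Longrightarrow> smooth_on (\<kappa> ` (U \<inter> U')) (\<kappa>' \<circ> inv_into U \<kappa>)"
  using manifold unfolding smooth_manifold_def by blast

lemma chart_exists:
  assumes "p \<in> points M"
  obtains U \<kappa> where "(U, \<kappa>) \<in> atlas M" "p \<in> U"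
proof -
  have "p \<in> \<Union> (fst ` atlas M)" using manifold assms unfolding smooth_manifold_def by blast
  then show ?thesis using that by auto
qed

lemma chart_inj: "(U, \<kappa>) \<in> atlas M \<Longrightarrow> inj_on \<kappa> U"
  using homeomorphic_imp_injective_map[OF chart_homeo] chart_subset
  by (metis inf.absorb_iff2 topspace_subtopology)

lemma chart_inv: "(U, \<kappa>) \<in> atlas M \<Longrightarrow> x \<in> U \<Longrightarrow> inv_into U \<kappa> (\<kappa> x) = x"
  using chart_inj by (simp add: inv_into_f_f)

lemma chart_image_open:
  assumes "(U, \<kappa>) \<in> atlas M" "openin (mtop M) W"
  shows "open (\<kappa> ` (U \<inter> W))"
proof -
  have "openin (subtopology (mtop M) U) (U \<inter> W)"
    using assms(2) by (simp add: openin_subtopology_Int2)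
  then have "openin (top_of_set (\<kappa> ` U)) (\<kappa> ` (U \<inter> W))"
    using homeomorphic_imp_open_map[OF chart_homeo[OF assms(1)]] unfolding open_map_def by blast
  moreover have "open (\<kappa> ` U)" using manifold assms(1) unfolding smooth_manifold_def by blast
  ultimately show ?thesis by (simp add: openin_open_eq)
qed

lemma chart_vimage_openin:
  assumes "(U, \<kappa>) \<in> atlas M" "open T"
  shows "openin (mtop M) {x \<in> U. \<kappa> x \<in> T}"
proof -
  have "openin (subtopology (mtop M) U) {x \<in> topspace (subtopology (mtop M) U). \<kappa> x \<in> \<kappa> ` U \<inter> T}"
    using homeomorphic_imp_continuous_map[OF chart_homeo[OF assms(1)]] assms(2)
    by (intro openin_continuous_map_preimage[where Y = "top_of_set (\<kappa> ` U)"]) auto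
  moreover have "{x \<in> topspace (subtopology (mtop M) U). \<kappa> x \<in> \<kappa> ` U \<inter> T} = {x \<in> U. \<kappa> x \<in> T}"
    using chart_subset[OF assms(1)] by auto
  ultimately show ?thesis
    using chart_openin[OF assms(1)] by (simp add: openin_open_subtopology)
qed

lemma chart_vimage_closedin:
  assumes c: "(U, \<kappa>) \<in> atlas M" and K: "compact K" "K \<subseteq> \<kappa> ` U"
  shows "closedin (mtop M) {x \<in> U. \<kappa> x \<in> K}"
proof -
  have "\<kappa> ` {x \<in> U. \<kappa> x \<in> K} = K" using K(2) by auto
  then have "compactin (top_of_set (\<kappa> ` U)) (\<kappa> ` {x \<in> U. \<kappa> x \<in> K})"
    using K by (simp add: compactin_subtopology)
  then have "compactin (subtopology (mtop M) U) {x \<in> U. \<kappa> x \<in> K}"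
    using homeomorphic_map_compactness[OF chart_homeo[OF c], of "{x \<in> U. \<kappa> x \<in> K}"] chart_subset[OF c] by auto
  then have "compactin (mtop M) {x \<in> U. \<kappa> x \<in> K}" by (simp add: compactin_subtopology)
  then show ?thesis
    using manifold unfolding smooth_manifold_def by (blast intro: compactin_imp_closedin)
qed

lemma Cinf_eq_Cinf_on: "Cinf M = Cinf_on M (points M)"
proof -
  have "U \<inter> points M = U" if "(U, \<kappa>) \<in> atlas M" for U \<kappa> using chart_subset[OF that] by auto
  then show ?thesis unfolding Cinf_def Cinf_on_def by auto
qed

lemma Cinf_onD: "f \<in> Cinf_on M W \<Longrightarrow> (U, \<kappa>) \<in> atlas M \<Longrightarrow> smooth_on (\<kappa> ` (U \<inter> W)) (f \<circ> inv_into U \<kappa>)"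
  unfolding Cinf_on_def by blast

lemma CinfD: "f \<in> Cinf M \<Longrightarrow> (U, \<kappa>) \<in> atlas M \<Longrightarrow> smooth_on (\<kappa> ` U) (f \<circ> inv_into U \<kappa>)"
  unfolding Cinf_def by blast

text \<open>Smoothness has to be checked in one chart per point only, because transition maps are smooth.\<close>

lemma Cinf_onI:
  assumes "\<And>p. p \<in> W \<Longrightarrow> \<exists>U \<kappa> W'. (U, \<kappa>) \<in> atlas M \<and> openin (mtop M) W' \<and> p \<in> W' \<and> W' \<subseteq> U \<and>
    smooth_on (\<kappa> ` W') (f \<circ> inv_into U \<kappa>)"
  shows "f \<in> Cinf_on M W"
  unfolding Cinf_on_def
proof safe
  fix U' \<kappa>' assume c': "(U', \<kappa>') \<in> atlas M"
  show "smooth_on (\<kappa>' ` (U' \<inter> W)) (f \<circ> inv_into U' \<kappa>')"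
  proof (rule smooth_on_local)
    fix y assume "y \<in> \<kappa>' ` (U' \<inter> W)"
    then obtain p where p: "p \<in> U'" "p \<in> W" "y = \<kappa>' p" by auto
    then obtain U \<kappa> W' where c: "(U, \<kappa>) \<in> atlas M" and W': "openin (mtop M) W'" "p \<in> W'" "W' \<subseteq> U"
      and f: "smooth_on (\<kappa> ` W') (f \<circ> inv_into U \<kappa>)"
      using assms by blast
    define T where "T = \<kappa>' ` (U' \<inter> W')"
    have T: "open T" unfolding T_def by (rule chart_image_open[OF c' W'(1)])
    have inv': "inv_into U' \<kappa>' (\<kappa>' x) = x" if "x \<in> U'" for x by (rule chart_inv[OF c' that])
    have inv: "inv_into U \<kappa> (\<kappa> x) = x" if "x \<in> W'" for x using chart_inv[OF c] that W'(3) by blast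
    have "smooth_on T (\<lambda>y. (f \<circ> inv_into U \<kappa>) ((\<kappa> \<circ> inv_into U' \<kappa>') y))"
    proof (rule smooth_on_compose[OF T _ _ f])
      show "(\<kappa> \<circ> inv_into U' \<kappa>') ` T \<subseteq> \<kappa> ` W'" using inv' by (auto simp: T_def)
      show "smooth_on T (\<kappa> \<circ> inv_into U' \<kappa>')"
        by (rule smooth_on_subset[OF chart_transition[OF c' c]]) (use W' in \<open>auto simp: T_def\<close>)
    qed
    then have "smooth_on T (f \<circ> inv_into U' \<kappa>')"
      by (rule smooth_on_cong[OF T, rotated]) (use inv inv' in \<open>auto simp: T_def\<close>)
    with T p W' show "\<exists>T. open T \<and> y \<in> T \<and> smooth_on T (f \<circ> inv_into U' \<kappa>')"
      by (auto simp: T_def)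
  qed
qed

lemma Cinf_on_chart:
  assumes "(U, \<kappa>) \<in> atlas M" "openin (mtop M) W" "W \<subseteq> U" "smooth_on (\<kappa> ` W) g"
  shows "(\<lambda>x. g (\<kappa> x)) \<in> Cinf_on M W"
proof (rule Cinf_onI)
  fix p assume p: "p \<in> W"
  have U: "U \<inter> W = W" using assms(3) by auto
  have "smooth_on (\<kappa> ` W) ((\<lambda>x. g (\<kappa> x)) \<circ> inv_into U \<kappa>)"
    using chart_inv[OF assms(1)] assms(3) chart_image_open[OF assms(1,2)] U
    by (intro smooth_on_cong[OF _ _ assms(4)]) auto
  with assms p show "\<exists>U' \<kappa>' W'. (U', \<kappa>') \<in> atlas M \<and> openin (mtop M) W' \<and> p \<in> W' \<and> W' \<subseteq> U' \<and>
    smooth_on (\<kappa>' ` W') ((\<lambda>x. g (\<kappa> x)) \<circ> inv_into U' \<kappa>')" by blast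
qed

lemma Cinf_on_subset: "f \<in> Cinf_on M W \<Longrightarrow> W' \<subseteq> W \<Longrightarrow> f \<in> Cinf_on M W'"
  unfolding Cinf_on_def by (force intro: smooth_on_subset)

lemma Cinf_imp_Cinf_on: "f \<in> Cinf M \<Longrightarrow> W \<subseteq> points M \<Longrightarrow> f \<in> Cinf_on M W"
  by (simp add: Cinf_eq_Cinf_on Cinf_on_subset)

lemma Cinf_on_cong:
  assumes "openin (mtop M) W" "f \<in> Cinf_on M W" "\<And>x. x \<in> W \<Longrightarrow> f x = g x"
  shows "g \<in> Cinf_on M W"
  unfolding Cinf_on_def
proof safe
  fix U \<kappa> assume c: "(U, \<kappa>) \<in> atlas M"
  show "smooth_on (\<kappa> ` (U \<inter> W)) (g \<circ> inv_into U \<kappa>)"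
    by (rule smooth_on_cong[OF chart_image_open[OF c assms(1)] _ Cinf_onD[OF assms(2) c]])
      (use assms(3) chart_inv[OF c] in auto)
qed

lemma Cinf_on_Un:
  assumes "openin (mtop M) W" "openin (mtop M) W'" "f \<in> Cinf_on M W" "f \<in> Cinf_on M W'"
  shows "f \<in> Cinf_on M (W \<union> W')"
  unfolding Cinf_on_def
proof safe
  fix U \<kappa> assume c: "(U, \<kappa>) \<in> atlas M"
  show "smooth_on (\<kappa> ` (U \<inter> (W \<union> W'))) (f \<circ> inv_into U \<kappa>)"
    using chart_image_open[OF c] assms Cinf_onD[OF _ c]
    by (intro smooth_on_local) blast
qed

lemma Cinf_on_const: "(\<lambda>x. c) \<in> Cinf_on M W"
  by (auto simp: Cinf_on_def o_def smooth_on_const)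

lemma Cinf_on_add:
  assumes "openin (mtop M) W" "f \<in> Cinf_on M W" "g \<in> Cinf_on M W"
  shows "(\<lambda>x. f x + g x) \<in> Cinf_on M W"
  using assms(2,3) smooth_on_add[OF chart_image_open[OF _ assms(1)]]
  unfolding Cinf_on_def o_def by blast

lemma Cinf_on_mult:
  assumes "openin (mtop M) W" "f \<in> Cinf_on M W" "g \<in> Cinf_on M W"
  shows "(\<lambda>x. f x * g x) \<in> Cinf_on M W"
  using assms(2,3) smooth_on_mult[OF chart_image_open[OF _ assms(1)]]
  unfolding Cinf_on_def o_def by blast

lemma Cinf_const: "(\<lambda>x. c) \<in> Cinf M"
  by (simp add: Cinf_eq_Cinf_on Cinf_on_const)

lemma Cinf_add: "f \<in> Cinf M \<Longrightarrow> g \<in> Cinf M \<Longrightarrow> (\<lambda>x. f x + g x) \<in> Cinf M"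
  by (simp add: Cinf_eq_Cinf_on Cinf_on_add)

lemma Cinf_mult: "f \<in> Cinf M \<Longrightarrow> g \<in> Cinf M \<Longrightarrow> (\<lambda>x. f x * g x) \<in> Cinf M"
  by (simp add: Cinf_eq_Cinf_on Cinf_on_mult)

lemma Cinf_scale: "f \<in> Cinf M \<Longrightarrow> (\<lambda>x. c * f x) \<in> Cinf M"
  by (intro Cinf_mult Cinf_const)

lemma Cinf_diff: "f \<in> Cinf M \<Longrightarrow> g \<in> Cinf M \<Longrightarrow> (\<lambda>x. f x - g x) \<in> Cinf M"
  using Cinf_add[OF _ Cinf_scale[of g "-1"], of f] by simp

lemma Cinf_sum: "(\<And>i. i \<in> I \<Longrightarrow> f i \<in> Cinf M) \<Longrightarrow> (\<lambda>x. \<Sum>i\<in>I. f i x) \<in> Cinf M"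
proof (induction I rule: infinite_finite_induct)
  case (insert i I)
  then show ?case using Cinf_add[of "f i" "\<lambda>x. \<Sum>i\<in>I. f i x"] by simp
qed (simp_all add: Cinf_const)

text \<open>The inverse is known to be smooth on the positive half-line only, so \<open>1 / f\<close> is treated as
  \<open>f / f\<^sup>2\<close>.\<close>

lemma Cinf_on_inverse:
  assumes "openin (mtop M) W" "f \<in> Cinf_on M W" "\<And>x. x \<in> W \<Longrightarrow> f x \<noteq> 0"
  shows "(\<lambda>x. inverse (f x)) \<in> Cinf_on M W"
proof -
  have "(\<lambda>x. inverse (f x * f x)) \<in> Cinf_on M W"
    unfolding Cinf_on_def o_def
  proof safe
    fix U \<kappa> assume c: "(U, \<kappa>) \<in> atlas M"
    show "smooth_on (\<kappa> ` (U \<inter> W)) (\<lambda>y. inverse (f (inv_into U \<kappa> y) * f (inv_into U \<kappa> y)))"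
    proof (rule smooth_on_compose[OF chart_image_open[OF c assms(1)] _ _ smooth_on_inverse])
      show "smooth_on (\<kappa> ` (U \<inter> W)) (\<lambda>y. f (inv_into U \<kappa> y) * f (inv_into U \<kappa> y))"
        using Cinf_onD[OF Cinf_on_mult[OF assms(1,2,2)] c] by (simp add: o_def)
    qed (use assms(3) chart_inv[OF c] in \<open>auto simp: less_le\<close>)
  qed
  then have "(\<lambda>x. f x * inverse (f x * f x)) \<in> Cinf_on M W"
    by (rule Cinf_on_mult[OF assms(1,2)])
  then show ?thesis
    by (rule Cinf_on_cong[OF assms(1)]) (use assms(3) in simp)
qed

lemma Cinf_nonzero_openin:
  assumes "f \<in> Cinf M"
  shows "openin (mtop M) {x \<in> points M. f x \<noteq> 0}"
proof (subst openin_subopen, safe)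
  fix p assume p: "p \<in> points M" "f p \<noteq> 0"
  obtain U \<kappa> where c: "(U, \<kappa>) \<in> atlas M" "p \<in> U" using chart_exists p(1) .
  let ?F = "f \<circ> inv_into U \<kappa>"
  have "open (\<kappa> ` U)" using chart_image_open[OF c(1) chart_openin[OF c(1)]] by simp
  then have "open (\<kappa> ` U \<inter> ?F -` (- {0}))"
    using smooth_on_imp_continuous_on[OF CinfD[OF assms c(1)]]
    by (intro continuous_open_preimage) auto
  then have "openin (mtop M) {x \<in> U. \<kappa> x \<in> \<kappa> ` U \<inter> ?F -` (- {0})}"
    by (rule chart_vimage_openin[OF c(1)])
  moreover have "{x \<in> U. \<kappa> x \<in> \<kappa> ` U \<inter> ?F -` (- {0})} = {x \<in> U. f x \<noteq> 0}"
    by (intro Collect_cong conj_cong refl) (simp add: chart_inv[OF c(1)])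
  ultimately have "openin (mtop M) {x \<in> U. f x \<noteq> 0}" by simp
  moreover have "{x \<in> U. f x \<noteq> 0} \<subseteq> {x \<in> points M. f x \<noteq> 0}"
    using chart_subset[OF c(1)] by auto
  moreover have "p \<in> {x \<in> U. f x \<noteq> 0}" using p c by auto
  ultimately show "\<exists>T. openin (mtop M) T \<and> p \<in> T \<and> T \<subseteq> {x \<in> points M. f x \<noteq> 0}" by blast
qed

text \<open>The support set \<open>K\<close> is closed in the whole manifold, because it is compact and the topology is
  Hausdorff. This is what allows functions on \<open>W\<close> to be continued by \<open>0\<close> after multiplication with the
  cut-off.\<close>

lemma cutoff:
  assumes W: "openin (mtop M) W" "p \<in> W"
  obtains \<theta> W\<^sub>0 K where "\<theta> \<in> Cinf M" "openin (mtop M) W\<^sub>0" "p \<in> W\<^sub>0" "closedin (mtop M) K" "W\<^sub>0 \<subseteq> K" "K \<subseteq> W"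
    "\<And>x. x \<in> W\<^sub>0 \<Longrightarrow> \<theta> x = 1" "\<And>x. x \<notin> K \<Longrightarrow> \<theta> x = 0"
proof -
  have pM: "p \<in> points M" using W openin_subset by blast
  obtain U \<kappa> where c: "(U, \<kappa>) \<in> atlas M" "p \<in> U" using chart_exists pM .
  have "open (\<kappa> ` (U \<inter> W))" by (rule chart_image_open[OF c(1) W(1)])
  moreover have "\<kappa> p \<in> \<kappa> ` (U \<inter> W)" using c W by auto
  ultimately obtain r where r: "r > 0" "cball (\<kappa> p) r \<subseteq> \<kappa> ` (U \<inter> W)"
    using open_contains_cball_eq by blast
  obtain \<beta> :: "'e \<Rightarrow> real" and s where \<beta>: "smooth_on UNIV \<beta>" "0 < s" "s < r" "\<And>x. x \<in> ball (\<kappa> p) s \<Longrightarrow> \<beta> x = 1"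
    "\<And>x. dist (\<kappa> p) x \<ge> r \<Longrightarrow> \<beta> x = 0"
    by (rule bump_function[OF r(1), of "\<kappa> p"]) (rule that)
  define K where "K = {x \<in> U. \<kappa> x \<in> cball (\<kappa> p) r}"
  define W\<^sub>0 where "W\<^sub>0 = {x \<in> U. \<kappa> x \<in> ball (\<kappa> p) s}"
  define \<theta> where "\<theta> = (\<lambda>x. if x \<in> U then \<beta> (\<kappa> x) else 0)"
  have K: "closedin (mtop M) K"
    unfolding K_def by (rule chart_vimage_closedin[OF c(1)]) (use r in auto)
  have KW: "K \<subseteq> W"
  proof
    fix x assume "x \<in> K"
    then have x: "x \<in> U" "\<kappa> x \<in> \<kappa> ` (U \<inter> W)" using r by (auto simp: K_def)
    then obtain z where z: "z \<in> U" "z \<in> W" "\<kappa> x = \<kappa> z" by auto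
    with x(1) have "x = z" using chart_inj[OF c(1)] by (simp add: inj_on_eq_iff)
    with z show "x \<in> W" by simp
  qed
  have 0: "\<theta> x = 0" if "x \<notin> K" for x
    using that \<beta>(5)[of "\<kappa> x"] by (auto simp: \<theta>_def K_def)
  have "\<theta> \<in> Cinf_on M U"
    by (rule Cinf_on_cong[OF chart_openin[OF c(1)]
        Cinf_on_chart[OF c(1) chart_openin[OF c(1)] order_refl smooth_on_subset[OF \<beta>(1)]]])
      (auto simp: \<theta>_def)
  moreover have oK: "openin (mtop M) (points M - K)" using K by blast
  moreover have "\<theta> \<in> Cinf_on M (points M - K)"
    by (rule Cinf_on_cong[OF oK Cinf_on_const[of 0]]) (use 0 in auto)
  ultimately have "\<theta> \<in> Cinf_on M (U \<union> (points M - K))"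
    using chart_openin[OF c(1)] by (intro Cinf_on_Un)
  moreover have "U \<union> (points M - K) = points M"
    using chart_subset[OF c(1)] by (auto simp: K_def)
  ultimately have "\<theta> \<in> Cinf M" by (simp add: Cinf_eq_Cinf_on)
  moreover have "openin (mtop M) W\<^sub>0"
    unfolding W\<^sub>0_def by (rule chart_vimage_openin[OF c(1)]) simp
  moreover have "p \<in> W\<^sub>0" using c \<beta> by (simp add: W\<^sub>0_def)
  moreover have "W\<^sub>0 \<subseteq> K" using \<beta>(3) by (auto simp: K_def W\<^sub>0_def)
  moreover have "\<theta> x = 1" if "x \<in> W\<^sub>0" for x using that \<beta>(4) by (auto simp: \<theta>_def W\<^sub>0_def)
  ultimately show ?thesis using that K KW 0 by blast
qed

lemma Cinf_cutoff_mult: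
  assumes "openin (mtop M) W" "f \<in> Cinf_on M W" "closedin (mtop M) K" "K \<subseteq> W" "\<theta> \<in> Cinf M"
    "\<And>x. x \<notin> K \<Longrightarrow> \<theta> x = 0"
  shows "(\<lambda>x. if x \<in> W then \<theta> x * f x else 0) \<in> Cinf M" (is "?h \<in> _")
proof -
  have W: "W \<subseteq> points M" using assms(1) openin_subset by blast
  have "?h \<in> Cinf_on M W"
    by (rule Cinf_on_cong[OF assms(1) Cinf_on_mult[OF assms(1) Cinf_imp_Cinf_on[OF assms(5) W] assms(2)]]) simp
  moreover have oK: "openin (mtop M) (points M - K)" using assms(3) by blast
  moreover have "?h \<in> Cinf_on M (points M - K)"
    by (rule Cinf_on_cong[OF oK Cinf_on_const[of 0]]) (use assms(6) in auto)
  ultimately have "?h \<in> Cinf_on M (W \<union> (points M - K))"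
    using assms(1) by (intro Cinf_on_Un)
  moreover have "W \<union> (points M - K) = points M" using W assms(4) by auto
  ultimately show ?thesis by (simp add: Cinf_eq_Cinf_on)
qed

lemma Cinf_on_extend:
  assumes "openin (mtop M) W" "p \<in> W" "f \<in> Cinf_on M W"
  obtains h W\<^sub>0 where "h \<in> Cinf M" "openin (mtop M) W\<^sub>0" "p \<in> W\<^sub>0" "W\<^sub>0 \<subseteq> W" "\<And>x. x \<in> W\<^sub>0 \<Longrightarrow> h x = f x"
proof -
  obtain \<theta> W\<^sub>0 K where \<theta>: "\<theta> \<in> Cinf M" "openin (mtop M) W\<^sub>0" "p \<in> W\<^sub>0" "closedin (mtop M) K" "W\<^sub>0 \<subseteq> K" "K \<subseteq> W"
    "\<And>x. x \<in> W\<^sub>0 \<Longrightarrow> \<theta> x = 1" "\<And>x. x \<notin> K \<Longrightarrow> \<theta> x = 0"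
    by (rule cutoff[OF assms(1,2)]) (rule that)
  show ?thesis
    by (rule that[OF Cinf_cutoff_mult[OF assms(1,3) \<theta>(4,6,1,8)] \<theta>(2,3)]) (use \<theta> in auto)
qed

lemma Cinf_reciprocal_near:
  assumes "f \<in> Cinf M" "p \<in> points M" "f p \<noteq> 0"
  obtains g W where "g \<in> Cinf M" "openin (mtop M) W" "p \<in> W" "\<And>x. x \<in> W \<Longrightarrow> g x * f x = 1"
proof -
  let ?W = "{x \<in> points M. f x \<noteq> 0}"
  have "(\<lambda>x. inverse (f x)) \<in> Cinf_on M ?W"
    by (rule Cinf_on_inverse[OF Cinf_nonzero_openin[OF assms(1)] Cinf_imp_Cinf_on[OF assms(1)]]) auto
  from Cinf_on_extend[OF Cinf_nonzero_openin[OF assms(1)] _ this] assms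
  obtain g W where "g \<in> Cinf M" "openin (mtop M) W" "p \<in> W" "W \<subseteq> ?W" "\<And>x. x \<in> W \<Longrightarrow> g x = inverse (f x)"
    by blast
  moreover from this have "g x * f x = 1" if "x \<in> W" for x
    using that by (simp add: subset_iff)
  ultimately show ?thesis using that by blast
qed

end

section \<open>Tangent spaces and local frames\<close>

lemma sum_fun_apply: "(\<Sum>i\<in>I. F i) x = (\<Sum>i\<in>I. F i x)"
  by (induction I rule: infinite_finite_induct) auto

lemma tscale_apply [simp]: "(c \<cdot> v) f = c * v f"
  by (simp add: tscale_def)

lemma fscale_apply [simp]: "fscale g X p = g p \<cdot> X p"
  by (simp add: fscale_def)

lemma tscale_zero_left [simp]: "0 \<cdot> v = 0" and tscale_zero_right [simp]: "c \<cdot> (0 :: 'a tvec) = 0"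
  and tscale_one [simp]: "1 \<cdot> v = v"
  by (auto simp: fun_eq_iff)

context manifold
begin

lemma tangentI:
  assumes "\<And>f h a b. f \<in> Cinf M \<Longrightarrow> h \<in> Cinf M \<Longrightarrow> v (\<lambda>x. a * f x + b * h x) = a * v f + b * v h"
    "\<And>f h. f \<in> Cinf M \<Longrightarrow> h \<in> Cinf M \<Longrightarrow> v (\<lambda>x. f x * h x) = f p * v h + h p * v f"
    "\<And>f. f \<notin> Cinf M \<Longrightarrow> v f = 0"
  shows "v \<in> tangent_space M p"
  using assms unfolding tangent_space_def by auto

lemma tangent_lin:
  "v \<in> tangent_space M p \<Longrightarrow> f \<in> Cinf M \<Longrightarrow> h \<in> Cinf M \<Longrightarrow> v (\<lambda>x. a * f x + b * h x) = a * v f + b * v h"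
  unfolding tangent_space_def by auto

lemma tangent_mult:
  "v \<in> tangent_space M p \<Longrightarrow> f \<in> Cinf M \<Longrightarrow> h \<in> Cinf M \<Longrightarrow> v (\<lambda>x. f x * h x) = f p * v h + h p * v f"
  unfolding tangent_space_def by auto

lemma tangent_nonsmooth: "v \<in> tangent_space M p \<Longrightarrow> f \<notin> Cinf M \<Longrightarrow> v f = 0"
  unfolding tangent_space_def by auto

lemma tangent_fun_add:
  "v \<in> tangent_space M p \<Longrightarrow> f \<in> Cinf M \<Longrightarrow> h \<in> Cinf M \<Longrightarrow> v (\<lambda>x. f x + h x) = v f + v h"
  using tangent_lin[of v p f h 1 1] by simp

lemma tangent_fun_diff:
  "v \<in> tangent_space M p \<Longrightarrow> f \<in> Cinf M \<Longrightarrow> h \<in> Cinf M \<Longrightarrow> v (\<lambda>x. f x - h x) = v f - v h"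
  using tangent_lin[of v p f h 1 "-1"] by simp

lemma tangent_fun_const: "v \<in> tangent_space M p \<Longrightarrow> v (\<lambda>x. c) = 0"
proof -
  assume v: "v \<in> tangent_space M p"
  have "v (\<lambda>x. 1) = 0" using tangent_mult[OF v Cinf_const[of 1] Cinf_const[of 1]] by simp
  then show ?thesis using tangent_lin[OF v Cinf_const[of 1] Cinf_const[of 1], of c 0] by simp
qed

lemma tangent_fun_sum:
  assumes v: "v \<in> tangent_space M p" and "\<And>i. i \<in> I \<Longrightarrow> f i \<in> Cinf M"
  shows "v (\<lambda>x. \<Sum>i\<in>I. f i x) = (\<Sum>i\<in>I. v (f i))"
  using assms(2)
proof (induction I rule: infinite_finite_induct)
  case (insert i I)
  have "v (\<lambda>x. \<Sum>i\<in>insert i I. f i x) = v (\<lambda>x. f i x + (\<Sum>i\<in>I. f i x))"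
    using insert.hyps by simp
  also have "\<dots> = v (f i) + v (\<lambda>x. \<Sum>i\<in>I. f i x)"
    using insert.prems by (intro tangent_fun_add[OF v] Cinf_sum) auto
  finally show ?case using insert by simp
qed (simp_all add: tangent_fun_const[OF v])

text \<open>With a cut-off \<open>\<theta>\<close> inside \<open>W\<close> the product \<open>\<theta> (f - h)\<close> vanishes identically, and the product rule
  gives \<open>v (f - h) = 0\<close>.\<close>

lemma tangent_local:
  assumes v: "v \<in> tangent_space M p" and "f \<in> Cinf M" "h \<in> Cinf M"
    and W: "openin (mtop M) W" "p \<in> W" and eq: "\<And>x. x \<in> W \<Longrightarrow> f x = h x"
  shows "v f = v h"
proof -
  obtain \<theta> W\<^sub>0 K where \<theta>: "\<theta> \<in> Cinf M" "p \<in> W\<^sub>0" "K \<subseteq> W" "\<And>x. x \<in> W\<^sub>0 \<Longrightarrow> \<theta> x = 1"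
    "\<And>x. x \<notin> K \<Longrightarrow> \<theta> x = 0"
    by (rule cutoff[OF W]) (rule that)
  have d: "(\<lambda>x. f x - h x) \<in> Cinf M" using assms by (simp add: Cinf_diff)
  have "(\<lambda>x. \<theta> x * (f x - h x)) = (\<lambda>x. 0)"
  proof
    fix x show "\<theta> x * (f x - h x) = 0" using eq[of x] \<theta>(3) \<theta>(5)[of x] by auto
  qed
  then have "0 = \<theta> p * v (\<lambda>x. f x - h x) + (f p - h p) * v \<theta>"
    using tangent_mult[OF v \<theta>(1) d] tangent_fun_const[OF v, of 0] by simp
  then show ?thesis using eq[OF W(2)] \<theta> tangent_fun_diff[OF v assms(2,3)] by simp
qed

lemma tangent_zero: "0 \<in> tangent_space M p"
  by (rule tangentI) auto

lemma tangent_lincomb: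
  "u \<in> tangent_space M p \<Longrightarrow> v \<in> tangent_space M p \<Longrightarrow> a \<cdot> u + b \<cdot> v \<in> tangent_space M p"
  by (rule tangentI) (simp_all add: tangent_lin tangent_mult tangent_nonsmooth algebra_simps)

lemma tangent_add: "u \<in> tangent_space M p \<Longrightarrow> v \<in> tangent_space M p \<Longrightarrow> u + v \<in> tangent_space M p"
  using tangent_lincomb[of u p v 1 1] by simp

lemma tangent_scale: "u \<in> tangent_space M p \<Longrightarrow> c \<cdot> u \<in> tangent_space M p"
  using tangent_lincomb[of u p u c 0] by simp

lemma minus_eq_tscale: "u - v = 1 \<cdot> u + (-1) \<cdot> (v :: 'z tvec)" and uminus_eq_tscale: "- v = (-1) \<cdot> (v :: 'z tvec)"
  by (auto simp: fun_eq_iff)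

lemma tangent_diff: "u \<in> tangent_space M p \<Longrightarrow> v \<in> tangent_space M p \<Longrightarrow> u - v \<in> tangent_space M p"
  unfolding minus_eq_tscale by (rule tangent_lincomb)

lemma tangent_uminus: "v \<in> tangent_space M p \<Longrightarrow> - v \<in> tangent_space M p"
  unfolding uminus_eq_tscale by (rule tangent_scale)

lemma tangent_sum:
  "(\<And>i. i \<in> I \<Longrightarrow> v i \<in> tangent_space M p) \<Longrightarrow> (\<Sum>i\<in>I. v i) \<in> tangent_space M p"
  by (induction I rule: infinite_finite_induct) (auto simp: tangent_zero tangent_add)

text \<open>By the Hadamard lemma \<open>f - f p\<close> is near \<open>p\<close> a sum of products of a coordinate that vanishes at \<open>p\<close>
  and a smooth function, and a derivation sees only the values of the second factors at \<open>p\<close>.\<close>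

lemma tangent_coordinates:
  assumes v: "v \<in> tangent_space M p" and c: "(U, \<kappa>) \<in> atlas M" "p \<in> U"
    and y: "\<And>b. b \<in> Basis \<Longrightarrow> y b \<in> Cinf M" and W: "openin (mtop M) W" "p \<in> W"
    and yW: "\<And>b x. b \<in> Basis \<Longrightarrow> x \<in> W \<Longrightarrow> y b x = \<kappa> x \<bullet> b" and f: "f \<in> Cinf M"
  shows "v f = (\<Sum>b\<in>Basis. v (y b) * frechet_derivative (f \<circ> inv_into U \<kappa>) (at (\<kappa> p)) b)"
proof -
  let ?F = "f \<circ> inv_into U \<kappa>"
  let ?G = "\<lambda>b. ray_moment (\<kappa> p) 0 (\<lambda>z. frechet_derivative ?F (at z) b)"
  have "open (\<kappa> ` U)" using chart_image_open[OF c(1) chart_openin[OF c(1)]] by simp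
  then obtain r where r: "r > 0" "ball (\<kappa> p) r \<subseteq> \<kappa> ` U"
    using c(2) openE by blast
  define W1 where "W1 = {x \<in> U. \<kappa> x \<in> ball (\<kappa> p) r}"
  have W1: "openin (mtop M) W1" "p \<in> W1" "W1 \<subseteq> U" "\<kappa> ` W1 \<subseteq> ball (\<kappa> p) r"
    unfolding W1_def using c r(1) by (auto intro: chart_vimage_openin[OF c(1) open_ball, simplified])
  have F: "smooth_on (ball (\<kappa> p) r) ?F" by (rule smooth_on_subset[OF CinfD[OF f c(1)] r(2)])
  have "\<exists>g W'. g \<in> Cinf M \<and> openin (mtop M) W' \<and> p \<in> W' \<and> W' \<subseteq> W1 \<and> (\<forall>x\<in>W'. g x = ?G b (\<kappa> x))" for b
  proof -
    have "(\<lambda>x. ?G b (\<kappa> x)) \<in> Cinf_on M W1"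
      by (rule Cinf_on_chart[OF c(1) W1(1,3) smooth_on_subset[OF smooth_on_ray_moment[OF smooth_on_deriv[OF F]] W1(4)]])
    then show ?thesis by (rule Cinf_on_extend[OF W1(1,2)]) blast
  qed
  then obtain g W' where g: "\<And>b. g b \<in> Cinf M" and W': "\<And>b. openin (mtop M) (W' b)" "\<And>b. p \<in> W' b"
    "\<And>b. W' b \<subseteq> W1" and gW: "\<And>b x. x \<in> W' b \<Longrightarrow> g b x = ?G b (\<kappa> x)"
    by metis
  define W2 where "W2 = W \<inter> W1 \<inter> (\<Inter>b\<in>Basis. W' b)"
  have W2: "openin (mtop M) W2" "p \<in> W2"
    using W W1 W' by (auto simp: W2_def intro!: openin_Int openin_Inter)
  have term_Cinf: "(\<lambda>x. (y b x - y b p) * g b x) \<in> Cinf M" if "b \<in> Basis" for b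
    by (intro Cinf_mult Cinf_diff Cinf_const y g that)
  have "v f = v (\<lambda>x. f p + (\<Sum>b\<in>Basis. (y b x - y b p) * g b x))"
  proof (rule tangent_local[OF v f _ W2])
    show "(\<lambda>x. f p + (\<Sum>b\<in>Basis. (y b x - y b p) * g b x)) \<in> Cinf M"
      by (intro Cinf_add Cinf_const Cinf_sum term_Cinf)
    fix x assume x: "x \<in> W2"
    then have xU: "x \<in> U" "\<kappa> x \<in> ball (\<kappa> p) r" by (auto simp: W2_def W1_def)
    have "f x = ?F (\<kappa> x)" using chart_inv[OF c(1) xU(1)] by simp
    also have "\<dots> = ?F (\<kappa> p) + (\<Sum>b\<in>Basis. ((\<kappa> x - \<kappa> p) \<bullet> b) * ?G b (\<kappa> x))"
      by (rule hadamard[OF F xU(2)])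
    also have "\<dots> = f p + (\<Sum>b\<in>Basis. (y b x - y b p) * g b x)"
      using x W2(2) chart_inv[OF c] by (auto simp: W2_def yW gW inner_diff_left intro!: sum.cong)
    finally show "f x = f p + (\<Sum>b\<in>Basis. (y b x - y b p) * g b x)" .
  qed
  also have "\<dots> = v (\<lambda>x. f p) + v (\<lambda>x. \<Sum>b\<in>Basis. (y b x - y b p) * g b x)"
    by (intro tangent_fun_add[OF v] Cinf_const Cinf_sum term_Cinf)
  also have "\<dots> = (\<Sum>b\<in>Basis. v (\<lambda>x. (y b x - y b p) * g b x))"
    by (subst tangent_fun_sum[OF v term_Cinf]) (simp_all add: tangent_fun_const[OF v])
  also have "\<dots> = (\<Sum>b\<in>Basis. v (y b) * frechet_derivative ?F (at (\<kappa> p)) b)"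
  proof (rule sum.cong[OF refl])
    fix b :: 'e assume b: "b \<in> Basis"
    have "v (\<lambda>x. (y b x - y b p) * g b x) = g b p * (v (y b) - v (\<lambda>x. y b p))"
      by (subst tangent_mult[OF v Cinf_diff[OF y[OF b] Cinf_const] g])
        (simp add: tangent_fun_diff[OF v y[OF b] Cinf_const])
    also have "g b p = frechet_derivative ?F (at (\<kappa> p)) b"
      by (simp add: gW[OF W'(2)] ray_moment_center)
    finally show "v (\<lambda>x. (y b x - y b p) * g b x) = v (y b) * frechet_derivative ?F (at (\<kappa> p)) b"
      by (simp add: tangent_fun_const[OF v])
  qed
  finally show ?thesis .
qed

lemma vector_fieldI:
  assumes "\<And>p. p \<in> points M \<Longrightarrow> X p \<in> tangent_space M p" "\<And>p. p \<notin> points M \<Longrightarrow> X p = 0"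
    "\<And>f. f \<in> Cinf M \<Longrightarrow> (\<lambda>p. X p f) \<in> Cinf M"
  shows "X \<in> vector_fields M"
  using assms by (simp add: vector_fields_def fields_along_def)

lemma vf_tangent: "X \<in> vector_fields M \<Longrightarrow> p \<in> points M \<Longrightarrow> X p \<in> tangent_space M p"
  by (simp add: vector_fields_def fields_along_def)

lemma vf_outside: "X \<in> vector_fields M \<Longrightarrow> p \<notin> points M \<Longrightarrow> X p = 0"
  by (simp add: vector_fields_def fields_along_def)

lemma vf_smooth: "X \<in> vector_fields M \<Longrightarrow> (\<lambda>p. X p f) \<in> Cinf M"
proof (cases "f \<in> Cinf M")
  case False
  assume X: "X \<in> vector_fields M"
  have "X p f = 0" for p
    using False X by (cases "p \<in> points M") (auto simp: vf_outside intro: tangent_nonsmooth[OF vf_tangent])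
  then show ?thesis by (simp add: Cinf_const)
qed (simp add: vector_fields_def fields_along_def)

lemma vf_zero: "0 \<in> vector_fields M"
  by (rule vector_fieldI) (auto simp: tangent_zero Cinf_const)

lemma vf_add: "X \<in> vector_fields M \<Longrightarrow> Y \<in> vector_fields M \<Longrightarrow> X + Y \<in> vector_fields M"
  by (rule vector_fieldI) (auto simp: tangent_add vf_tangent vf_outside Cinf_add vf_smooth)

lemma vf_fscale: "f \<in> Cinf M \<Longrightarrow> X \<in> vector_fields M \<Longrightarrow> fscale f X \<in> vector_fields M"
  by (rule vector_fieldI) (auto simp: tangent_scale vf_tangent vf_outside Cinf_mult vf_smooth)

lemma vf_sum: "(\<And>i. i \<in> I \<Longrightarrow> X i \<in> vector_fields M) \<Longrightarrow> (\<Sum>i\<in>I. X i) \<in> vector_fields M"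
  by (induction I rule: infinite_finite_induct) (auto simp: vf_zero vf_add)

text \<open>Coordinate fields of a chart, multiplied by a cut-off so that they become fields on the whole
  manifold.\<close>

lemma coordinate_field:
  assumes c: "(U, \<kappa>) \<in> atlas M" and \<theta>: "\<theta> \<in> Cinf M" "closedin (mtop M) K" "K \<subseteq> U" "\<And>x. x \<notin> K \<Longrightarrow> \<theta> x = 0"
  shows "(\<lambda>q f. if q \<in> U then \<theta> q * (if f \<in> Cinf M then frechet_derivative (f \<circ> inv_into U \<kappa>) (at (\<kappa> q)) b else 0)
    else 0) \<in> vector_fields M" (is "?Z \<in> _")
proof (rule vector_fieldI)
  fix p assume p: "p \<in> points M"
  show "?Z p \<in> tangent_space M p"
  proof (cases "p \<in> U")
    case True
    have d: "(f \<circ> inv_into U \<kappa> has_derivative frechet_derivative (f \<circ> inv_into U \<kappa>) (at (\<kappa> p))) (at (\<kappa> p))"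
      if "f \<in> Cinf M" for f
      using smooth_on_has_derivative[OF CinfD[OF that c]] True by blast
    show ?thesis
    proof (rule tangentI)
      fix f h and \<alpha> \<beta> :: real assume fh: "f \<in> Cinf M" "h \<in> Cinf M"
      have eq: "(\<lambda>x. \<alpha> * f x + \<beta> * h x) \<circ> inv_into U \<kappa>
          = (\<lambda>z. \<alpha> * (f \<circ> inv_into U \<kappa>) z + \<beta> * (h \<circ> inv_into U \<kappa>) z)" by (simp add: fun_eq_iff)
      have "(\<lambda>x. \<alpha> * f x + \<beta> * h x) \<in> Cinf M" using fh by (intro Cinf_add Cinf_scale)
      moreover have "frechet_derivative ((\<lambda>x. \<alpha> * f x + \<beta> * h x) \<circ> inv_into U \<kappa>) (at (\<kappa> p))
          = (\<lambda>b. \<alpha> * frechet_derivative (f \<circ> inv_into U \<kappa>) (at (\<kappa> p)) b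
             + \<beta> * frechet_derivative (h \<circ> inv_into U \<kappa>) (at (\<kappa> p)) b)"
        unfolding eq
        by (rule frechet_derivative_at[symmetric], intro has_derivative_add has_derivative_mult_right d fh)
      ultimately show "?Z p (\<lambda>x. \<alpha> * f x + \<beta> * h x) = \<alpha> * ?Z p f + \<beta> * ?Z p h"
        using fh by (simp add: algebra_simps)
    next
      fix f h assume fh: "f \<in> Cinf M" "h \<in> Cinf M"
      have eq: "(\<lambda>x. f x * h x) \<circ> inv_into U \<kappa> = (\<lambda>z. (f \<circ> inv_into U \<kappa>) z * (h \<circ> inv_into U \<kappa>) z)"
        by (simp add: fun_eq_iff)
      have "(\<lambda>x. f x * h x) \<in> Cinf M" using fh by (rule Cinf_mult)
      moreover have "frechet_derivative ((\<lambda>x. f x * h x) \<circ> inv_into U \<kappa>) (at (\<kappa> p))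
          = (\<lambda>b. (f \<circ> inv_into U \<kappa>) (\<kappa> p) * frechet_derivative (h \<circ> inv_into U \<kappa>) (at (\<kappa> p)) b
             + frechet_derivative (f \<circ> inv_into U \<kappa>) (at (\<kappa> p)) b * (h \<circ> inv_into U \<kappa>) (\<kappa> p))"
        unfolding eq
        by (rule frechet_derivative_at[symmetric], intro has_derivative_mult d fh)
      ultimately show "?Z p (\<lambda>x. f x * h x) = f p * ?Z p h + h p * ?Z p f"
        using fh chart_inv[OF c True] by (simp add: algebra_simps)
    qed auto
  next
    case False
    then have "?Z p = 0" by (auto simp: fun_eq_iff)
    then show ?thesis by (simp add: tangent_zero)
  qed
next
  fix f assume f: "f \<in> Cinf M"
  have "smooth_on (\<kappa> ` U) (\<lambda>z. frechet_derivative (f \<circ> inv_into U \<kappa>) (at z) b)"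
    by (rule smooth_on_deriv[OF CinfD[OF f c]])
  then have "(\<lambda>q. frechet_derivative (f \<circ> inv_into U \<kappa>) (at (\<kappa> q)) b) \<in> Cinf_on M U"
    by (rule Cinf_on_chart[OF c chart_openin[OF c] order_refl])
  from Cinf_cutoff_mult[OF chart_openin[OF c] this \<theta>(2,3,1,4)]
  show "(\<lambda>q. ?Z q f) \<in> Cinf M" using f by (simp cong: if_cong)
qed (use chart_subset[OF c] in \<open>auto simp: fun_eq_iff\<close>)

end

text \<open>The model is a system of coordinates with its coordinate fields. The functions and fields are
  global, as derivations act on global functions and sections are global.\<close>

definition local_frame ::
  "('a, 'e::euclidean_space) mfd \<Rightarrow> 'a set \<Rightarrow> ('e \<Rightarrow> 'a \<Rightarrow> real) \<Rightarrow> ('e \<Rightarrow> 'a \<Rightarrow> 'a tvec) \<Rightarrow> bool" where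
  "local_frame M W y Z \<longleftrightarrow> openin (mtop M) W \<and> (\<forall>b\<in>Basis. y b \<in> Cinf M \<and> Z b \<in> vector_fields M) \<and>
     (\<forall>q\<in>W. \<forall>b\<in>Basis. \<forall>c\<in>Basis. Z b q (y c) = (if b = c then 1 else 0)) \<and>
     (\<forall>q\<in>W. \<forall>v\<in>tangent_space M q. v = (\<Sum>b\<in>Basis. v (y b) \<cdot> Z b q))"

context manifold
begin

lemma local_frame_exists:
  assumes "p \<in> points M"
  obtains W y Z where "local_frame M W y Z" "p \<in> W"
proof -
  obtain U \<kappa> where c: "(U, \<kappa>) \<in> atlas M" "p \<in> U" using chart_exists assms .
  obtain \<theta> W\<^sub>0 K where \<theta>: "\<theta> \<in> Cinf M" "openin (mtop M) W\<^sub>0" "p \<in> W\<^sub>0" "closedin (mtop M) K" "W\<^sub>0 \<subseteq> K" "K \<subseteq> U"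
    "\<And>x. x \<in> W\<^sub>0 \<Longrightarrow> \<theta> x = 1" "\<And>x. x \<notin> K \<Longrightarrow> \<theta> x = 0"
    by (rule cutoff[OF chart_openin[OF c(1)] c(2)]) (rule that)
  have WU: "W\<^sub>0 \<subseteq> U" using \<theta> by blast
  define y where "y = (\<lambda>b x. if x \<in> U then \<theta> x * (\<kappa> x \<bullet> b) else 0)"
  define Z where "Z = (\<lambda>b q f. if q \<in> U
    then \<theta> q * (if f \<in> Cinf M then frechet_derivative (f \<circ> inv_into U \<kappa>) (at (\<kappa> q)) b else 0) else 0)"
  have y: "y b \<in> Cinf M" for b
  proof -
    have "(\<lambda>x. \<kappa> x \<bullet> b) \<in> Cinf_on M U"
      by (rule Cinf_on_chart[OF c(1) chart_openin[OF c(1)] order_refl])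
        (intro smooth_on_bounded_linear bounded_linear_inner_left)
    from Cinf_cutoff_mult[OF chart_openin[OF c(1)] this \<theta>(4,6,1,8)]
    show ?thesis by (simp add: y_def)
  qed
  have Z: "Z b \<in> vector_fields M" for b
    unfolding Z_def by (rule coordinate_field[OF c(1) \<theta>(1,4,6,8)])
  have yW: "y b x = \<kappa> x \<bullet> b" if "x \<in> W\<^sub>0" for b x
    using that WU \<theta>(7) by (auto simp: y_def)
  have ZW: "Z b q f = frechet_derivative (f \<circ> inv_into U \<kappa>) (at (\<kappa> q)) b" if "q \<in> W\<^sub>0" "f \<in> Cinf M" for b q f
    using that WU \<theta>(7) by (auto simp: Z_def)
  have dual: "Z b q (y c') = b \<bullet> c'" if q: "q \<in> W\<^sub>0" for b q c'
  proof -
    have o: "open (\<kappa> ` (U \<inter> W\<^sub>0))" by (rule chart_image_open[OF c(1) \<theta>(2)])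
    have "((\<lambda>z. z \<bullet> c') has_derivative (\<lambda>z. z \<bullet> c')) (at (\<kappa> q))"
      by (intro bounded_linear_imp_has_derivative bounded_linear_inner_left)
    then have "(y c' \<circ> inv_into U \<kappa> has_derivative (\<lambda>z. z \<bullet> c')) (at (\<kappa> q))"
      by (rule has_derivative_transform_within_open[OF _ o])
        (use q WU chart_inv[OF c(1)] yW in auto)
    then show ?thesis using ZW[OF q y] by (simp add: frechet_derivative_at[symmetric])
  qed
  have span: "v = (\<Sum>b\<in>Basis. v (y b) \<cdot> Z b q)" if q: "q \<in> W\<^sub>0" and v: "v \<in> tangent_space M q" for q v
  proof
    fix f
    show "v f = (\<Sum>b\<in>Basis. v (y b) \<cdot> Z b q) f"
    proof (cases "f \<in> Cinf M")
      case True
      have "v f = (\<Sum>b\<in>Basis. v (y b) * frechet_derivative (f \<circ> inv_into U \<kappa>) (at (\<kappa> q)) b)"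
        by (rule tangent_coordinates[OF v c(1) _ y \<theta>(2) q _ True]) (use q WU yW in auto)
      then show ?thesis by (simp add: sum_fun_apply ZW[OF q True])
    next
      case False
      then have "Z b q f = 0" for b by (simp add: Z_def)
      with False show ?thesis by (simp add: sum_fun_apply tangent_nonsmooth[OF v])
    qed
  qed
  have "local_frame M W\<^sub>0 y Z"
    unfolding local_frame_def using \<theta>(2) y Z dual span by (auto simp: inner_Basis)
  then show ?thesis using that \<theta>(3) by blast
qed

lemma local_frame_basis:
  assumes "p \<in> points M"
  obtains e :: "'e \<Rightarrow> 'a tvec" and y where "\<And>b. b \<in> Basis \<Longrightarrow> e b \<in> tangent_space M p" "\<And>b. b \<in> Basis \<Longrightarrow> y b \<in> Cinf M"
    "\<And>b c. b \<in> Basis \<Longrightarrow> c \<in> Basis \<Longrightarrow> e b (y c) = (if b = c then 1 else 0)"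
    "\<And>v. v \<in> tangent_space M p \<Longrightarrow> v = (\<Sum>b\<in>Basis. v (y b) \<cdot> e b)"
proof -
  obtain W y Z where f: "local_frame M W y Z" "p \<in> W" using local_frame_exists assms .
  show ?thesis
    by (rule that[of "\<lambda>b. Z b p" y]) (use f assms in \<open>auto simp: local_frame_def intro: vf_tangent\<close>)
qed

lemma tangent_vector_extends:
  assumes "p \<in> points M" "v \<in> tangent_space M p"
  obtains X where "X \<in> vector_fields M" "X p = v"
proof -
  obtain W y Z where f: "local_frame M W y Z" "p \<in> W" using local_frame_exists assms(1) .
  show ?thesis
  proof
    show "(\<Sum>b\<in>Basis. fscale (\<lambda>q. v (y b)) (Z b)) \<in> vector_fields M"
      using f by (intro vf_sum vf_fscale Cinf_const) (auto simp: local_frame_def)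
    have "v = (\<Sum>b\<in>Basis. v (y b) \<cdot> Z b p)"
      using f assms(2) unfolding local_frame_def by blast
    then show "(\<Sum>b\<in>Basis. fscale (\<lambda>q. v (y b)) (Z b)) p = v" by (simp add: sum_fun_apply)
  qed
qed

text \<open>Gaussian elimination for fields: subtracting multiples of fields dual to the \<open>f i\<close> produces a field
  that kills every \<open>f i\<close>.\<close>

lemma eliminate_components:
  assumes "finite I" and X: "X \<in> vector_fields M" and E: "\<And>i. i \<in> I \<Longrightarrow> E i \<in> vector_fields M"
  obtains Y where "Y \<in> vector_fields M" "\<And>q g. Y q g = X q g - (\<Sum>i\<in>I. X q (f i) * E i q g)"
    "\<And>q j. \<forall>i\<in>I. E i q (f j) = (if i = j then 1 else 0) \<Longrightarrow> j \<in> I \<Longrightarrow> Y q (f j) = 0"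
proof -
  define Y where "Y = X + (\<Sum>i\<in>I. fscale (\<lambda>q. - 1 * X q (f i)) (E i))"
  have Y: "Y \<in> vector_fields M"
    unfolding Y_def by (intro vf_add X vf_sum vf_fscale Cinf_scale vf_smooth E)
  have Yq: "Y q g = X q g - (\<Sum>i\<in>I. X q (f i) * E i q g)" for q g
    by (simp add: Y_def sum_fun_apply sum_negf)
  have YI: "Y q (f j) = 0" if dual: "\<forall>i\<in>I. E i q (f j) = (if i = j then 1 else 0)" and "j \<in> I" for q j
  proof -
    have "(\<Sum>i\<in>I. X q (f i) * E i q (f j)) = (\<Sum>i\<in>I. if i = j then X q (f i) else 0)"
      by (rule sum.cong) (auto simp: dual)
    then show ?thesis using \<open>j \<in> I\<close> assms(1) by (simp add: Yq)
  qed
  show ?thesis by (rule that[OF Y Yq YI])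
qed

text \<open>Arbitrary extensions of the vectors are corrected one index at a time. After the components along
  the earlier fields are removed, the new field still pairs with its own function to \<open>1\<close> at \<open>p\<close>, so
  that one can divide by this pairing near \<open>p\<close>.\<close>

lemma dual_fields:
  assumes "finite I" and p: "p \<in> points M"
    and "\<And>i. i \<in> I \<Longrightarrow> f i \<in> Cinf M" "\<And>i. i \<in> I \<Longrightarrow> u i \<in> tangent_space M p"
    and "\<And>i j. i \<in> I \<Longrightarrow> j \<in> I \<Longrightarrow> u i (f j) = (if i = j then 1 else 0)"
  shows "\<exists>E W. openin (mtop M) W \<and> p \<in> W \<and> (\<forall>i\<in>I. E i \<in> vector_fields M) \<and>
    (\<forall>q\<in>W. \<forall>i\<in>I. \<forall>j\<in>I. E i q (f j) = (if i = j then 1 else 0))"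
  using assms(1,3-)
proof (induction I rule: finite_induct)
  case empty
  then show ?case using p by (intro exI[of _ "\<lambda>_. 0"] exI[of _ "points M"]) auto
next
  case (insert k I)
  have "\<exists>E W. openin (mtop M) W \<and> p \<in> W \<and> (\<forall>i\<in>I. E i \<in> vector_fields M) \<and>
    (\<forall>q\<in>W. \<forall>i\<in>I. \<forall>j\<in>I. E i q (f j) = (if i = j then 1 else 0))"
    using insert.prems by (intro insert.IH) auto
  then obtain E W where all: "openin (mtop M) W \<and> p \<in> W \<and> (\<forall>i\<in>I. E i \<in> vector_fields M) \<and>
    (\<forall>q\<in>W. \<forall>i\<in>I. \<forall>j\<in>I. E i q (f j) = (if i = j then 1 else 0))"
    by (elim exE) (rule that)
  then have W: "openin (mtop M) W" "p \<in> W" by blast+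
  have E: "E i \<in> vector_fields M" if "i \<in> I" for i using all that by blast
  have EW: "E i q (f j) = (if i = j then 1 else 0)" if "q \<in> W" "i \<in> I" "j \<in> I" for q i j
    using all that by blast
  obtain X where X: "X \<in> vector_fields M" "X p = u k"
    using tangent_vector_extends[OF p] insert.prems(2)[of k] by blast
  obtain Y where Y: "Y \<in> vector_fields M" and Yq: "\<And>q g. Y q g = X q g - (\<Sum>i\<in>I. X q (f i) * E i q g)"
    and YE: "\<And>q j. \<forall>i\<in>I. E i q (f j) = (if i = j then 1 else 0) \<Longrightarrow> j \<in> I \<Longrightarrow> Y q (f j) = 0"
    by (rule eliminate_components[where f = f, OF insert.hyps(1) X(1) E]) (assumption, rule that)
  have YI: "Y q (f j) = 0" if "q \<in> W" "j \<in> I" for q j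
    by (rule YE) (use EW that in auto)
  have "Y p (f k) = 1"
  proof -
    have "X p (f i) = 0" if "i \<in> I" for i
      using that insert.prems(3)[of k i] insert.hyps(2) X(2) by auto
    then show ?thesis using X(2) insert.prems(3)[of k k] by (simp add: Yq)
  qed
  then obtain g W1 where g: "g \<in> Cinf M" and W1: "openin (mtop M) W1" "p \<in> W1"
    and gW: "\<And>x. x \<in> W1 \<Longrightarrow> g x * Y x (f k) = 1"
    using Cinf_reciprocal_near[OF vf_smooth[OF Y] p] by (metis zero_neq_one)
  define E' where "E' = (\<lambda>i. if i = k then fscale g Y else E i + fscale (\<lambda>q. (- 1 * E i q (f k)) * g q) Y)"
  have "E' i \<in> vector_fields M" if "i \<in> insert k I" for i
  proof (cases "i = k")
    case True
    then show ?thesis using vf_fscale[OF g Y] by (simp add: E'_def)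
  next
    case False
    with that have i: "E i \<in> vector_fields M" using E by blast
    have "E i + fscale (\<lambda>q. (- 1 * E i q (f k)) * g q) Y \<in> vector_fields M"
      by (intro vf_add vf_fscale Cinf_mult Cinf_scale i g Y vf_smooth[OF i])
    with False show ?thesis by (simp only: E'_def if_False)
  qed
  moreover have "E' i q (f j) = (if i = j then 1 else 0)"
    if q: "q \<in> W \<inter> W1" and ij: "i \<in> insert k I" "j \<in> insert k I" for q i j
  proof -
    have gk: "g q * Y q (f k) = 1" using gW q by blast
    have "E i q (f k) * (g q * Y q (f k)) = E i q (f k)" using gk by simp
    then show ?thesis
      using q ij gk YI[of q j] EW[of q i j] insert.hyps(2) by (auto simp: E'_def algebra_simps)
  qed
  ultimately show ?case
    using W W1 by (intro exI[of _ E'] exI[of _ "W \<inter> W1"]) (auto intro: openin_Int)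
qed

text \<open>Duality makes the vectors independent, and their number is the dimension of the tangent space.\<close>

lemma dual_vectors_span:
  fixes e :: "'e \<Rightarrow> 'a tvec"
  assumes p: "p \<in> points M" and f: "\<And>b. b \<in> Basis \<Longrightarrow> f b \<in> Cinf M"
    and e: "\<And>b. b \<in> Basis \<Longrightarrow> e b \<in> tangent_space M p"
    and dual: "\<And>b c. b \<in> Basis \<Longrightarrow> c \<in> Basis \<Longrightarrow> e b (f c) = (if b = c then 1 else 0)"
    and v: "v \<in> tangent_space M p"
  shows "v = (\<Sum>b\<in>Basis. v (f b) \<cdot> e b)"
proof -
  obtain z :: "'e \<Rightarrow> 'a tvec" and y where y: "\<And>b. b \<in> Basis \<Longrightarrow> y b \<in> Cinf M"
    and span: "\<And>v. v \<in> tangent_space M p \<Longrightarrow> v = (\<Sum>b\<in>Basis. v (y b) \<cdot> z b)"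
    by (rule local_frame_basis[OF p]) (rule that)
  define c where "c = (\<lambda>x::'e. \<Sum>b\<in>Basis. (x \<bullet> b) \<cdot> e b)"
  have c: "c x \<in> tangent_space M p" for x unfolding c_def by (intro tangent_sum tangent_scale e)
  have cf: "c x (f b) = x \<bullet> b" if "b \<in> Basis" for x b
  proof -
    have "c x (f b) = (\<Sum>d\<in>Basis. if d = b then x \<bullet> d else 0)"
      unfolding c_def sum_fun_apply by (rule sum.cong) (use that in \<open>auto simp: dual\<close>)
    then show ?thesis using that by simp
  qed
  define L where "L = (\<lambda>x::'e. \<Sum>k\<in>Basis. c x (y k) *\<^sub>R k)"
  have Lk: "L x \<bullet> k = c x (y k)" if "k \<in> Basis" for x k
    using that by (simp add: L_def inner_sum_left inner_Basis if_distrib cong: if_cong)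
  have lin: "linear L"
    by (rule linearI)
      (auto simp: L_def c_def sum_fun_apply inner_add_left sum.distrib algebra_simps sum_distrib_left scaleR_sum_right
        scaleR_add_left sum_distrib_right simp flip: scaleR_sum_left)
  moreover have "inj L"
  proof (subst linear_injective_0[OF lin], safe)
    fix x assume "L x = 0"
    then have "c x (y k) = 0" if "k \<in> Basis" for k using Lk[OF that, of x] by simp
    then have "(\<Sum>b\<in>Basis. c x (y b) \<cdot> z b) = 0" by simp
    then have "c x = 0" by (simp only: span[OF c, of x, symmetric])
    then have "x \<bullet> b = 0" if "b \<in> Basis" for b using cf[OF that, of x] by simp
    then show "x = 0" by (simp add: euclidean_eq_iff[of x 0])
  qed
  ultimately have "surj L" by (rule linear_inj_imp_surj)
  then obtain x where x: "L x = (\<Sum>k\<in>Basis. v (y k) *\<^sub>R k)" by (metis surjD)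
  have "c x (y k) = v (y k)" if "k \<in> Basis" for k
    using Lk[OF that, of x] that unfolding x by (simp add: inner_sum_left inner_Basis if_distrib cong: if_cong)
  then have "(\<Sum>b\<in>Basis. v (y b) \<cdot> z b) = (\<Sum>b\<in>Basis. c x (y b) \<cdot> z b)" by simp
  then have vc: "v = c x" by (simp only: span[OF v, symmetric] span[OF c, symmetric])
  have "(\<Sum>b\<in>Basis. c x (f b) \<cdot> e b) = (\<Sum>b\<in>Basis. (x \<bullet> b) \<cdot> e b)"
    by (rule sum.cong) (simp_all add: cf)
  also have "\<dots> = c x" by (simp only: c_def)
  finally show ?thesis by (simp only: vc)
qed

end

section \<open>Smooth maps and integral manifolds\<close>

lemma Cinf_pullback:
  assumes M: "smooth_manifold M" and N: "smooth_manifold N" and F: "smooth_map M N F" and h: "h \<in> Cinf N"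
  shows "h \<circ> F \<in> Cinf M"
proof -
  interpret M: manifold M by unfold_locales (rule M)
  interpret N: manifold N by unfold_locales (rule N)
  have cF: "continuous_map (mtop M) (mtop N) F" using F by (simp add: smooth_map_def)
  show ?thesis
    unfolding M.Cinf_eq_Cinf_on
  proof (rule M.Cinf_onI)
    fix p assume p: "p \<in> points M"
    obtain U \<kappa> where c: "(U, \<kappa>) \<in> atlas M" "p \<in> U" using M.chart_exists p .
    have "F p \<in> points N" using cF p by (auto simp: continuous_map_def)
    then obtain V \<psi> where d: "(V, \<psi>) \<in> atlas N" "F p \<in> V" using N.chart_exists by blast
    define W where "W = U \<inter> {x \<in> points M. F x \<in> V}"
    have W: "openin (mtop M) W"
      unfolding W_def by (intro openin_Int M.chart_openin[OF c(1)] openin_continuous_map_preimage[OF cF] N.chart_openin[OF d(1)])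
    have W_eq: "W = U \<inter> F -` V" using M.chart_subset[OF c(1)] by (auto simp: W_def)
    have "U \<inter> W = W" by (auto simp: W_def)
    then have o: "open (\<kappa> ` W)" using M.chart_image_open[OF c(1) W] by simp
    have inv: "inv_into U \<kappa> (\<kappa> x) = x" if "x \<in> W" for x
      using that M.chart_inv[OF c(1)] by (simp add: W_def)
    have "smooth_on (\<kappa> ` W) (\<lambda>z. (h \<circ> inv_into V \<psi>) ((\<psi> \<circ> F \<circ> inv_into U \<kappa>) z))"
    proof (rule smooth_on_compose[OF o _ _ N.CinfD[OF h d(1)]])
      show "(\<psi> \<circ> F \<circ> inv_into U \<kappa>) ` \<kappa> ` W \<subseteq> \<psi> ` V" using inv by (auto simp: W_def)
      show "smooth_on (\<kappa> ` W) (\<psi> \<circ> F \<circ> inv_into U \<kappa>)"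
        using F c(1) d(1) unfolding smooth_map_def W_eq by blast
    qed
    then have "smooth_on (\<kappa> ` W) (h \<circ> F \<circ> inv_into U \<kappa>)"
      by (rule smooth_on_cong[OF o, rotated]) (use inv N.chart_inv[OF d(1)] in \<open>auto simp: W_def\<close>)
    with c W d p show "\<exists>U \<kappa> W'. (U, \<kappa>) \<in> atlas M \<and> openin (mtop M) W' \<and> p \<in> W' \<and> W' \<subseteq> U \<and>
        smooth_on (\<kappa> ` W') (h \<circ> F \<circ> inv_into U \<kappa>)"
      by (intro exI[of _ U] exI[of _ \<kappa>] exI[of _ W]) (auto simp: W_def)
  qed
qed

lemma pushfwd_tangent:
  assumes M: "smooth_manifold M" and N: "smooth_manifold N" and F: "smooth_map M N F"
    and v: "v \<in> tangent_space M p"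
  shows "pushfwd N F v \<in> tangent_space N (F p)"
proof -
  interpret M: manifold M by unfold_locales (rule M)
  interpret N: manifold N by unfold_locales (rule N)
  have pb: "(\<lambda>x. h (F x)) \<in> Cinf M" if "h \<in> Cinf N" for h
    using Cinf_pullback[OF M N F that] by (simp add: o_def)
  show ?thesis
    by (rule N.tangentI)
      (simp_all add: pushfwd_def o_def M.tangent_lin[OF v pb pb] M.tangent_mult[OF v pb pb]
        N.Cinf_add N.Cinf_scale N.Cinf_mult)
qed

lemma pushfwd_zero [simp]: "pushfwd N F 0 = 0"
  and pushfwd_lincomb: "pushfwd N F (a \<cdot> u + b \<cdot> v) = a \<cdot> pushfwd N F u + b \<cdot> pushfwd N F v"
  and pushfwd_diff: "pushfwd N F (u - v) = pushfwd N F u - pushfwd N F v"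
  and pushfwd_tscale: "pushfwd N F (a \<cdot> v) = a \<cdot> pushfwd N F v"
  by (auto simp: pushfwd_def fun_eq_iff)

lemma pushfwd_sum: "pushfwd N F (\<Sum>i\<in>I. v i) = (\<Sum>i\<in>I. pushfwd N F (v i))"
proof
  fix h show "pushfwd N F (\<Sum>i\<in>I. v i) h = (\<Sum>i\<in>I. pushfwd N F (v i)) h"
    by (cases "h \<in> Cinf N") (simp_all add: pushfwd_def sum_fun_apply)
qed

lemma pushfwd_apply: "h \<in> Cinf N \<Longrightarrow> pushfwd N F v h = v (\<lambda>x. h (F x))"
  by (simp add: pushfwd_def o_def)

lemma (in manifold) lie_bracket_tangent:
  assumes X: "X \<in> vector_fields M" and Y: "Y \<in> vector_fields M" and p: "p \<in> points M"
  shows "lie_bracket X Y p \<in> tangent_space M p"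
proof -
  have lin: "(\<lambda>q. Z q (\<lambda>x. a * f x + b * h x)) = (\<lambda>q. a * Z q f + b * Z q h)"
    if Z: "Z \<in> vector_fields M" and f: "f \<in> Cinf M" and h: "h \<in> Cinf M" for Z f h a b
  proof
    fix q show "Z q (\<lambda>x. a * f x + b * h x) = a * Z q f + b * Z q h"
      using tangent_lin[OF vf_tangent[OF Z] f h] vf_outside[OF Z, of q] by (cases "q \<in> points M") auto
  qed
  have mult: "(\<lambda>q. Z q (\<lambda>x. f x * h x)) = (\<lambda>q. f q * Z q h + h q * Z q f)"
    if Z: "Z \<in> vector_fields M" and f: "f \<in> Cinf M" and h: "h \<in> Cinf M" for Z f h
  proof
    fix q show "Z q (\<lambda>x. f x * h x) = f q * Z q h + h q * Z q f"
      using tangent_mult[OF vf_tangent[OF Z] f h] vf_outside[OF Z, of q] by (cases "q \<in> points M") auto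
  qed
  have null: "(\<lambda>q. Z q f) = (\<lambda>q. 0)" if Z: "Z \<in> vector_fields M" and f: "f \<notin> Cinf M" for Z f
  proof
    fix q show "Z q f = 0"
      using tangent_nonsmooth[OF vf_tangent[OF Z] f] vf_outside[OF Z, of q] by (cases "q \<in> points M") auto
  qed
  note t = vf_tangent[OF X p] vf_tangent[OF Y p] and s = vf_smooth[OF X] vf_smooth[OF Y]
  show ?thesis
  proof (rule tangentI)
    fix f h and a b :: real assume fh: "f \<in> Cinf M" "h \<in> Cinf M"
    show "lie_bracket X Y p (\<lambda>x. a * f x + b * h x) = a * lie_bracket X Y p f + b * lie_bracket X Y p h"
      by (simp add: lie_bracket_def lin[OF X fh] lin[OF Y fh] tangent_lin[OF t(1) s(2) s(2)]
          tangent_lin[OF t(2) s(1) s(1)] algebra_simps)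
  next
    fix f h assume fh: "f \<in> Cinf M" "h \<in> Cinf M"
    show "lie_bracket X Y p (\<lambda>x. f x * h x) = f p * lie_bracket X Y p h + h p * lie_bracket X Y p f"
      by (simp add: lie_bracket_def mult[OF X fh] mult[OF Y fh] tangent_fun_add[OF t(1)] tangent_fun_add[OF t(2)]
          tangent_mult[OF t(1)] tangent_mult[OF t(2)] Cinf_mult fh s algebra_simps)
  next
    fix f assume "f \<notin> Cinf M"
    then show "lie_bracket X Y p f = 0"
      by (simp add: lie_bracket_def null[OF X] null[OF Y] tangent_fun_const[OF t(1)] tangent_fun_const[OF t(2)])
  qed
qed

text \<open>The easy half of the Frobenius theorem. As the inclusion is an immersion, the smooth functions of
  the ambient manifold contain, near each point of \<open>S\<close>, enough functions dual to a frame of \<open>S\<close>; with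
  them a section of \<open>D\<close> is restricted to a smooth field on \<open>S\<close>, and the bracket can be computed in \<open>S\<close>.\<close>

lemma integral_manifold_bracket:
  fixes M :: "('a, 'e::euclidean_space) mfd" and S :: "('a, 'r::euclidean_space) mfd"
  assumes M: "smooth_manifold M" and int: "integral_manifold M D S" and p: "p \<in> points S"
    and X: "X \<in> sections M D" and Y: "Y \<in> sections M D"
  shows "lie_bracket X Y p \<in> D p"
proof -
  have S: "smooth_manifold S" and imm: "immersion S M id"
    and D: "\<And>q. q \<in> points S \<Longrightarrow> pushfwd M id ` tangent_space S q = D q"
    using int by (auto simp: integral_manifold_def)
  have sm: "smooth_map S M id" using imm by (simp add: immersion_def)
  interpret M: manifold M by unfold_locales (rule M)
  interpret S: manifold S by unfold_locales (rule S)
  have sub: "points S \<subseteq> points M"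
    using sm by (auto simp: smooth_map_def continuous_map_def)
  have CS: "f \<in> Cinf S" if "f \<in> Cinf M" for f using Cinf_pullback[OF S M sm that] by simp
  obtain e :: "'r \<Rightarrow> 'a tvec" and y where e: "\<And>b. b \<in> Basis \<Longrightarrow> e b \<in> tangent_space S p"
    and ey: "\<And>b c. b \<in> Basis \<Longrightarrow> c \<in> Basis \<Longrightarrow> e b (y c) = (if b = c then 1 else 0)"
    by (rule S.local_frame_basis[OF p]) (rule that)
  \<comment> \<open>The components of the differential at \<open>p\<close> of the restriction to \<open>S\<close>. Every value is attained,
    since a vector orthogonal to all values would be killed by the differential of the inclusion.\<close>
  define a where "a = (\<lambda>f. \<Sum>b\<in>Basis. e b f *\<^sub>R b)"
  have "subspace (a ` Cinf M)"
  proof (rule subspaceI)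
    have "a (\<lambda>x. 0) = 0" by (simp add: a_def S.tangent_fun_const[OF e])
    then show "0 \<in> a ` Cinf M" by (metis M.Cinf_const image_eqI)
  next
    fix u v assume "u \<in> a ` Cinf M" "v \<in> a ` Cinf M"
    then obtain f h where fh: "f \<in> Cinf M" "h \<in> Cinf M" "u = a f" "v = a h" by auto
    have "a (\<lambda>x. f x + h x) = u + v"
      by (simp add: a_def fh S.tangent_fun_add[OF e] CS scaleR_add_left sum.distrib)
    with fh show "u + v \<in> a ` Cinf M" by (metis M.Cinf_add image_eqI)
  next
    fix c u assume "u \<in> a ` Cinf M"
    then obtain f where f: "f \<in> Cinf M" "u = a f" by auto
    have "a (\<lambda>x. c * f x) = c *\<^sub>R u"
      using S.tangent_lin[OF e CS[OF f(1)] CS[OF f(1)], of _ c 0] by (simp add: a_def f scaleR_sum_right)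
    with f show "c *\<^sub>R u \<in> a ` Cinf M" by (metis M.Cinf_scale image_eqI)
  qed
  then have span: "span (a ` Cinf M) = a ` Cinf M" by (simp add: span_eq_iff)
  have "a ` Cinf M = UNIV"
  proof (rule ccontr)
    assume "a ` Cinf M \<noteq> UNIV"
    then have "dim (a ` Cinf M) \<noteq> DIM('r)" using span dim_eq_full by metis
    then have "dim (a ` Cinf M) < DIM('r)" using dim_subset_UNIV[of "a ` Cinf M"] by linarith
    then obtain c where c: "c \<noteq> 0" "\<And>z. z \<in> a ` Cinf M \<Longrightarrow> c \<bullet> z = 0"
      by (metis orthogonal_to_subspace_exists orthogonal_def span_base)
    define t where "t = (\<Sum>b\<in>Basis. (c \<bullet> b) \<cdot> e b)"
    have t: "t \<in> tangent_space S p" unfolding t_def by (intro S.tangent_sum S.tangent_scale e)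
    have "t f = 0" if "f \<in> Cinf M" for f
    proof -
      have "t f = c \<bullet> a f" by (simp add: t_def a_def sum_fun_apply inner_sum_right mult.commute)
      with c(2) that show ?thesis by simp
    qed
    then have "pushfwd M id t = pushfwd M id 0" by (auto simp: pushfwd_def fun_eq_iff)
    moreover have "inj_on (pushfwd M id) (tangent_space S p)" using imm p by (simp add: immersion_def)
    ultimately have "t = 0" by (rule inj_onD[OF _ _ t S.tangent_zero, rotated])
    have "c \<bullet> d = 0" if d: "d \<in> Basis" for d
    proof -
      have "t (y d) = (\<Sum>b\<in>Basis. if b = d then c \<bullet> b else 0)"
        unfolding t_def sum_fun_apply by (rule sum.cong) (use d in \<open>auto simp: ey\<close>)
      then show ?thesis using d \<open>t = 0\<close> by simp
    qed
    with c(1) show False by (simp add: euclidean_eq_iff[of c 0])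
  qed
  then have "\<forall>c. \<exists>f. f \<in> Cinf M \<and> a f = c" by (metis UNIV_I imageE)
  then obtain h where h: "\<And>c. h c \<in> Cinf M" "\<And>c. a (h c) = c" by metis
  have eh: "e b (h c) = (if b = c then 1 else 0)" if "b \<in> Basis" "c \<in> Basis" for b c
  proof -
    have "a (h c) \<bullet> b = e b (h c)"
      using that by (simp add: a_def inner_sum_left inner_Basis if_distrib cong: if_cong)
    then have "e b (h c) = (if c = b then 1 else 0)" using that by (simp add: h(2) inner_Basis)
    then show ?thesis by (simp add: eq_commute)
  qed
  have "\<exists>E W. openin (mtop S) W \<and> p \<in> W \<and> (\<forall>i\<in>Basis. E i \<in> vector_fields S) \<and>
      (\<forall>q\<in>W. \<forall>i\<in>Basis. \<forall>j\<in>Basis. E i q (h j) = (if i = j then 1 else 0))"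
    by (rule S.dual_fields[OF finite_Basis p, where u = e]) (simp_all add: CS h e eh)
  then obtain E :: "'r \<Rightarrow> 'a \<Rightarrow> 'a tvec" and W where W: "openin (mtop S) W \<and> p \<in> W \<and> (\<forall>i\<in>Basis. E i \<in> vector_fields S) \<and>
      (\<forall>q\<in>W. \<forall>i\<in>Basis. \<forall>j\<in>Basis. E i q (h j) = (if i = j then 1 else 0))"
    by (elim exE) (rule that)
  then have WS: "W \<subseteq> points S" using openin_subset by blast
  \<comment> \<open>The restriction of a section of \<open>D\<close> to a field on \<open>S\<close>, correct on \<open>W\<close>.\<close>
  define R where "R = (\<lambda>X. \<Sum>b\<in>Basis. fscale (\<lambda>q. X q (h b)) (E b))"
  have R: "R X \<in> vector_fields S" if "X \<in> sections M D" for X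
    unfolding R_def using that W by (intro S.vf_sum S.vf_fscale CS M.vf_smooth) (auto simp: sections_def)
  have Rq: "R X q f = X q f" if X: "X \<in> sections M D" and q: "q \<in> W" and f: "f \<in> Cinf M" for X q f
  proof -
    have qS: "q \<in> points S" using q WS by blast
    then have "X q \<in> pushfwd M id ` tangent_space S q" using X sub D by (auto simp: sections_def)
    then obtain t where t: "t \<in> tangent_space S q" "X q = pushfwd M id t" by blast
    then have Xt: "X q f = t f" if "f \<in> Cinf M" for f using that by (simp add: pushfwd_def)
    have "t = (\<Sum>b\<in>Basis. t (h b) \<cdot> E b q)"
      by (rule S.dual_vectors_span[OF qS _ _ _ t(1)]) (use W q qS CS h S.vf_tangent in auto)
    also have "\<dots> = R X q" by (simp add: R_def sum_fun_apply Xt h)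
    finally show ?thesis using Xt[OF f] by simp
  qed
  have RR: "R X p (\<lambda>q. R Y q f) = X p (\<lambda>q. Y q f)"
    if "X \<in> sections M D" "Y \<in> sections M D" "f \<in> Cinf M" for X Y f
  proof -
    have Yf: "(\<lambda>q. Y q f) \<in> Cinf M" using that(2) by (intro M.vf_smooth) (auto simp: sections_def)
    have "R X p (\<lambda>q. R Y q f) = R X p (\<lambda>q. Y q f)"
      by (rule S.tangent_local[OF S.vf_tangent[OF R[OF that(1)] p], of _ _ W])
        (use W Rq[OF that(2) _ that(3)] CS[OF Yf] S.vf_smooth[OF R[OF that(2)]] in auto)
    also have "\<dots> = X p (\<lambda>q. Y q f)" using W by (intro Rq that Yf) auto
    finally show ?thesis .
  qed
  have t: "lie_bracket (R X) (R Y) p \<in> tangent_space S p"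
    by (rule S.lie_bracket_tangent[OF R[OF X] R[OF Y] p])
  have "lie_bracket X Y p \<in> tangent_space M p"
    using X Y p sub by (intro M.lie_bracket_tangent) (auto simp: sections_def)
  then have "lie_bracket X Y p = pushfwd M id (lie_bracket (R X) (R Y) p)"
    by (auto simp: fun_eq_iff pushfwd_def lie_bracket_def[of "R X"] RR[OF X Y] RR[OF Y X]
        M.tangent_nonsmooth) (simp add: lie_bracket_def)
  then show ?thesis using D[OF p] t by auto
qed

lemma smooth_on_linear_precompose:
  assumes "bounded_linear L" "open S" "L ` S \<subseteq> T" "smooth_on T g"
  shows "smooth_on S (\<lambda>x. g (L x))"
proof -
  have "Ck_on k S (\<lambda>x. g (L x))" if "Ck_on k T g" for k
    using that
  proof (induction k arbitrary: g)
    case 0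
    then show ?case
      using linear_continuous_on[OF assms(1)] assms(3) by (auto intro: continuous_on_compose2)
  next
    case (Suc k)
    have d: "((\<lambda>x. g (L x)) has_derivative (\<lambda>v. frechet_derivative g (at (L x)) (L v))) (at x)" if "x \<in> S" for x
      using Suc.prems that assms(3)
      by (intro has_derivative_compose[OF bounded_linear_imp_has_derivative[OF assms(1)]])
        (auto simp flip: frechet_derivative_works)
    show ?case
      by (rule Ck_on_SucI[OF assms(2) d]) (use Suc.prems in \<open>auto intro: Suc.IH\<close>)
  qed
  then show ?thesis using assms(4) by (simp add: smooth_on_def)
qed

text \<open>An integral manifold comes with a prescribed model space \<open>'r\<close>. Composing the charts with a linear
  isomorphism changes the model space and leaves smooth functions and tangent vectors as they are.\<close>

lemma integral_manifold_full:
  fixes M :: "('a, 'e::euclidean_space) mfd" and L :: "'e \<Rightarrow> 'r::euclidean_space"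
  assumes M: "smooth_manifold M" and L: "linear L" and L': "linear L'"
    and inv: "\<And>x. L' (L x) = x" "\<And>y. L (L' y) = y"
    and D: "\<And>p. p \<in> points M \<Longrightarrow> D p = tangent_space M p"
  shows "integral_manifold M D \<lparr>mtop = mtop M, atlas = (\<lambda>(U, \<kappa>). (U, L \<circ> \<kappa>)) ` atlas M\<rparr>"
    (is "integral_manifold M D ?S")
proof -
  interpret M: manifold M by unfold_locales (rule M)
  have bL: "bounded_linear L" "bounded_linear L'" using L L' by (simp_all add: linear_conv_bounded_linear)
  have img: "L ` A = L' -` A" for A using inv by (auto simp: image_iff) metis
  have openL: "open A \<Longrightarrow> open (L ` A)" for A
    unfolding img using bL(2) by (intro open_vimage linear_continuous_on)
  have invL: "inv_into U (L \<circ> \<kappa>) (L (\<kappa> x)) = x" if "(U, \<kappa>) \<in> atlas M" "x \<in> U" for U \<kappa> x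
  proof -
    have "inj_on (L \<circ> \<kappa>) U"
      using M.chart_inj[OF that(1)] inv(1) by (metis comp_inj_on inj_on_inverseI)
    then show ?thesis using that(2) by (metis comp_apply inv_into_f_f)
  qed
  have rechart: "smooth_on ((L \<circ> \<kappa>) ` A) (f \<circ> inv_into U (L \<circ> \<kappa>)) \<longleftrightarrow> smooth_on (\<kappa> ` A) (f \<circ> inv_into U \<kappa>)"
    if c: "(U, \<kappa>) \<in> atlas M" and A: "openin (mtop M) A" "A \<subseteq> U"
    for U \<kappa> A and f :: "'a \<Rightarrow> 'z::real_normed_vector"
  proof -
    have "U \<inter> A = A" using A by auto
    then have o: "open (\<kappa> ` A)" using M.chart_image_open[OF c A(1)] by simp
    then have o': "open ((L \<circ> \<kappa>) ` A)" using openL[OF o] by (simp add: image_comp)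
    show ?thesis
    proof
      assume *: "smooth_on ((L \<circ> \<kappa>) ` A) (f \<circ> inv_into U (L \<circ> \<kappa>))"
      show "smooth_on (\<kappa> ` A) (f \<circ> inv_into U \<kappa>)"
        by (rule smooth_on_cong[OF o _ smooth_on_linear_precompose[OF bL(1) o _ *]])
          (use A invL[OF c] M.chart_inv[OF c] in auto)
    next
      assume *: "smooth_on (\<kappa> ` A) (f \<circ> inv_into U \<kappa>)"
      show "smooth_on ((L \<circ> \<kappa>) ` A) (f \<circ> inv_into U (L \<circ> \<kappa>))"
        by (rule smooth_on_cong[OF o' _ smooth_on_linear_precompose[OF bL(2) o' _ *]])
          (use A invL[OF c] M.chart_inv[OF c] inv(1) in auto)
    qed
  qed
  have chartS: "\<exists>\<kappa>'. \<kappa> = L \<circ> \<kappa>' \<and> (U, \<kappa>') \<in> atlas M" if "(U, \<kappa>) \<in> atlas ?S" for U \<kappa>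
    using that by auto
  have homeo: "homeomorphic_map (subtopology (mtop M) U) (top_of_set ((L \<circ> \<kappa>) ` U)) (L \<circ> \<kappa>)"
    if c: "(U, \<kappa>) \<in> atlas M" for U \<kappa>
  proof (rule homeomorphic_map_compose[OF M.chart_homeo[OF c]])
    have "homeomorphic_maps (top_of_set (\<kappa> ` U)) (top_of_set ((L \<circ> \<kappa>) ` U)) L L'"
      using linear_continuous_on[OF bL(1)] linear_continuous_on[OF bL(2)] inv
      by (auto simp: homeomorphic_maps_def)
    then show "homeomorphic_map (top_of_set (\<kappa> ` U)) (top_of_set ((L \<circ> \<kappa>) ` U)) L"
      by (rule homeomorphic_maps_imp_map)
  qed
  have S: "smooth_manifold ?S"
    unfolding smooth_manifold_def
  proof (intro conjI)
    show "Hausdorff_space (mtop ?S)" "second_countable (mtop ?S)"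
      using M by (auto simp: smooth_manifold_def)
    have "fst ` atlas ?S = fst ` atlas M" by (force simp: image_iff)
    then show "\<Union> (fst ` atlas ?S) = points ?S" using M by (simp add: smooth_manifold_def)
    show "\<forall>(U, \<kappa>)\<in>atlas ?S. openin (mtop ?S) U \<and> open (\<kappa> ` U) \<and>
        homeomorphic_map (subtopology (mtop ?S) U) (top_of_set (\<kappa> ` U)) \<kappa>"
    proof safe
      fix U \<kappa> assume "(U, \<kappa>) \<in> atlas ?S"
      then obtain \<kappa>' where c: "\<kappa> = L \<circ> \<kappa>'" "(U, \<kappa>') \<in> atlas M" using chartS by blast
      show "openin (mtop ?S) U" using M.chart_openin[OF c(2)] by simp
      show "homeomorphic_map (subtopology (mtop ?S) U) (top_of_set (\<kappa> ` U)) \<kappa>"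
        using homeo[OF c(2)] by (simp add: c(1))
      show "open (\<kappa> ` U)"
        using openL[OF M.chart_image_open[OF c(2) M.chart_openin[OF c(2)]]] by (simp add: c(1) image_comp)
    qed
    show "\<forall>(U, \<kappa>)\<in>atlas ?S. \<forall>(U', \<kappa>')\<in>atlas ?S. smooth_on (\<kappa> ` (U \<inter> U')) (\<kappa>' \<circ> inv_into U \<kappa>)"
    proof safe
      fix U \<kappa> U' \<kappa>' assume "(U, \<kappa>) \<in> atlas ?S" "(U', \<kappa>') \<in> atlas ?S"
      then obtain \<mu> \<mu>' where c: "\<kappa> = L \<circ> \<mu>" "(U, \<mu>) \<in> atlas M" "\<kappa>' = L \<circ> \<mu>'" "(U', \<mu>') \<in> atlas M"
        using chartS by metis
      have UU: "openin (mtop M) (U \<inter> U')" using M.chart_openin c by (blast intro: openin_Int)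
      have "smooth_on (\<mu> ` (U \<inter> U')) (\<lambda>z. L ((\<mu>' \<circ> inv_into U \<mu>) z))"
        using M.chart_image_open[OF c(2) M.chart_openin[OF c(4)]]
        by (intro smooth_on_linear_compose[OF bL(1)] M.chart_transition c)
      then have "smooth_on (\<mu> ` (U \<inter> U')) (L \<circ> \<mu>' \<circ> inv_into U \<mu>)" by (simp add: o_def)
      then show "smooth_on (\<kappa> ` (U \<inter> U')) (\<kappa>' \<circ> inv_into U \<kappa>)"
        using rechart[OF c(2) UU, of "L \<circ> \<mu>'"] by (simp add: c)
    qed
  qed
  have "Cinf ?S = Cinf M"
  proof -
    have "f \<in> Cinf ?S \<longleftrightarrow> f \<in> Cinf M" for f
    proof -
      have "smooth_on ((L \<circ> \<kappa>) ` U) (f \<circ> inv_into U (L \<circ> \<kappa>)) \<longleftrightarrow> smooth_on (\<kappa> ` U) (f \<circ> inv_into U \<kappa>)"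
        if "(U, \<kappa>) \<in> atlas M" for U \<kappa>
        by (rule rechart[OF that M.chart_openin[OF that] order_refl])
      then show ?thesis by (force simp: Cinf_def)
    qed
    then show ?thesis by blast
  qed
  then have T: "tangent_space ?S p = tangent_space M p" for p by (simp add: tangent_space_def)
  have push: "pushfwd M id v = v" if "v \<in> tangent_space M p" for v p
    using M.tangent_nonsmooth[OF that] by (auto simp: pushfwd_def)
  have "smooth_map ?S M id"
    unfolding smooth_map_def
  proof safe
    show "continuous_map (mtop ?S) (mtop M) id" by simp
    fix U \<kappa> V \<psi> assume "(U, \<kappa>) \<in> atlas ?S" and d: "(V, \<psi>) \<in> atlas M"
    then obtain \<mu> where c: "\<kappa> = L \<circ> \<mu>" "(U, \<mu>) \<in> atlas M" using chartS by metis
    have "openin (mtop M) (U \<inter> V)" using M.chart_openin c d by (blast intro: openin_Int)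
    then show "smooth_on (\<kappa> ` (U \<inter> id -` V)) (\<psi> \<circ> id \<circ> inv_into U \<kappa>)"
      using rechart[OF c(2), of "U \<inter> V" \<psi>] M.chart_transition[OF c(2) d] by (simp add: c)
  qed
  moreover have "inj_on (pushfwd M id) (tangent_space ?S p)" for p
    unfolding T by (rule inj_onI) (metis push)
  ultimately have "immersion ?S M id" by (simp add: immersion_def)
  moreover have "pushfwd M id ` tangent_space ?S q = D q" if "q \<in> points ?S" for q
    using D[of q] that push by (force simp: T image_iff)
  ultimately show ?thesis using S by (simp add: integral_manifold_def)
qed

section \<open>Riemannian metrics\<close>

locale riemannian = manifold M for M :: "('a, 'e::euclidean_space) mfd" +
  fixes g :: "'a metric_tensor"
  assumes metric: "riemannian_metric M g"
begin

lemma metric_sym: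
  "p \<in> points M \<Longrightarrow> u \<in> tangent_space M p \<Longrightarrow> v \<in> tangent_space M p \<Longrightarrow> g p u v = g p v u"
  using metric unfolding riemannian_metric_def by blast

lemma metric_pos:
  "p \<in> points M \<Longrightarrow> u \<in> tangent_space M p \<Longrightarrow> u \<noteq> 0 \<Longrightarrow> g p u u > 0"
  using metric unfolding riemannian_metric_def by blast

lemma metric_lincomb_left:
  "p \<in> points M \<Longrightarrow> u \<in> tangent_space M p \<Longrightarrow> v \<in> tangent_space M p \<Longrightarrow> w \<in> tangent_space M p \<Longrightarrow>
    g p (a \<cdot> u + b \<cdot> v) w = a * g p u w + b * g p v w"
  using metric unfolding riemannian_metric_def by blast

lemma metric_lincomb_right:
  "p \<in> points M \<Longrightarrow> u \<in> tangent_space M p \<Longrightarrow> v \<in> tangent_space M p \<Longrightarrow> w \<in> tangent_space M p \<Longrightarrow>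
    g p w (a \<cdot> u + b \<cdot> v) = a * g p w u + b * g p w v"
  by (simp add: metric_sym[of p w] metric_lincomb_left tangent_lincomb)

lemma metric_smooth: "X \<in> vector_fields M \<Longrightarrow> Y \<in> vector_fields M \<Longrightarrow> (\<lambda>p. g p (X p) (Y p)) \<in> Cinf M"
  using metric unfolding riemannian_metric_def by simp

context
  fixes p assumes p: "p \<in> points M"
begin

lemma metric_zero: "w \<in> tangent_space M p \<Longrightarrow> g p 0 w = 0" "w \<in> tangent_space M p \<Longrightarrow> g p w 0 = 0"
  using metric_lincomb_left[OF p tangent_zero tangent_zero, of w 0 0]
    metric_lincomb_right[OF p tangent_zero tangent_zero, of w 0 0] by auto

lemma metric_diff:
  assumes "u \<in> tangent_space M p" "v \<in> tangent_space M p" "w \<in> tangent_space M p"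
  shows "g p (u - v) w = g p u w - g p v w" "g p w (u - v) = g p w u - g p w v"
  unfolding minus_eq_tscale
  using metric_lincomb_left[OF p assms, of 1 "-1"] metric_lincomb_right[OF p assms, of 1 "-1"]
  by simp_all

lemma metric_uminus:
  assumes "v \<in> tangent_space M p" "w \<in> tangent_space M p"
  shows "g p (- v) w = - g p v w" "g p w (- v) = - g p w v"
  using metric_diff[OF tangent_zero assms] metric_zero[OF assms(2)] by simp_all

lemma functional_sum:
  fixes l :: "'a tvec \<Rightarrow> real"
  assumes "\<And>u v a b. u \<in> tangent_space M p \<Longrightarrow> v \<in> tangent_space M p \<Longrightarrow> l (a \<cdot> u + b \<cdot> v) = a * l u + b * l v"
    and "\<And>i. i \<in> I \<Longrightarrow> e i \<in> tangent_space M p"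
  shows "l (\<Sum>i\<in>I. c i \<cdot> e i) = (\<Sum>i\<in>I. c i * l (e i))"
  using assms(2)
proof (induction I rule: infinite_finite_induct)
  case (insert i I)
  have "l (c i \<cdot> e i + 1 \<cdot> (\<Sum>i\<in>I. c i \<cdot> e i)) = c i * l (e i) + 1 * l (\<Sum>i\<in>I. c i \<cdot> e i)"
    using insert.prems by (intro assms(1) tangent_sum tangent_scale) auto
  moreover have "l (\<Sum>i\<in>I. c i \<cdot> e i) = (\<Sum>i\<in>I. c i * l (e i))"
    using insert.prems by (intro insert.IH) auto
  ultimately show ?case
    by (simp only: sum.insert[OF insert.hyps] tscale_one mult_1)
qed (use assms(1)[OF tangent_zero tangent_zero, of 0 0] in simp_all)

lemma metric_sum_left:
  assumes "\<And>i. i \<in> I \<Longrightarrow> e i \<in> tangent_space M p" "w \<in> tangent_space M p"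
  shows "g p (\<Sum>i\<in>I. c i \<cdot> e i) w = (\<Sum>i\<in>I. c i * g p (e i) w)"
  by (rule functional_sum[of "\<lambda>u. g p u w"]) (auto simp: metric_lincomb_left[OF p] assms)

lemma metric_sum_right:
  assumes "\<And>i. i \<in> I \<Longrightarrow> e i \<in> tangent_space M p" "w \<in> tangent_space M p"
  shows "g p w (\<Sum>i\<in>I. c i \<cdot> e i) = (\<Sum>i\<in>I. c i * g p w (e i))"
  by (rule functional_sum[of "g p w"]) (auto simp: metric_lincomb_right[OF p] assms)

text \<open>In a basis, pairing with the metric is a linear map of the model space to itself; it is injective
  by definiteness and hence surjective.\<close>

lemma riesz_representation:
  fixes l :: "'a tvec \<Rightarrow> real"
  assumes l: "\<And>u v a b. u \<in> tangent_space M p \<Longrightarrow> v \<in> tangent_space M p \<Longrightarrow> l (a \<cdot> u + b \<cdot> v) = a * l u + b * l v"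
  obtains r where "r \<in> tangent_space M p" "\<And>w. w \<in> tangent_space M p \<Longrightarrow> g p r w = l w"
proof -
  obtain e :: "'e \<Rightarrow> 'a tvec" and y where e: "\<And>b. b \<in> Basis \<Longrightarrow> e b \<in> tangent_space M p"
    and ey: "\<And>b c. b \<in> Basis \<Longrightarrow> c \<in> Basis \<Longrightarrow> e b (y c) = (if b = c then 1 else 0)"
    and span: "\<And>v. v \<in> tangent_space M p \<Longrightarrow> v = (\<Sum>b\<in>Basis. v (y b) \<cdot> e b)"
    by (rule local_frame_basis[OF p]) (rule that)
  define c where "c = (\<lambda>x::'e. \<Sum>b\<in>Basis. (x \<bullet> b) \<cdot> e b)"
  have c: "c x \<in> tangent_space M p" for x unfolding c_def by (intro tangent_sum tangent_scale e)
  have cy: "c x (y b) = x \<bullet> b" if "b \<in> Basis" for x b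
  proof -
    have "c x (y b) = (\<Sum>d\<in>Basis. if d = b then x \<bullet> d else 0)"
      unfolding c_def sum_fun_apply by (rule sum.cong) (use that in \<open>auto simp: ey\<close>)
    then show ?thesis using that by simp
  qed
  define G where "G = (\<lambda>x::'e. \<Sum>k\<in>Basis. g p (c x) (e k) *\<^sub>R k)"
  have Gk: "G x \<bullet> k = g p (c x) (e k)" if "k \<in> Basis" for x k
    using that by (simp add: G_def inner_sum_left inner_Basis if_distrib cong: if_cong)
  have ge: "g p (c x) (e k) = (\<Sum>b\<in>Basis. (x \<bullet> b) * g p (e b) (e k))" if "k \<in> Basis" for x k
    unfolding c_def by (rule metric_sum_left) (use e that in auto)
  have lin: "linear G"
  proof (rule linearI)
    show "G (x + z) = G x + G z" for x z
      by (rule euclidean_eqI) (simp add: Gk ge inner_add_left algebra_simps sum.distrib)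
    show "G (r *\<^sub>R x) = r *\<^sub>R G x" for r x
      by (rule euclidean_eqI) (simp add: Gk ge sum_distrib_left algebra_simps)
  qed
  moreover have "inj G"
  proof (subst linear_injective_0[OF lin], safe)
    fix x assume "G x = 0"
    then have "g p (c x) (e k) = 0" if "k \<in> Basis" for k using Gk[OF that, of x] by simp
    moreover have "g p (c x) (c x) = (\<Sum>b\<in>Basis. (x \<bullet> b) * g p (c x) (e b))"
      by (subst (2) c_def) (rule metric_sum_right[OF e c])
    ultimately have "g p (c x) (c x) = 0" by simp
    then have "c x = 0" using metric_pos[OF p c] by force
    then have "x \<bullet> b = 0" if "b \<in> Basis" for b using cy[OF that, of x] by simp
    then show "x = 0" by (simp add: euclidean_eq_iff[of x 0])
  qed
  ultimately have "surj G" by (rule linear_inj_imp_surj)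
  then obtain x where x: "G x = (\<Sum>k\<in>Basis. l (e k) *\<^sub>R k)" by (metis surjD)
  have gl: "g p (c x) (e k) = l (e k)" if "k \<in> Basis" for k
    using Gk[OF that, of x] that unfolding x by (simp add: inner_sum_left inner_Basis if_distrib cong: if_cong)
  have "g p (c x) w = l w" if w: "w \<in> tangent_space M p" for w
  proof -
    have "g p (c x) (\<Sum>b\<in>Basis. w (y b) \<cdot> e b) = (\<Sum>b\<in>Basis. w (y b) * g p (c x) (e b))"
      by (rule metric_sum_right[OF e c])
    also have "\<dots> = (\<Sum>b\<in>Basis. w (y b) * l (e b))" by (rule sum.cong) (simp_all add: gl)
    also have "\<dots> = l (\<Sum>b\<in>Basis. w (y b) \<cdot> e b)" by (rule functional_sum[OF l e, symmetric])
    finally show ?thesis by (simp only: span[OF w, symmetric])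
  qed
  then show ?thesis using that c by blast
qed

lemma metric_nondegenerate:
  assumes "u \<in> tangent_space M p" "v \<in> tangent_space M p" "\<And>w. w \<in> tangent_space M p \<Longrightarrow> g p u w = g p v w"
  shows "u = v"
proof -
  have "g p (u - v) (u - v) = 0"
    using assms(3)[of "u - v"] by (simp add: metric_diff(1) assms tangent_diff)
  then show ?thesis using metric_pos[OF p tangent_diff[OF assms(1,2)]] by force
qed

lemma grad_tangent: "grad M g f p \<in> tangent_space M p"
proof -
  obtain r where r: "r \<in> tangent_space M p" "\<And>w. w \<in> tangent_space M p \<Longrightarrow> g p r w = w f"
    by (rule riesz_representation[of "\<lambda>w. w f"]) auto
  have "\<exists>!v. v \<in> tangent_space M p \<and> (\<forall>w\<in>tangent_space M p. g p v w = w f)"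
    by (rule ex1I[of _ r]) (use r metric_nondegenerate in auto)
  from theI'[OF this] show ?thesis by (simp add: grad_def)
qed

end

end

section \<open>Horizontally conformal submersions\<close>

locale conformal_submersion = M: riemannian M gM + N: riemannian N gN
  for M :: "('a, 'm::euclidean_space) mfd" and gM and N :: "('b, 'n::euclidean_space) mfd" and gN +
  fixes F :: "'a \<Rightarrow> 'b" and dil :: "'a \<Rightarrow> real"
  assumes conformal: "horizontally_conformal_submersion M gM N gN F dil"
begin

abbreviation "vert \<equiv> ver M N F"
abbreviation "horz \<equiv> hor M gM N F"

lemma smooth_F: "smooth_map M N F"
  using conformal by (simp add: horizontally_conformal_submersion_def submersion_def)

lemma F_points: "p \<in> points M \<Longrightarrow> F p \<in> points N"
  using smooth_F by (auto simp: smooth_map_def continuous_map_def)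

lemma pullback: "h \<in> Cinf N \<Longrightarrow> (\<lambda>x. h (F x)) \<in> Cinf M"
  using Cinf_pullback[OF M.manifold N.manifold smooth_F] by (simp add: o_def)

lemma push_tangent: "v \<in> tangent_space M p \<Longrightarrow> pushfwd N F v \<in> tangent_space N (F p)"
  by (rule pushfwd_tangent[OF M.manifold N.manifold smooth_F])

lemma push_surj:
  assumes "p \<in> points M" "w \<in> tangent_space N (F p)"
  shows "\<exists>v\<in>tangent_space M p. pushfwd N F v = w"
proof -
  have "pushfwd N F ` tangent_space M p = tangent_space N (F p)"
    using conformal assms(1) by (simp add: horizontally_conformal_submersion_def submersion_def)
  then have "w \<in> pushfwd N F ` tangent_space M p" using assms(2) by simp
  then show ?thesis by blast
qed

lemma dil_pos: "p \<in> points M \<Longrightarrow> dil p > 0"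
  using conformal by (simp add: horizontally_conformal_submersion_def)

lemma ver_tangent: "v \<in> vert p \<Longrightarrow> v \<in> tangent_space M p"
  by (simp add: ver_def)

lemma hor_tangent: "v \<in> horz p \<Longrightarrow> v \<in> tangent_space M p"
  by (simp add: hor_def)

lemma ver_push: "v \<in> vert p \<Longrightarrow> pushfwd N F v = 0"
  by (simp add: ver_def)

lemma hor_ver_orthogonal: "u \<in> horz p \<Longrightarrow> v \<in> vert p \<Longrightarrow> gM p u v = 0"
  by (simp add: hor_def)

lemma ver_lincomb: "u \<in> vert p \<Longrightarrow> v \<in> vert p \<Longrightarrow> a \<cdot> u + b \<cdot> v \<in> vert p"
  by (simp add: ver_def pushfwd_lincomb M.tangent_lincomb)

lemma hor_lincomb: "p \<in> points M \<Longrightarrow> u \<in> horz p \<Longrightarrow> v \<in> horz p \<Longrightarrow> a \<cdot> u + b \<cdot> v \<in> horz p"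
  by (auto simp: hor_def M.metric_lincomb_left M.tangent_lincomb ver_tangent)

lemma ver_zero: "0 \<in> vert p"
  by (simp add: ver_def M.tangent_zero)

lemma hor_zero: "p \<in> points M \<Longrightarrow> 0 \<in> horz p"
  by (auto simp: hor_def M.tangent_zero M.metric_zero ver_tangent)

lemma ver_diff: "u \<in> vert p \<Longrightarrow> v \<in> vert p \<Longrightarrow> u - v \<in> vert p"
  unfolding M.minus_eq_tscale by (rule ver_lincomb)

lemma hor_diff: "p \<in> points M \<Longrightarrow> u \<in> horz p \<Longrightarrow> v \<in> horz p \<Longrightarrow> u - v \<in> horz p"
  unfolding M.minus_eq_tscale by (rule hor_lincomb)

lemma ver_hor_zero:
  assumes "p \<in> points M" "v \<in> vert p" "v \<in> horz p"
  shows "v = 0"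
  using hor_ver_orthogonal[OF assms(3,2)] M.metric_pos[OF assms(1) ver_tangent[OF assms(2)]] by force

text \<open>The Riesz representatives of the differentials of functions \<open>y \<circ> F\<close> are horizontal. They have
  enough freedom to match the image of any tangent vector because their Gram matrix is definite.\<close>

lemma hor_decomposition:
  assumes p: "p \<in> points M" and u: "u \<in> tangent_space M p"
  obtains h where "h \<in> horz p" "u - h \<in> vert p"
proof -
  obtain e :: "'n \<Rightarrow> 'b tvec" and y where e: "\<And>b. b \<in> Basis \<Longrightarrow> e b \<in> tangent_space N (F p)"
    and y: "\<And>b. b \<in> Basis \<Longrightarrow> y b \<in> Cinf N"
    and ey: "\<And>b c. b \<in> Basis \<Longrightarrow> c \<in> Basis \<Longrightarrow> e b (y c) = (if b = c then 1 else 0)"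
    and span: "\<And>v. v \<in> tangent_space N (F p) \<Longrightarrow> v = (\<Sum>b\<in>Basis. v (y b) \<cdot> e b)"
    by (rule N.local_frame_basis[OF F_points[OF p]]) (rule that)
  define f where "f = (\<lambda>b x. y b (F x))"
  have push_f: "pushfwd N F v (y b) = v (f b)" if "b \<in> Basis" for v b
    using pushfwd_apply[OF y[OF that]] by (simp add: f_def)
  have "\<exists>r. r \<in> tangent_space M p \<and> (\<forall>w\<in>tangent_space M p. gM p r w = w (f b))" for b
    by (rule M.riesz_representation[OF p, of "\<lambda>w. w (f b)"]) auto
  then obtain r where r: "\<And>b. r b \<in> tangent_space M p"
    and rf: "\<And>b w. w \<in> tangent_space M p \<Longrightarrow> gM p (r b) w = w (f b)"
    by metis
  define c where "c = (\<lambda>x::'n. \<Sum>b\<in>Basis. (x \<bullet> b) \<cdot> r b)"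
  have c: "c x \<in> tangent_space M p" for x unfolding c_def by (intro M.tangent_sum M.tangent_scale r)
  have gc: "gM p (c x) w = (\<Sum>b\<in>Basis. (x \<bullet> b) * w (f b))" if "w \<in> tangent_space M p" for x w
    unfolding c_def by (subst M.metric_sum_left[OF p r that]) (simp add: rf[OF that])
  have c_hor: "c x \<in> horz p" for x
  proof -
    have "gM p (c x) w = 0" if "w \<in> vert p" for w
      unfolding gc[OF ver_tangent[OF that]]
      by (rule sum.neutral) (use push_f[of _ w] ver_push[OF that] in auto)
    then show ?thesis using c by (simp add: hor_def)
  qed
  define K where "K = (\<lambda>x::'n. \<Sum>k\<in>Basis. c x (f k) *\<^sub>R k)"
  have Kk: "K x \<bullet> k = c x (f k)" if "k \<in> Basis" for x k
    using that by (simp add: K_def inner_sum_left inner_Basis if_distrib cong: if_cong)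
  have cf: "c x (f k) = (\<Sum>b\<in>Basis. (x \<bullet> b) * r b (f k))" for x k
    by (simp add: c_def sum_fun_apply)
  have lin: "linear K"
  proof (rule linearI)
    show "K (x + z) = K x + K z" for x z
      by (rule euclidean_eqI) (simp add: Kk cf inner_add_left algebra_simps sum.distrib)
    show "K (s *\<^sub>R x) = s *\<^sub>R K x" for s x
      by (rule euclidean_eqI) (simp add: Kk cf sum_distrib_left algebra_simps)
  qed
  moreover have "inj K"
  proof (subst linear_injective_0[OF lin], safe)
    fix x assume "K x = 0"
    then have "c x (f k) = 0" if "k \<in> Basis" for k using Kk[OF that, of x] by simp
    then have "gM p (c x) (c x) = 0" by (simp add: gc[OF c])
    then have c0: "c x = 0" using M.metric_pos[OF p c] by force
    have "x \<bullet> k = 0" if k: "k \<in> Basis" for k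
    proof -
      obtain w where w: "w \<in> tangent_space M p" "pushfwd N F w = e k"
        using push_surj[OF p e[OF k]] by blast
      have "w (f b) = (if b = k then 1 else 0)" if "b \<in> Basis" for b
        using push_f[OF that, of w] ey[OF k that] w(2) by auto
      then have "gM p (c x) w = (\<Sum>b\<in>Basis. if b = k then x \<bullet> b else 0)"
        unfolding gc[OF w(1)] by (intro sum.cong) auto
      then show ?thesis using k c0 M.metric_zero[OF p w(1)] by simp
    qed
    then show "x = 0" by (simp add: euclidean_eq_iff[of x 0])
  qed
  ultimately have "surj K" by (rule linear_inj_imp_surj)
  then obtain x where x: "K x = (\<Sum>k\<in>Basis. u (f k) *\<^sub>R k)" by (metis surjD)
  have cu: "c x (f k) = u (f k)" if "k \<in> Basis" for k
    using Kk[OF that, of x] that unfolding x by (simp add: inner_sum_left inner_Basis if_distrib cong: if_cong)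
  have uc: "u - c x \<in> tangent_space M p" by (rule M.tangent_diff[OF u c])
  have "pushfwd N F (u - c x) (y b) = 0" if "b \<in> Basis" for b
    using cu[OF that] by (simp add: push_f[OF that])
  then have "(\<Sum>b\<in>Basis. pushfwd N F (u - c x) (y b) \<cdot> e b) = 0" by simp
  then have "pushfwd N F (u - c x) = 0" by (simp only: span[OF push_tangent[OF uc], symmetric])
  then have "u - c x \<in> vert p" using uc by (simp add: ver_def)
  then show ?thesis using that c_hor by blast
qed

lemma vproj_eqI:
  assumes p: "p \<in> points M" and w: "w \<in> vert p" "u - w \<in> horz p"
  shows "vproj M gM N F p u = w"
  unfolding vproj_def
proof (rule the_equality)
  fix z assume z: "z \<in> vert p \<and> u - z \<in> horz p"
  have "(u - w) - (u - z) = z - w" by simp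
  then have "z - w \<in> horz p" using hor_diff[OF p w(2), of "u - z"] z by simp
  then have "z - w = 0" using ver_hor_zero[OF p ver_diff] z w by blast
  then show "z = w" by simp
qed (use w in blast)

lemma vproj_ver: "p \<in> points M \<Longrightarrow> u \<in> vert p \<Longrightarrow> vproj M gM N F p u = u"
  by (rule vproj_eqI) (auto simp: hor_zero)

lemma vproj_hor: "p \<in> points M \<Longrightarrow> u \<in> horz p \<Longrightarrow> vproj M gM N F p u = 0"
  by (rule vproj_eqI) (auto simp: ver_zero)

lemma hproj_props:
  assumes p: "p \<in> points M" and u: "u \<in> tangent_space M p"
  shows "hproj M gM N F p u \<in> horz p" "u - hproj M gM N F p u \<in> vert p"
proof -
  obtain h where h: "h \<in> horz p" "u - h \<in> vert p" by (rule hor_decomposition[OF p u])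
  then have "vproj M gM N F p u = u - h" by (intro vproj_eqI[OF p]) auto
  then show "hproj M gM N F p u \<in> horz p" "u - hproj M gM N F p u \<in> vert p"
    using h by (simp_all add: hproj_def)
qed

text \<open>One horizontal argument is enough, since the vertical part of the other one drops out on both
  sides.\<close>

lemma conformal_left:
  assumes p: "p \<in> points M" and u: "u \<in> tangent_space M p" and w: "w \<in> horz p"
  shows "(dil p)\<^sup>2 * gM p u w = gN (F p) (pushfwd N F u) (pushfwd N F w)"
proof -
  obtain h where h: "h \<in> horz p" "u - h \<in> vert p" by (rule hor_decomposition[OF p u])
  have "gM p (u - h) w = 0"
    using hor_ver_orthogonal[OF w h(2)] M.metric_sym[OF p ver_tangent[OF h(2)] hor_tangent[OF w]] by simp
  then have "gM p u w = gM p h w"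
    by (simp add: M.metric_diff(1)[OF p u hor_tangent[OF h(1)] hor_tangent[OF w]])
  moreover have "pushfwd N F u = pushfwd N F h"
    using ver_push[OF h(2)] by (simp add: pushfwd_diff)
  moreover have "(dil p)\<^sup>2 * gM p h w = gN (F p) (pushfwd N F h) (pushfwd N F w)"
    using conformal p h(1) w by (simp add: horizontally_conformal_submersion_def)
  ultimately show ?thesis by simp
qed

text \<open>Lifts of a frame of \<open>N\<close>, corrected to be dual to the functions \<open>y b \<circ> F\<close>, serve to remove the
  non-vertical components of an extension of \<open>v\<close>. A cut-off then gives the zero vector where the frame
  is not available.\<close>

lemma vertical_field_exists:
  assumes p: "p \<in> points M" and v: "v \<in> vert p"
  obtains V where "V \<in> sections M vert" "V p = v"
proof -
  obtain WN y Z where fr: "local_frame N WN y Z" and FW: "F p \<in> WN"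
    by (rule N.local_frame_exists[OF F_points[OF p]]) (rule that)
  have y: "y b \<in> Cinf N" and Z: "Z b \<in> vector_fields N" if "b \<in> Basis" for b
    using fr that by (auto simp: local_frame_def)
  define f where "f = (\<lambda>b x. y b (F x))"
  have f: "f b \<in> Cinf M" if "b \<in> Basis" for b unfolding f_def by (rule pullback[OF y[OF that]])
  have push_f: "pushfwd N F u (y b) = u (f b)" if "b \<in> Basis" for u b
    using pushfwd_apply[OF y[OF that]] by (simp add: f_def)
  have "\<forall>b\<in>Basis. \<exists>u. u \<in> tangent_space M p \<and> pushfwd N F u = Z b (F p)"
    using push_surj[OF p N.vf_tangent[OF Z F_points[OF p]]] by blast
  then obtain u where u: "\<And>b. b \<in> Basis \<Longrightarrow> u b \<in> tangent_space M p \<and> pushfwd N F (u b) = Z b (F p)"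
    by metis
  have uf: "u b (f c) = (if b = c then 1 else 0)" if "b \<in> Basis" "c \<in> Basis" for b c
    using push_f[OF that(2), of "u b"] u[OF that(1)] fr FW that by (simp add: local_frame_def)
  have "\<exists>E W. openin (mtop M) W \<and> p \<in> W \<and> (\<forall>i\<in>Basis. E i \<in> vector_fields M) \<and>
      (\<forall>q\<in>W. \<forall>i\<in>Basis. \<forall>j\<in>Basis. E i q (f j) = (if i = j then 1 else 0))"
    by (rule M.dual_fields[OF finite_Basis p, where u = u]) (use f u uf in auto)
  then obtain E :: "'n \<Rightarrow> 'a \<Rightarrow> 'a tvec" and W where W: "openin (mtop M) W \<and> p \<in> W \<and> (\<forall>i\<in>Basis. E i \<in> vector_fields M) \<and>
      (\<forall>q\<in>W. \<forall>i\<in>Basis. \<forall>j\<in>Basis. E i q (f j) = (if i = j then 1 else 0))"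
    by (elim exE) (rule that)
  obtain X where X: "X \<in> vector_fields M" "X p = v"
    by (rule M.tangent_vector_extends[OF p ver_tangent[OF v]])
  have E: "E i \<in> vector_fields M" if "i \<in> Basis" for i using W that by blast
  obtain Y where Y: "Y \<in> vector_fields M" and Yq: "\<And>q h. Y q h = X q h - (\<Sum>i\<in>Basis. X q (f i) * E i q h)"
    and YE: "\<And>q j. \<forall>i\<in>Basis. E i q (f j) = (if i = j then 1 else 0) \<Longrightarrow> j \<in> Basis \<Longrightarrow> Y q (f j) = 0"
    by (rule M.eliminate_components[where f = f, OF finite_Basis X(1) E]) (assumption, rule that)
  define W' where "W' = W \<inter> {q \<in> points M. F q \<in> WN}"
  have W': "openin (mtop M) W'" "p \<in> W'"
    unfolding W'_def using W fr FW p smooth_F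
    by (auto simp: smooth_map_def local_frame_def intro!: openin_Int openin_continuous_map_preimage)
  obtain \<theta> W\<^sub>0 K where \<theta>: "\<theta> \<in> Cinf M" "p \<in> W\<^sub>0" "K \<subseteq> W'" "\<And>x. x \<in> W\<^sub>0 \<Longrightarrow> \<theta> x = 1"
    "\<And>x. x \<notin> K \<Longrightarrow> \<theta> x = 0"
    by (rule M.cutoff[OF W']) (rule that)
  have Yv: "Y q \<in> vert q" if q: "q \<in> W'" for q
  proof -
    have qM: "q \<in> points M" using q by (simp add: W'_def)
    have t: "pushfwd N F (Y q) \<in> tangent_space N (F q)"
      by (rule push_tangent[OF M.vf_tangent[OF Y qM]])
    have "Y q (f j) = 0" if "j \<in> Basis" for j
      by (rule YE[OF _ that]) (use W q that in \<open>auto simp: W'_def\<close>)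
    then have "(\<Sum>b\<in>Basis. pushfwd N F (Y q) (y b) \<cdot> Z b (F q)) = 0" by (simp add: push_f)
    moreover have "pushfwd N F (Y q) = (\<Sum>b\<in>Basis. pushfwd N F (Y q) (y b) \<cdot> Z b (F q))"
      using fr q t unfolding local_frame_def W'_def by blast
    ultimately have "pushfwd N F (Y q) = 0" by simp
    then show ?thesis using M.vf_tangent[OF Y qM] by (simp add: ver_def)
  qed
  have "fscale \<theta> Y \<in> sections M vert"
    unfolding sections_def
  proof (intro CollectI conjI ballI)
    fix q assume "q \<in> points M"
    show "fscale \<theta> Y q \<in> vert q"
    proof (cases "q \<in> K")
      case True
      then have "\<theta> q \<cdot> Y q + 0 \<cdot> Y q \<in> vert q" using \<theta>(3) Yv by (intro ver_lincomb) auto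
      then show ?thesis by simp
    qed (simp add: \<theta>(5) ver_zero)
  qed (rule M.vf_fscale[OF \<theta>(1) Y])
  moreover have "fscale \<theta> Y p = v"
  proof -
    have "v (f i) = 0" if "i \<in> Basis" for i
      using push_f[OF that, of v] ver_push[OF v] by simp
    then have "Y p = v" using X(2) by (auto simp: fun_eq_iff Yq)
    then show ?thesis using \<theta> by simp
  qed
  ultimately show ?thesis using that by blast
qed

text \<open>The Lie derivative of the metric along a vertical field \<open>V\<close> is proportional to the metric on
  horizontal fields. For orthogonal \<open>X\<close> and \<open>Y\<close> the factor disappears. In a frame of \<open>N\<close> the pulled
  back coefficients \<open>gN (Z i) (Z j) \<circ> F\<close> are constant along \<open>V\<close>, and \<open>V\<close> acts on the components of
  \<open>X\<close> through the bracket alone because it kills the functions \<open>y i \<circ> F\<close>.\<close>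

lemma conformal_lie_bracket:
  assumes V: "V \<in> sections M vert" and X: "X \<in> sections M horz" and Y: "Y \<in> sections M horz"
    and orth: "\<And>q. q \<in> points M \<Longrightarrow> gM q (X q) (Y q) = 0" and p: "p \<in> points M"
  shows "gM p (lie_bracket V X p) (Y p) + gM p (X p) (lie_bracket V Y p) = 0"
proof -
  have vf: "V \<in> vector_fields M" "X \<in> vector_fields M" "Y \<in> vector_fields M"
    using V X Y by (auto simp: sections_def)
  obtain WN y Z where fr: "local_frame N WN y Z" and FW: "F p \<in> WN"
    by (rule N.local_frame_exists[OF F_points[OF p]]) (rule that)
  have y: "y b \<in> Cinf N" and Z: "Z b \<in> vector_fields N" if "b \<in> Basis" for b
    using fr that by (auto simp: local_frame_def)
  define f where "f = (\<lambda>b x. y b (F x))"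
  have push_f: "pushfwd N F u (y b) = u (f b)" if "b \<in> Basis" for u b
    using pushfwd_apply[OF y[OF that]] by (simp add: f_def)
  define k where "k = (\<lambda>i j q. gN (F q) (Z i (F q)) (Z j (F q)))"
  have k: "k i j \<in> Cinf M" and Vk: "V p (k i j) = 0" if "i \<in> Basis" "j \<in> Basis" for i j
  proof -
    have "(\<lambda>q. gN q (Z i q) (Z j q)) \<in> Cinf N" by (rule N.metric_smooth[OF Z Z]) (use that in auto)
    note pullback[OF this] pushfwd_apply[OF this, of F "V p"]
    then show "k i j \<in> Cinf M" "V p (k i j) = 0"
      using V p ver_push[of "V p" p] by (auto simp: k_def sections_def)
  qed
  have push_expand: "gN (F q) (pushfwd N F u) (pushfwd N F w) = (\<Sum>i\<in>Basis. \<Sum>j\<in>Basis. u (f i) * w (f j) * k i j q)"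
    if q: "q \<in> points M" "F q \<in> WN" and u: "u \<in> tangent_space M q" and w: "w \<in> tangent_space M q" for q u w
  proof -
    have Zt: "Z b (F q) \<in> tangent_space N (F q)" if "b \<in> Basis" for b
      by (rule N.vf_tangent[OF Z[OF that] F_points[OF q(1)]])
    have ex: "pushfwd N F u = (\<Sum>b\<in>Basis. u (f b) \<cdot> Z b (F q))" if u: "u \<in> tangent_space M q" for u
    proof -
      have "pushfwd N F u = (\<Sum>b\<in>Basis. pushfwd N F u (y b) \<cdot> Z b (F q))"
        using fr q(2) push_tangent[OF u] unfolding local_frame_def by blast
      then show ?thesis by (simp add: push_f)
    qed
    have Zs: "(\<Sum>b\<in>Basis. w (f b) \<cdot> Z b (F q)) \<in> tangent_space N (F q)"
      by (intro N.tangent_sum N.tangent_scale Zt)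
    show ?thesis
      unfolding ex[OF u] ex[OF w]
      by (simp add: N.metric_sum_left[OF F_points[OF q(1)] Zt Zs] N.metric_sum_right[OF F_points[OF q(1)] Zt Zt]
          k_def sum_distrib_left mult.assoc)
  qed
  have Vf: "(\<lambda>q. V q (f b)) = (\<lambda>q. 0)" if "b \<in> Basis" for b
  proof
    fix q show "V q (f b) = 0"
    proof (cases "q \<in> points M")
      case True
      then have "pushfwd N F (V q) = 0" using V ver_push by (auto simp: sections_def)
      then show ?thesis using push_f[OF that, of "V q"] by simp
    qed (simp add: M.vf_outside[OF vf(1)])
  qed
  have br: "V p (\<lambda>q. X q (f b)) = lie_bracket V X p (f b)" if "X \<in> vector_fields M" "b \<in> Basis" for X b
    using M.tangent_fun_const[OF M.vf_tangent[OF that(1) p], of 0] by (simp add: lie_bracket_def Vf[OF that(2)])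
  have Vp: "V p \<in> tangent_space M p" by (rule M.vf_tangent[OF vf(1) p])
  have sm: "(\<lambda>q. X q (f i)) \<in> Cinf M" "(\<lambda>q. Y q (f i)) \<in> Cinf M" for i
    by (intro M.vf_smooth vf)+
  let ?term = "\<lambda>i j q. X q (f i) * Y q (f j) * k i j q"
  have term_smooth: "?term i j \<in> Cinf M" if "i \<in> Basis" "j \<in> Basis" for i j
    using that by (intro M.Cinf_mult sm k)
  have "V p (\<lambda>q. \<Sum>i\<in>Basis. \<Sum>j\<in>Basis. ?term i j q) = V p (\<lambda>q. 0)"
  proof (rule M.tangent_local[OF Vp, where W = "{q \<in> points M. F q \<in> WN}"])
    show "openin (mtop M) {q \<in> points M. F q \<in> WN}"
      using fr smooth_F by (auto simp: smooth_map_def local_frame_def intro!: openin_continuous_map_preimage)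
    fix q assume q: "q \<in> {q \<in> points M. F q \<in> WN}"
    then have "(\<Sum>i\<in>Basis. \<Sum>j\<in>Basis. ?term i j q) = gN (F q) (pushfwd N F (X q)) (pushfwd N F (Y q))"
      using vf by (intro push_expand[symmetric] M.vf_tangent) auto
    also have "\<dots> = (dil q)\<^sup>2 * gM q (X q) (Y q)"
      using q vf Y by (intro conformal_left[symmetric] M.vf_tangent) (auto simp: sections_def)
    also have "\<dots> = 0" using orth q by simp
    finally show "(\<Sum>i\<in>Basis. \<Sum>j\<in>Basis. ?term i j q) = 0" .
  qed (use p FW term_smooth in \<open>auto intro!: M.Cinf_sum M.Cinf_const\<close>)
  then have "0 = V p (\<lambda>q. \<Sum>i\<in>Basis. \<Sum>j\<in>Basis. ?term i j q)"
    by (simp add: M.tangent_fun_const[OF Vp])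
  also have "\<dots> = (\<Sum>i\<in>Basis. V p (\<lambda>q. \<Sum>j\<in>Basis. ?term i j q))"
    by (rule M.tangent_fun_sum[OF Vp]) (intro M.Cinf_sum term_smooth)
  also have "\<dots> = (\<Sum>i\<in>Basis. \<Sum>j\<in>Basis. V p (?term i j))"
    by (intro sum.cong refl M.tangent_fun_sum[OF Vp] term_smooth)
  also have "\<dots> = (\<Sum>i\<in>Basis. \<Sum>j\<in>Basis. lie_bracket V X p (f i) * Y p (f j) * k i j p
      + X p (f i) * lie_bracket V Y p (f j) * k i j p)"
  proof (intro sum.cong refl)
    fix i j :: 'n assume ij: "i \<in> Basis" "j \<in> Basis"
    have "V p (?term i j) = X p (f i) * Y p (f j) * V p (k i j) + k i j p * V p (\<lambda>q. X q (f i) * Y q (f j))"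
      by (rule M.tangent_mult[OF Vp M.Cinf_mult[OF sm] k[OF ij]])
    also have "V p (\<lambda>q. X q (f i) * Y q (f j))
        = X p (f i) * lie_bracket V Y p (f j) + Y p (f j) * lie_bracket V X p (f i)"
      by (simp only: M.tangent_mult[OF Vp sm] br[OF vf(2) ij(1)] br[OF vf(3) ij(2)])
    finally show "V p (?term i j) = lie_bracket V X p (f i) * Y p (f j) * k i j p
      + X p (f i) * lie_bracket V Y p (f j) * k i j p"
      by (simp add: Vk[OF ij] algebra_simps)
  qed
  also have "\<dots> = gN (F p) (pushfwd N F (lie_bracket V X p)) (pushfwd N F (Y p))
      + gN (F p) (pushfwd N F (X p)) (pushfwd N F (lie_bracket V Y p))"
    by (simp add: push_expand[OF p FW] M.lie_bracket_tangent vf p M.vf_tangent sum.distrib)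
  also have "gN (F p) (pushfwd N F (X p)) (pushfwd N F (lie_bracket V Y p))
      = gN (F p) (pushfwd N F (lie_bracket V Y p)) (pushfwd N F (X p))"
    by (intro N.metric_sym F_points p push_tangent M.lie_bracket_tangent M.vf_tangent vf)
  also have "gN (F p) (pushfwd N F (lie_bracket V X p)) (pushfwd N F (Y p)) + \<dots>
      = (dil p)\<^sup>2 * (gM p (lie_bracket V X p) (Y p) + gM p (lie_bracket V Y p) (X p))"
    using X Y p
    by (simp add: conformal_left[symmetric] M.lie_bracket_tangent vf sections_def distrib_left)
  finally have "gM p (lie_bracket V X p) (Y p) + gM p (lie_bracket V Y p) (X p) = 0"
    using dil_pos[OF p] by simp
  then show ?thesis
    using M.metric_sym[OF p M.lie_bracket_tangent[OF vf(1,3) p] M.vf_tangent[OF vf(2) p]] by simp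
qed

end

lemma (in conformal_submersion) hor_full:
  assumes "p \<in> points M" "vert p = {0}"
  shows "horz p = tangent_space M p"
proof -
  have "gM p v w = 0" if "v \<in> tangent_space M p" "w \<in> vert p" for v w
    using that(2) M.metric_zero(2)[OF assms(1) that(1)] unfolding assms(2) by blast
  then show ?thesis by (auto simp: hor_def)
qed

text \<open>Here the differential is an isomorphism of tangent spaces. Read in frames at one point, it is the
  linear isomorphism \<open>L\<close> between the model spaces.\<close>

lemma (in conformal_submersion) integrable_if_vertical_trivial:
  assumes ver0: "\<And>p. p \<in> points M \<Longrightarrow> vert p = {0}"
  shows "integrable_distribution TYPE('n) M horz"
  unfolding integrable_distribution_def
proof
  fix p assume p: "p \<in> points M"
  obtain e :: "'m \<Rightarrow> 'a tvec" and y where e: "\<And>b. b \<in> Basis \<Longrightarrow> e b \<in> tangent_space M p"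
    and ey: "\<And>b c. b \<in> Basis \<Longrightarrow> c \<in> Basis \<Longrightarrow> e b (y c) = (if b = c then 1 else 0)"
    and span: "\<And>v. v \<in> tangent_space M p \<Longrightarrow> v = (\<Sum>b\<in>Basis. v (y b) \<cdot> e b)"
    by (rule M.local_frame_basis[OF p]) (rule that)
  obtain e' :: "'n \<Rightarrow> 'b tvec" and y' where e': "\<And>b. b \<in> Basis \<Longrightarrow> e' b \<in> tangent_space N (F p)"
    and ey': "\<And>b c. b \<in> Basis \<Longrightarrow> c \<in> Basis \<Longrightarrow> e' b (y' c) = (if b = c then 1 else 0)"
    and span': "\<And>v. v \<in> tangent_space N (F p) \<Longrightarrow> v = (\<Sum>b\<in>Basis. v (y' b) \<cdot> e' b)"
    by (rule N.local_frame_basis[OF F_points[OF p]]) (rule that)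
  define c where "c = (\<lambda>x::'m. \<Sum>b\<in>Basis. (x \<bullet> b) \<cdot> e b)"
  have c: "c x \<in> tangent_space M p" for x unfolding c_def by (intro M.tangent_sum M.tangent_scale e)
  have cy: "c x (y b) = x \<bullet> b" if "b \<in> Basis" for x b
  proof -
    have "c x (y b) = (\<Sum>d\<in>Basis. if d = b then x \<bullet> d else 0)"
      unfolding c_def sum_fun_apply by (rule sum.cong) (use that in \<open>auto simp: ey\<close>)
    then show ?thesis using that by simp
  qed
  have push_c: "pushfwd N F (c x) h = (\<Sum>b\<in>Basis. (x \<bullet> b) * pushfwd N F (e b) h)" for x h
    by (simp add: c_def pushfwd_sum pushfwd_tscale sum_fun_apply)
  define L where "L = (\<lambda>x::'m. \<Sum>j\<in>Basis. pushfwd N F (c x) (y' j) *\<^sub>R j)"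
  have Lj: "L x \<bullet> j = pushfwd N F (c x) (y' j)" if "j \<in> Basis" for x j
    using that by (simp add: L_def inner_sum_left inner_Basis if_distrib cong: if_cong)
  have lin: "linear L"
  proof (rule linearI)
    show "L (x + z) = L x + L z" for x z
      by (rule euclidean_eqI) (simp add: Lj push_c inner_add_left algebra_simps sum.distrib)
    show "L (s *\<^sub>R x) = s *\<^sub>R L x" for s x
      by (rule euclidean_eqI) (simp add: Lj push_c sum_distrib_left algebra_simps)
  qed
  have inj: "inj L"
  proof (subst linear_injective_0[OF lin], safe)
    fix x assume "L x = 0"
    then have "pushfwd N F (c x) (y' j) = 0" if "j \<in> Basis" for j using Lj[OF that, of x] by simp
    then have "(\<Sum>b\<in>Basis. pushfwd N F (c x) (y' b) \<cdot> e' b) = 0" by simp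
    then have "pushfwd N F (c x) = 0" by (simp only: span'[OF push_tangent[OF c], symmetric])
    then have "c x \<in> vert p" using c by (simp add: ver_def)
    then have "c x = 0" using ver0[OF p] by simp
    then have "x \<bullet> b = 0" if "b \<in> Basis" for b using cy[OF that, of x] by simp
    then show "x = 0" by (simp add: euclidean_eq_iff[of x 0])
  qed
  have "\<exists>x. L x = z" for z
  proof -
    let ?w = "\<Sum>j\<in>Basis. (z \<bullet> j) \<cdot> e' j"
    have "?w \<in> tangent_space N (F p)" by (intro N.tangent_sum N.tangent_scale e')
    then obtain v where v: "v \<in> tangent_space M p" "pushfwd N F v = ?w" using push_surj[OF p] by blast
    define x where "x = (\<Sum>b\<in>Basis. v (y b) *\<^sub>R b)"
    have "x \<bullet> b = v (y b)" if "b \<in> Basis" for b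
      using that by (simp add: x_def inner_sum_left inner_Basis if_distrib cong: if_cong)
    then have "c x = (\<Sum>b\<in>Basis. v (y b) \<cdot> e b)" unfolding c_def by (intro sum.cong) auto
    then have cv: "c x = v" by (simp only: span[OF v(1), symmetric])
    have "L x \<bullet> j = z \<bullet> j" if j: "j \<in> Basis" for j
    proof -
      have "?w (y' j) = (\<Sum>i\<in>Basis. if i = j then z \<bullet> i else 0)"
        unfolding sum_fun_apply by (rule sum.cong) (use j in \<open>auto simp: ey'\<close>)
      then show ?thesis using j by (simp add: Lj cv v(2))
    qed
    then have "L x = z" by (rule euclidean_eqI)
    then show ?thesis by (rule exI)
  qed
  then have surj: "surj L" unfolding surj_def by (metis (no_types))
  have "linear (inv L)"
  proof (rule linearI)
    show "inv L (a + b) = inv L a + inv L b" for a b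
      by (rule injD[OF inj]) (simp add: linear_add[OF lin] surj_f_inv_f[OF surj])
    show "inv L (s *\<^sub>R a) = s *\<^sub>R inv L a" for s a
      by (rule injD[OF inj]) (simp add: linear_scale[OF lin] surj_f_inv_f[OF surj])
  qed
  from integral_manifold_full[OF M.manifold lin this inv_f_f[OF inj] surj_f_inv_f[OF surj], of horz]
  have "integral_manifold M horz \<lparr>mtop = mtop M, atlas = (\<lambda>(U, \<kappa>). (U, L \<circ> \<kappa>)) ` atlas M\<rparr>"
    using hor_full ver0 by simp
  then show "\<exists>S :: ('a, 'n) mfd. integral_manifold M horz S \<and> p \<in> points S"
    using p by force
qed

section \<open>Sasakian total spaces\<close>

locale sasakian_submersion = conformal_submersion M gM N gN F dil
  for M :: "('a, 'm::euclidean_space) mfd" and gM and N :: "('b, 'n::euclidean_space) mfd" and gN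
    and F :: "'a \<Rightarrow> 'b" and dil +
  fixes \<phi> :: "'a \<Rightarrow> 'a tvec \<Rightarrow> 'a tvec" and \<xi> :: "'a \<Rightarrow> 'a tvec" and \<eta> :: "'a \<Rightarrow> 'a tvec \<Rightarrow> real"
    and nabM :: "('a \<Rightarrow> 'a tvec) \<Rightarrow> ('a \<Rightarrow> 'a tvec) \<Rightarrow> ('a \<Rightarrow> 'a tvec)"
    and nabF :: "('a \<Rightarrow> 'a tvec) \<Rightarrow> ('a \<Rightarrow> 'b tvec) \<Rightarrow> ('a \<Rightarrow> 'b tvec)"
  assumes sasakian: "sasakian M \<phi> \<xi> \<eta> gM nabM"
    and anti_invariant: "conformal_anti_invariant_xi_perp_submersion M \<phi> \<xi> \<eta> gM N gN F dil"
    and connection_F: "connection M (fields_along M N F) nabF"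
begin

lemma almost_contact: "almost_contact_metric M \<phi> \<xi> \<eta> gM"
  using sasakian by (simp add: sasakian_def)

lemma xi_field: "\<xi> \<in> vector_fields M"
  using almost_contact by (simp add: almost_contact_metric_def)

lemma phi_tensor: "tensor11 M \<phi>"
  using almost_contact by (simp add: almost_contact_metric_def)

lemma phi_field: "X \<in> vector_fields M \<Longrightarrow> along M \<phi> X \<in> vector_fields M"
  using phi_tensor by (simp add: tensor11_def)

lemma along_apply: "p \<in> points M \<Longrightarrow> along M T X p = T p (X p)"
  by (simp add: along_def)

lemma phi_tangent: "p \<in> points M \<Longrightarrow> u \<in> tangent_space M p \<Longrightarrow> \<phi> p u \<in> tangent_space M p"
  using phi_tensor unfolding tensor11_def by blast

lemma phi_zero: "p \<in> points M \<Longrightarrow> \<phi> p 0 = 0"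
proof -
  assume p: "p \<in> points M"
  have "\<phi> p (0 \<cdot> 0 + 0 \<cdot> 0) = 0 \<cdot> \<phi> p 0 + 0 \<cdot> \<phi> p 0"
    using phi_tensor p M.tangent_zero[of p] unfolding tensor11_def by blast
  then show ?thesis by simp
qed

context
  fixes p assumes p: "p \<in> points M"
begin

lemma contact_point:
  "\<phi> p (\<xi> p) = 0" "\<eta> p (\<xi> p) = 1"
  and contact_vector: "u \<in> tangent_space M p \<Longrightarrow> \<eta> p (\<phi> p u) = 0"
    "u \<in> tangent_space M p \<Longrightarrow> \<phi> p (\<phi> p u) = - u + \<eta> p u \<cdot> \<xi> p"
  and contact_metric: "u \<in> tangent_space M p \<Longrightarrow> v \<in> tangent_space M p \<Longrightarrow>
    gM p (\<phi> p u) (\<phi> p v) = gM p u v - \<eta> p u * \<eta> p v"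
  using almost_contact p unfolding almost_contact_metric_def by blast+

lemma xi_tangent: "\<xi> p \<in> tangent_space M p"
  by (rule M.vf_tangent[OF xi_field p])

lemma xi_hor: "\<xi> p \<in> horz p" and phi_ver_hor: "v \<in> vert p \<Longrightarrow> \<phi> p v \<in> horz p"
  using anti_invariant p unfolding conformal_anti_invariant_xi_perp_submersion_def by blast+

lemma metric_xi: "u \<in> tangent_space M p \<Longrightarrow> gM p u (\<xi> p) = \<eta> p u"
  using contact_metric[OF _ xi_tangent, of u] contact_point M.metric_zero(2)[OF p phi_tangent[OF p], of u]
  by simp

lemma eta_ver: "v \<in> vert p \<Longrightarrow> \<eta> p v = 0"
  using metric_xi[OF ver_tangent] hor_ver_orthogonal[OF xi_hor] M.metric_sym[OF p ver_tangent xi_tangent]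
  by simp

lemma phi_phi_ver: "v \<in> vert p \<Longrightarrow> \<phi> p (\<phi> p v) = - v"
  by (simp add: contact_vector ver_tangent eta_ver)

lemma metric_phi_ver: "v \<in> vert p \<Longrightarrow> gM p (\<phi> p v) (\<phi> p v) = gM p v v"
  by (simp add: contact_metric ver_tangent eta_ver)

lemma metric_xi_phi_ver: "v \<in> vert p \<Longrightarrow> gM p (\<xi> p) (\<phi> p v) = 0"
  using metric_xi[OF phi_tangent[OF p ver_tangent]] contact_vector(1)[OF ver_tangent]
    M.metric_sym[OF p phi_tangent[OF p ver_tangent] xi_tangent] by simp

end

lemma levi_civita: "levi_civita M gM nabM"
  using sasakian by (simp add: sasakian_def)

lemma connection_M: "connection M (vector_fields M) nabM"
  using levi_civita by (simp add: levi_civita_def)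

lemma nabla_field: "X \<in> vector_fields M \<Longrightarrow> Y \<in> vector_fields M \<Longrightarrow> nabM X Y \<in> vector_fields M"
  using connection_M by (simp add: connection_def)

lemma nabla_tangent:
  "X \<in> vector_fields M \<Longrightarrow> Y \<in> vector_fields M \<Longrightarrow> p \<in> points M \<Longrightarrow> nabM X Y p \<in> tangent_space M p"
  by (intro M.vf_tangent nabla_field)

lemma torsion_free:
  assumes "X \<in> vector_fields M" "Y \<in> vector_fields M"
  shows "lie_bracket X Y p = nabM X Y p - nabM Y X p"
proof -
  have "nabM X Y - nabM Y X = lie_bracket X Y"
    using levi_civita assms by (simp add: levi_civita_def)
  then have "lie_bracket X Y p = (nabM X Y - nabM Y X) p" by simp
  then show ?thesis by simp
qed

lemma nabla_xi: "X \<in> vector_fields M \<Longrightarrow> p \<in> points M \<Longrightarrow> nabM X \<xi> p = \<phi> p (X p)"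
  using sasakian by (simp add: sasakian_def along_apply)

lemma connection_zero:
  assumes "connection M E nab" "X \<in> vector_fields M" "0 \<in> E"
  shows "nab X 0 = 0"
proof -
  have "nab X (0 + 0) = nab X 0 + nab X 0" using assms unfolding connection_def by blast
  then show ?thesis by simp
qed

lemma nabla_uminus:
  assumes X: "X \<in> vector_fields M" and Y: "Y \<in> vector_fields M" and Y': "- Y \<in> vector_fields M"
  shows "nabM X (- Y) p = - nabM X Y p"
proof -
  have "nabM X (Y + - Y) = nabM X Y + nabM X (- Y)"
    using connection_M assms unfolding connection_def by blast
  then have "nabM X Y + nabM X (- Y) = 0"
    using connection_zero[OF connection_M X M.vf_zero] by simp
  then have "(nabM X Y + nabM X (- Y)) p = 0" by simp
  then show ?thesis by (simp add: add_eq_0_iff)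
qed

lemma orthogonal_fields_nabla:
  assumes X: "X \<in> vector_fields M" and Y: "Y \<in> vector_fields M" and Z: "Z \<in> vector_fields M"
    and orth: "\<And>q. q \<in> points M \<Longrightarrow> gM q (Y q) (Z q) = 0" and p: "p \<in> points M"
  shows "gM p (nabM X Y p) (Z p) = - gM p (Y p) (nabM X Z p)"
proof -
  have Xp: "X p \<in> tangent_space M p" by (rule M.vf_tangent[OF X p])
  have "X p (\<lambda>q. gM q (Y q) (Z q)) = X p (\<lambda>q. 0)"
    by (rule M.tangent_local[OF Xp M.metric_smooth[OF Y Z] M.Cinf_const, where W = "points M"])
      (use orth p in auto)
  moreover have "X p (\<lambda>q. gM q (Y q) (Z q)) = gM p (nabM X Y p) (Z p) + gM p (Y p) (nabM X Z p)"
    using levi_civita X Y Z p unfolding levi_civita_def by blast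
  ultimately show ?thesis using M.tangent_fun_const[OF Xp, of 0] by simp
qed

lemma xi_section: "\<xi> \<in> sections M horz"
  unfolding sections_def using xi_field xi_hor by auto

context
  fixes V assumes V: "V \<in> sections M vert"
begin

lemma V_field: "V \<in> vector_fields M" and V_ver: "p \<in> points M \<Longrightarrow> V p \<in> vert p"
  using V by (auto simp: sections_def)

lemma phi_V_field: "along M \<phi> V \<in> vector_fields M"
  by (rule phi_field[OF V_field])

lemma phi_V_hor: "along M \<phi> V \<in> sections M horz"
  unfolding sections_def using phi_V_field V_ver phi_ver_hor by (auto simp: along_apply)

text \<open>The fields \<open>\<xi>\<close> and \<open>\<phi> V\<close> are orthogonal, so that conformality gives
  \<open>g([V, \<xi>], \<phi> V) + g(\<xi>, [V, \<phi> V]) = 0\<close>. Writing the brackets with the connection, all terms but one are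
  computed by \<open>\<nabla>\<^sub>X \<xi> = \<phi> X\<close>.\<close>

lemma nabla_xi_V:
  assumes p: "p \<in> points M"
  shows "gM p (nabM \<xi> V p) (\<phi> p (V p)) = - gM p (V p) (V p)"
proof -
  let ?X = "along M \<phi> V"
  note Vp = V_ver[OF p] ver_tangent[OF V_ver[OF p]]
  note phiVp = phi_tangent[OF p Vp(2)]
  have Xp: "?X p = \<phi> p (V p)" by (rule along_apply[OF p])
  have orth: "gM q (\<xi> q) (?X q) = 0" if "q \<in> points M" for q
    using metric_xi_phi_ver[OF that V_ver[OF that]] by (simp add: along_apply[OF that])
  have orth': "gM q (\<xi> q) (V q) = 0" if "q \<in> points M" for q
    by (rule hor_ver_orthogonal[OF xi_hor[OF that] V_ver[OF that]])
  have "gM p (nabM V \<xi> p) (?X p) = - gM p (\<xi> p) (nabM V ?X p)"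
    by (rule orthogonal_fields_nabla[OF V_field xi_field phi_V_field orth p])
  then have 1: "gM p (\<xi> p) (nabM V ?X p) = - gM p (V p) (V p)"
    by (simp add: nabla_xi[OF V_field p] Xp metric_phi_ver[OF p Vp(1)])
  have "gM p (nabM ?X \<xi> p) (V p) = - gM p (\<xi> p) (nabM ?X V p)"
    by (rule orthogonal_fields_nabla[OF phi_V_field xi_field V_field orth' p])
  then have 2: "gM p (\<xi> p) (nabM ?X V p) = gM p (V p) (V p)"
    by (simp add: nabla_xi[OF phi_V_field p] Xp phi_phi_ver[OF p Vp(1)] M.metric_uminus[OF p Vp(2) Vp(2)])
  have "gM p (lie_bracket V \<xi> p) (?X p) + gM p (\<xi> p) (lie_bracket V ?X p) = 0"
    by (rule conformal_lie_bracket[OF V xi_section phi_V_hor orth p])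
  moreover have "gM p (lie_bracket V \<xi> p) (?X p) = gM p (V p) (V p) - gM p (nabM \<xi> V p) (\<phi> p (V p))"
    by (simp add: torsion_free[OF V_field xi_field] nabla_xi[OF V_field p] Xp metric_phi_ver[OF p Vp(1)]
        M.metric_diff(1)[OF p phiVp nabla_tangent[OF xi_field V_field p] phiVp])
  moreover have "gM p (\<xi> p) (lie_bracket V ?X p) = - 2 * gM p (V p) (V p)"
    by (simp add: torsion_free[OF V_field phi_V_field] 1 2
        M.metric_diff(2)[OF p nabla_tangent[OF V_field phi_V_field p] nabla_tangent[OF phi_V_field V_field p]
          xi_tangent[OF p]])
  ultimately show ?thesis by simp
qed

text \<open>The obstruction to integrability: a bracket of horizontal fields that fails to be horizontal
  wherever \<open>V\<close> does not vanish.\<close>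

lemma lie_bracket_phi_V_xi:
  assumes p: "p \<in> points M"
  shows "gM p (lie_bracket (along M \<phi> V) \<xi> p) (V p) = - 2 * gM p (V p) (V p)"
proof -
  let ?X = "along M \<phi> V"
  note Vp = V_ver[OF p] ver_tangent[OF V_ver[OF p]]
  note phiVp = phi_tangent[OF p Vp(2)]
  have Xp: "?X p = \<phi> p (V p)" by (rule along_apply[OF p])
  have "gM p (nabM \<xi> ?X p) (V p) = - gM p (?X p) (nabM \<xi> V p)"
    by (rule orthogonal_fields_nabla[OF xi_field phi_V_field V_field _ p])
      (use phi_V_hor V_ver hor_ver_orthogonal in \<open>auto simp: sections_def\<close>)
  also have "\<dots> = gM p (V p) (V p)"
    using nabla_xi_V[OF p] by (simp add: Xp M.metric_sym[OF p phiVp nabla_tangent[OF xi_field V_field p]])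
  finally have "gM p (nabM \<xi> ?X p) (V p) = gM p (V p) (V p)" .
  moreover have "gM p (nabM ?X \<xi> p) (V p) = - gM p (V p) (V p)"
    by (simp add: nabla_xi[OF phi_V_field p] Xp phi_phi_ver[OF p Vp(1)] M.metric_uminus[OF p Vp(2) Vp(2)])
  ultimately show ?thesis
    by (simp add: torsion_free[OF phi_V_field xi_field]
        M.metric_diff(1)[OF p nabla_tangent[OF phi_V_field xi_field p] nabla_tangent[OF xi_field phi_V_field p] Vp(2)])
qed

end

lemma vertical_trivial_if_integrable:
  assumes int: "integrable_distribution TYPE('n) M horz" and p: "p \<in> points M"
  shows "vert p = {0}"
proof (rule ccontr)
  assume "vert p \<noteq> {0}"
  then obtain v where v: "v \<in> vert p" "v \<noteq> 0" using ver_zero by blast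
  obtain V where V: "V \<in> sections M vert" "V p = v" by (rule vertical_field_exists[OF p v(1)])
  obtain S :: "('a, 'n) mfd" where S: "integral_manifold M horz S" "p \<in> points S"
    using int p unfolding integrable_distribution_def by blast
  have "lie_bracket (along M \<phi> V) \<xi> p \<in> horz p"
    by (rule integral_manifold_bracket[OF M.manifold S phi_V_hor[OF V(1)] xi_section])
  then have "gM p (lie_bracket (along M \<phi> V) \<xi> p) (V p) = 0"
    by (rule hor_ver_orthogonal) (simp add: V v)
  then have "gM p v v = 0" using lie_bracket_phi_V_xi[OF V(1) p] V(2) by simp
  then show False using M.metric_pos[OF p ver_tangent[OF v(1)] v(2)] by simp
qed

text \<open>The pointwise content of the second assertion of the theorem, for fixed fields.\<close>

definition integrability_identity ::
  "('a \<Rightarrow> 'a tvec) \<Rightarrow> ('a \<Rightarrow> 'a tvec) \<Rightarrow> ('a \<Rightarrow> 'a tvec) \<Rightarrow> 'a \<Rightarrow> bool" where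
  "integrability_identity X Y V p \<longleftrightarrow>
    (let B = along M (Bpart M \<phi> gM N F);
         C = along M (Cpart M \<phi> gM N F);
         A = oneill_A M gM N F nabM;
         push = along M (\<lambda>p. pushfwd N F);
         lnl = (\<lambda>q. ln (dil q))
     in (1 / (dil p)\<^sup>2) * gN (F p) (nabF Y (push (C X)) p - nabF X (push (C Y)) p)
                             (pushfwd N F (\<phi> p (V p)))
       = gM p (A X (B Y) p - A Y (B X) p - C Y p lnl \<cdot> X p + C X p lnl \<cdot> Y p
               - (2 * gM p (C X p) (Y p)) \<cdot> grad M gM lnl p
               - \<eta> p (Y p) \<cdot> X p + \<eta> p (X p) \<cdot> Y p)
           (\<phi> p (V p)))"

text \<open>Since \<open>\<mu>\<close> consists of horizontal vectors, \<open>\<B>\<close> inherits uniqueness from the vertical projection.\<close>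

lemma Bpart_eqI:
  assumes p: "p \<in> points M" and w: "w \<in> vert p" "\<phi> p u - w \<in> mu M \<phi> gM N F p"
  shows "Bpart M \<phi> gM N F p u = w"
  unfolding Bpart_def
proof (rule the_equality)
  fix z assume z: "z \<in> vert p \<and> \<phi> p u - z \<in> mu M \<phi> gM N F p"
  have "vproj M gM N F p (\<phi> p u) = z" "vproj M gM N F p (\<phi> p u) = w"
    using w z by (auto intro!: vproj_eqI[OF p] simp: mu_def)
  then show "z = w" by simp
qed (use w in blast)

lemma mu_zero: "p \<in> points M \<Longrightarrow> 0 \<in> mu M \<phi> gM N F p"
  by (auto simp: mu_def hor_zero M.metric_zero phi_tangent ver_tangent)

lemma field_zero_outside: "X \<in> vector_fields M \<Longrightarrow> (\<And>p. p \<in> points M \<Longrightarrow> X p = Z p) \<Longrightarrow>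
    (\<lambda>p. if p \<in> points M then Z p else 0) = X"
  using M.vf_outside by (auto simp: fun_eq_iff)

lemma along_hproj_hor:
  assumes "X \<in> sections M horz"
  shows "along M (hproj M gM N F) X = X"
  unfolding along_def
  by (rule field_zero_outside) (use assms in \<open>auto simp: sections_def hproj_def vproj_hor\<close>)

lemma along_zero:
  assumes "\<And>p. p \<in> points M \<Longrightarrow> T p (X p) = 0"
  shows "along M T X = 0"
  using assms by (auto simp: along_def fun_eq_iff)

lemma oneill_A_zero:
  assumes X: "X \<in> sections M horz"
  shows "oneill_A M gM N F nabM X 0 = 0"
proof -
  have Xf: "X \<in> vector_fields M" using X by (simp add: sections_def)
  have v0: "along M (vproj M gM N F) 0 = 0" by (rule along_zero) (simp add: vproj_ver ver_zero)
  have h0: "along M (hproj M gM N F) 0 = 0" by (rule along_zero) (simp add: hproj_def vproj_ver ver_zero)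
  show ?thesis
    by (simp add: oneill_A_def Let_def along_hproj_hor[OF X] v0 h0 connection_zero[OF connection_M Xf M.vf_zero])
qed

lemma oneill_A_ver:
  assumes X: "X \<in> sections M horz" and V: "V \<in> sections M vert" and p: "p \<in> points M"
  shows "oneill_A M gM N F nabM X V p = hproj M gM N F p (nabM X V p)"
proof -
  have f: "X \<in> vector_fields M" "V \<in> vector_fields M" using X V by (auto simp: sections_def)
  have vV: "along M (vproj M gM N F) V = V"
    unfolding along_def by (rule field_zero_outside) (use V in \<open>auto simp: sections_def vproj_ver\<close>)
  have hV: "along M (hproj M gM N F) V = 0"
    by (rule along_zero) (use V in \<open>auto simp: sections_def hproj_def vproj_ver\<close>)
  have v0: "along M (vproj M gM N F) 0 = 0" by (rule along_zero) (simp add: vproj_ver ver_zero)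
  show ?thesis
    by (simp add: oneill_A_def Let_def along_hproj_hor[OF X] vV hV v0 along_apply[OF p]
        connection_zero[OF connection_M f(1) M.vf_zero])
qed

text \<open>For \<open>X = \<phi> V\<close> and \<open>Y = \<xi>\<close> one has \<open>\<C> X = \<C> Y = 0\<close>, \<open>\<B> X = - V\<close> and \<open>\<B> Y = 0\<close>. The left side
  of the identity vanishes, while the right side is \<open>g(\<nabla>\<^sub>\<xi> V, \<phi> V) - g(V, V) = - 2 g(V, V)\<close>.\<close>

lemma vertical_zero_if_identity:
  assumes V: "V \<in> sections M vert" and p: "p \<in> points M"
    and id: "integrability_identity (along M \<phi> V) \<xi> V p"
  shows "V p = 0"
proof -
  let ?X = "along M \<phi> V"
  note Vf = V_field[OF V] and Vv = V_ver[OF V] and Xf = phi_V_field[OF V]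
  have mV_ver: "- V q \<in> vert q" if "q \<in> points M" for q
    using ver_diff[OF ver_zero Vv[OF that]] by simp
  have mV: "- V \<in> vector_fields M"
  proof -
    have "- V = fscale (\<lambda>_. - 1) V" by (auto simp: fun_eq_iff)
    then show ?thesis using M.vf_fscale[OF M.Cinf_const Vf] by simp
  qed
  have mVs: "- V \<in> sections M vert" using mV mV_ver by (simp add: sections_def)
  have BX: "Bpart M \<phi> gM N F q (?X q) = - V q" if q: "q \<in> points M" for q
    by (rule Bpart_eqI[OF q mV_ver[OF q]])
      (simp add: along_apply[OF q] phi_phi_ver[OF q Vv[OF q]] mu_zero[OF q])
  have BY: "Bpart M \<phi> gM N F q (\<xi> q) = 0" if q: "q \<in> points M" for q
    by (rule Bpart_eqI[OF q ver_zero]) (simp add: contact_point[OF q] mu_zero[OF q])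
  have B: "along M (Bpart M \<phi> gM N F) ?X = - V" "along M (Bpart M \<phi> gM N F) \<xi> = 0"
  proof -
    show "along M (Bpart M \<phi> gM N F) ?X = - V"
      unfolding along_def[of M "Bpart M \<phi> gM N F"] by (rule field_zero_outside[OF mV]) (simp add: BX)
    show "along M (Bpart M \<phi> gM N F) \<xi> = 0" by (rule along_zero) (rule BY)
  qed
  have C: "along M (Cpart M \<phi> gM N F) ?X = 0" "along M (Cpart M \<phi> gM N F) \<xi> = 0"
  proof -
    show "along M (Cpart M \<phi> gM N F) ?X = 0"
    proof (rule along_zero)
      fix q assume q: "q \<in> points M"
      show "Cpart M \<phi> gM N F q (?X q) = 0"
        unfolding Cpart_def unfolding BX[OF q] by (simp add: along_apply[OF q] phi_phi_ver[OF q Vv[OF q]])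
    qed
    show "along M (Cpart M \<phi> gM N F) \<xi> = 0"
      by (rule along_zero) (simp add: Cpart_def BY contact_point)
  qed
  have push0: "along M (\<lambda>p. pushfwd N F) 0 = 0" by (rule along_zero) simp
  have zero_along: "0 \<in> fields_along M N F"
    by (simp add: fields_along_def N.tangent_zero M.Cinf_const)
  note nabF0 = connection_zero[OF connection_F _ zero_along]
  let ?D = "nabM \<xi> V p" and ?w = "\<phi> p (V p)"
  have D: "?D \<in> tangent_space M p" by (rule nabla_tangent[OF xi_field Vf p])
  have wh: "?w \<in> horz p" by (rule phi_ver_hor[OF p Vv[OF p]])
  have w: "?w \<in> tangent_space M p" by (rule hor_tangent[OF wh])
  let ?H = "hproj M gM N F p (- ?D)"
  have mD: "- ?D \<in> tangent_space M p" by (rule M.tangent_uminus[OF D])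
  have H: "?H \<in> tangent_space M p" by (rule hor_tangent[OF hproj_props(1)[OF p mD]])
  have "gM p (- ?D - ?H) ?w = 0"
    using hor_ver_orthogonal[OF wh hproj_props(2)[OF p mD]] M.metric_sym[OF p w M.tangent_diff[OF mD H]] by simp
  then have gH: "gM p ?H ?w = gM p (V p) (V p)"
    using nabla_xi_V[OF V p] by (simp add: M.metric_diff(1)[OF p mD H w] M.metric_uminus(1)[OF p D w])
  have eta0: "\<eta> p ?w = 0" by (rule contact_vector(1)[OF p ver_tangent[OF Vv[OF p]]])
  have "0 = gM p (- ?H - ?w) ?w"
    using id
    by (simp add: integrability_identity_def Let_def B C push0 nabF0 xi_field Xf oneill_A_zero phi_V_hor[OF V]
        oneill_A_ver[OF xi_section mVs p] nabla_uminus[OF xi_field Vf mV] along_apply[OF p, of \<phi>]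
        contact_point[OF p] eta0 N.metric_zero[OF F_points[OF p]] push_tangent w M.metric_zero xi_tangent p)
  also have "\<dots> = - 2 * gM p (V p) (V p)"
    by (simp add: M.metric_diff(1)[OF p M.tangent_uminus[OF H] w w] M.metric_uminus(1)[OF p H w] gH
        metric_phi_ver[OF p Vv[OF p]])
  finally show ?thesis using M.metric_pos[OF p ver_tangent[OF Vv[OF p]]] by force
qed

lemma identity_if_vertical_trivial:
  assumes ver0: "\<And>q. q \<in> points M \<Longrightarrow> vert q = {0}" and p: "p \<in> points M"
    and X: "X \<in> sections M horz" and Y: "Y \<in> sections M horz" and V: "V \<in> sections M vert"
  shows "integrability_identity X Y V p"
proof -
  have Vp: "V p = 0" using V ver0[OF p] p by (auto simp: sections_def)
  have B0: "Bpart M \<phi> gM N F q u = 0" if q: "q \<in> points M" and u: "u \<in> tangent_space M q" for q u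
    by (rule Bpart_eqI[OF q ver_zero])
      (use ver0[OF q] hor_full[OF q] in \<open>auto simp: mu_def phi_tangent q u phi_zero M.metric_zero\<close>)
  have B: "along M (Bpart M \<phi> gM N F) Z = 0" if "Z \<in> vector_fields M" for Z
    by (rule along_zero) (simp add: B0 M.vf_tangent that)
  have C: "along M (Cpart M \<phi> gM N F) Z \<in> vector_fields M" if Z: "Z \<in> vector_fields M" for Z
  proof -
    have "along M (Cpart M \<phi> gM N F) Z = along M \<phi> Z"
      using M.vf_tangent[OF Z] by (auto simp: along_def fun_eq_iff Cpart_def B0)
    then show ?thesis using phi_field[OF Z] by simp
  qed
  have f: "X \<in> vector_fields M" "Y \<in> vector_fields M" using X Y by (auto simp: sections_def)
  have push: "along M (\<lambda>p. pushfwd N F) Z \<in> fields_along M N F" if Z: "Z \<in> vector_fields M" for Z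
  proof -
    have "(\<lambda>p. along M (\<lambda>p. pushfwd N F) Z p h) = (\<lambda>p. Z p (\<lambda>x. h (F x)))" if h: "h \<in> Cinf N" for h
      using M.vf_outside[OF Z] by (auto simp: along_def fun_eq_iff pushfwd_apply[OF h])
    then show ?thesis
      using M.vf_smooth[OF Z] push_tangent[OF M.vf_tangent[OF Z]]
      by (simp add: fields_along_def along_def[of M _ Z])
  qed
  have nab: "nabF Z W p \<in> tangent_space N (F p)" if "Z \<in> vector_fields M" "W \<in> fields_along M N F" for Z W
  proof -
    have "nabF Z W \<in> fields_along M N F" using connection_F that by (simp add: connection_def)
    then show ?thesis using p by (simp add: fields_along_def)
  qed
  show ?thesis
    unfolding integrability_identity_def Let_def B[OF f(1)] B[OF f(2)] oneill_A_zero[OF X] oneill_A_zero[OF Y] Vp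
    by (simp add: phi_zero[OF p] N.metric_zero[OF F_points[OF p]] M.metric_zero[OF p] N.tangent_diff nab push C f
        M.tangent_diff M.tangent_add M.tangent_scale M.tangent_uminus M.tangent_zero M.vf_tangent p M.grad_tangent)
qed

lemma integrable_iff_vertical_trivial:
  "integrable_distribution TYPE('n) M horz \<longleftrightarrow> (\<forall>p\<in>points M. vert p = {0})"
  using vertical_trivial_if_integrable integrable_if_vertical_trivial by blast

lemma identity_iff_vertical_trivial:
  "(\<forall>X\<in>sections M horz. \<forall>Y\<in>sections M horz. \<forall>V\<in>sections M vert. \<forall>p\<in>points M.
      integrability_identity X Y V p) \<longleftrightarrow> (\<forall>p\<in>points M. vert p = {0})"
proof
  assume id: "\<forall>X\<in>sections M horz. \<forall>Y\<in>sections M horz. \<forall>V\<in>sections M vert. \<forall>p\<in>points M.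
      integrability_identity X Y V p"
  show "\<forall>p\<in>points M. vert p = {0}"
  proof safe
    fix p v assume p: "p \<in> points M" and v: "v \<in> vert p"
    obtain V where V: "V \<in> sections M vert" "V p = v" by (rule vertical_field_exists[OF p v])
    have "integrability_identity (along M \<phi> V) \<xi> V p"
      using id phi_V_hor[OF V(1)] xi_section V(1) p by blast
    then show "v = 0" using vertical_zero_if_identity[OF V(1) p] V(2) by simp
  qed (rule ver_zero)
next
  assume "\<forall>p\<in>points M. vert p = {0}"
  then have ver0: "vert q = {0}" if "q \<in> points M" for q using that by blast
  show "\<forall>X\<in>sections M horz. \<forall>Y\<in>sections M horz. \<forall>V\<in>sections M vert. \<forall>p\<in>points M.
      integrability_identity X Y V p"
    by (intro ballI identity_if_vertical_trivial[OF ver0])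
qed

end

theorem theorem3p1:
  fixes M :: "('a, 'm::euclidean_space) mfd" and N :: "('b, 'n::euclidean_space) mfd"
    and \<phi> :: "'a \<Rightarrow> 'a tvec \<Rightarrow> 'a tvec" and \<xi> :: "'a \<Rightarrow> 'a tvec" and \<eta> :: "'a \<Rightarrow> 'a tvec \<Rightarrow> real"
    and gM :: "'a metric_tensor" and gN :: "'b metric_tensor"
    and \<pi> :: "'a \<Rightarrow> 'b" and dil :: "'a \<Rightarrow> real"
    and nabM :: "('a \<Rightarrow> 'a tvec) \<Rightarrow> ('a \<Rightarrow> 'a tvec) \<Rightarrow> ('a \<Rightarrow> 'a tvec)"
    and nabN :: "('b \<Rightarrow> 'b tvec) \<Rightarrow> ('b \<Rightarrow> 'b tvec) \<Rightarrow> ('b \<Rightarrow> 'b tvec)"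
    and nab\<pi> :: "('a \<Rightarrow> 'a tvec) \<Rightarrow> ('a \<Rightarrow> 'b tvec) \<Rightarrow> ('a \<Rightarrow> 'b tvec)"
  assumes "sasakian M \<phi> \<xi> \<eta> gM nabM"
    and "conformal_anti_invariant_xi_perp_submersion M \<phi> \<xi> \<eta> gM N gN \<pi> dil"
    and "\<pi> ` points M = points N"
    and "levi_civita N gN nabN"
    and "pullback_connection M N \<pi> nabN nab\<pi>"
  shows "integrable_distribution TYPE('n) M (hor M gM N \<pi>) \<longleftrightarrow>
    (\<forall>X \<in> sections M (hor M gM N \<pi>). \<forall>Y \<in> sections M (hor M gM N \<pi>). \<forall>V \<in> sections M (ver M N \<pi>).
       let B = along M (Bpart M \<phi> gM N \<pi>);
           C = along M (Cpart M \<phi> gM N \<pi>);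
           A = oneill_A M gM N \<pi> nabM;
           push = along M (\<lambda>p. pushfwd N \<pi>);
           lnl = (\<lambda>q. ln (dil q))
       in \<forall>p \<in> points M.
         (1 / (dil p)\<^sup>2) * gN (\<pi> p) (nab\<pi> Y (push (C X)) p - nab\<pi> X (push (C Y)) p)
                               (pushfwd N \<pi> (\<phi> p (V p)))
         = gM p (A X (B Y) p - A Y (B X) p - C Y p lnl \<cdot> X p + C X p lnl \<cdot> Y p
                 - (2 * gM p (C X p) (Y p)) \<cdot> grad M gM lnl p
                 - \<eta> p (Y p) \<cdot> X p + \<eta> p (X p) \<cdot> Y p)
             (\<phi> p (V p)))"
proof -
  interpret sasakian_submersion M gM N gN \<pi> dil \<phi> \<xi> \<eta> nabM nab\<pi>
    by unfold_locales
      (use assms in \<open>simp_all add: conformal_anti_invariant_xi_perp_submersion_def almost_contact_metric_def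
        pullback_connection_def\<close>)
  show ?thesis
    using integrable_iff_vertical_trivial identity_iff_vertical_trivial
    unfolding integrability_identity_def Let_def by blast
qed

end
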